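(* Let $M$ be a $3$-dimensional regular Sasaki manifold with Boothby-Wang fibering $\pi:M\to\bar M$, let $\bar\gamma$ be a unit-speed curve in $\bar M$, and let $\iota:S_{\bar\gamma}\to M$ be the Hopf cylinder over $\bar\gamma$, with mean curvature $H$ and mean curvature vector field $\mathbb H$. Then $\Delta\mathbb H=\lambda\mathbb H$ holds in $\iota^*TM$ for some $\lambda\in\mathbf R$ if and only if $\bar\gamma$ is a geodesic (in which case the equation holds with $\lambda=0$) or a Riemannian circle (with $\lambda\ne0$). In the latter, non-geodesic, case the eigenvalue is $\lambda=4H^2+2>2$.
   Context: Conventions. A contact Riemannian $3$-manifold is $(M,\eta,\xi,\varphi,g)$ with $\eta$ a contact form, $\xi$ its Reeb vector field ($\eta(\xi)=1$, $d\eta(\xi,\cdot)=0$), $\varphi$ an endomorphism field and $g$ a Riemannian metric such that $\varphi^2=-I+\eta\otimes\xi$, $g(\varphi X,\varphi Y)=g(X,Y)-\eta(X)\eta(Y)$, $g(\xi,\cdot)=\eta$, $d\eta(X,Y)=2g(X,\varphi Y)$, where $d\eta(X,Y)=X\eta(Y)-Y\eta(X)-\eta([X,Y])$. It is a Sasaki manifold if $(\nabla_X\varphi)Y=g(X,Y)\xi-\eta(Y)X$; then $\xi$ is Killing and $\nabla_X\xi=-\varphi X$. It is regular if $\xi$ generates a one-parameter group $K$ of isometries acting simply transitively on each orbit, with orbit space $\bar M=M/K$ a smooth surface; $\bar M$ carries the metric making $\pi:M\to\bar M$ (the Boothby-Wang fibering) a Riemannian submersion and the complex structure $J\bar X=\pi_*(\varphi\bar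 X^* )$, where $\bar X^*$ is the horizontal lift (orthogonal to $\xi$). For a unit-speed curve $\bar\gamma$ in $\bar M$ put $\bar{\mathbf p}_1=\bar\gamma'$, $\bar{\mathbf p}_2=J\bar{\mathbf p}_1$ and define the signed curvature $\bar\kappa$ by $\bar\nabla_{\bar\gamma'}\bar\gamma'=\bar\kappa\,\bar{\mathbf p}_2$. A Riemannian circle in $\bar M$ is here a curve with constant nonzero curvature $\bar\kappa$. The Hopf cylinder is $S=S_{\bar\gamma}=\pi^{-1}(\bar\gamma)$ with induced metric (if $\bar\gamma$ is not injective, the immersed surface given by the pullback of $\pi$ along $\bar\gamma$). With $\mathbf t=(\bar{\mathbf p}_1)^*$ and unit normal $\mathbf n=(\bar{\mathbf p}_2)^*=\varphi\mathbf t$, $(\mathbf t,\xi)$ is an orthonormal frame of $S$, $S$ is flat with $\mathbf t,\xi$ parallel on $S$, the mean curvature is $H=(\bar\kappa\circ\pi)/2$, and $\mathbb H=H\mathbf n$. The Laplacian acting on sections of $\iota^*TM$ is $\Delta=-(\nabla_{\mathbf t}\nabla_{\mathbf t}+\nabla_\xi\nabla_\xi)$, with $\nabla$ the connection induced by the Levi-Civita connection of $M$. *)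

theory Defs
  imports "HOL-Analysis.Analysis"
begin

section \<open>Smooth manifolds\<close>

primrec Ck_on :: "nat \<Rightarrow> 'a::euclidean_space set \<Rightarrow> ('a \<Rightarrow> 'b::real_normed_vector) \<Rightarrow> bool" where
  "Ck_on 0 W f \<longleftrightarrow> continuous_on W f"
| "Ck_on (Suc k) W f \<longleftrightarrow> (\<forall>x\<in>W. f differentiable (at x)) \<and>
     (\<forall>v. Ck_on k W (\<lambda>x. frechet_derivative f (at x) v))"

text \<open>Smoothness on an open set \<open>W\<close>.\<close>
definition smooth_on :: "'a::euclidean_space set \<Rightarrow> ('a \<Rightarrow> 'b::real_normed_vector) \<Rightarrow> bool" where
  "smooth_on W f \<longleftrightarrow> (\<forall>k. Ck_on k W f)"

type_synonym ('m, 'e) atlas = "('m set \<times> ('m \<Rightarrow> 'e)) set"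

definition smooth_atlas :: "('m::topological_space, 'e::euclidean_space) atlas \<Rightarrow> bool" where
  "smooth_atlas A \<longleftrightarrow>
     (\<Union>(U, \<phi>)\<in>A. U) = UNIV \<and>
     (\<forall>(U, \<phi>)\<in>A. open U \<and> open (\<phi> ` U) \<and> homeomorphism U (\<phi> ` U) \<phi> (inv_into U \<phi>)) \<and>
     (\<forall>(U, \<phi>)\<in>A. \<forall>(V, \<psi>)\<in>A. smooth_on (\<phi> ` (U \<inter> V)) (\<psi> \<circ> inv_into U \<phi>))"

text \<open>The real functions that are smooth on some neighbourhood of \<open>p\<close>.  They are total functions
  whose values away from \<open>p\<close> are arbitrary, so indicator functions of neighbourhoods of \<open>p\<close> are
  among them.\<close>
definition smooth_germs :: "('m::topological_space, 'e::euclidean_space) atlas \<Rightarrow> 'm \<Rightarrow> ('m \<Rightarrow> real) set" where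
  "smooth_germs A p = {f. \<exists>(U, \<phi>)\<in>A. p \<in> U \<and>
     (\<exists>W. open W \<and> \<phi> p \<in> W \<and> W \<subseteq> \<phi> ` U \<and> smooth_on W (f \<circ> inv_into U \<phi>))}"

text \<open>A smooth space is a set of points together with the sheaf of smooth functions, given
  by the functions smooth near each point.\<close>
record 'm smooth_space =
  points :: "'m set"
  germs :: "'m \<Rightarrow> ('m \<Rightarrow> real) set"

definition mfd :: "('m::topological_space, 'e::euclidean_space) atlas \<Rightarrow> 'm smooth_space" where
  "mfd A = \<lparr>points = UNIV, germs = smooth_germs A\<rparr>"

text \<open>The smooth structure of an embedded submanifold: a function is smooth if it is locally the
  restriction of a smooth function of the ambient manifold.\<close>
definition submfd :: "('m::topological_space, 'e::euclidean_space) atlas \<Rightarrow> 'm set \<Rightarrow> 'm smooth_space" where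
  "submfd A S = \<lparr>points = S, germs = (\<lambda>q. {h. \<exists>F\<in>smooth_germs A q. \<exists>W. open W \<and> q \<in> W \<and>
     (\<forall>x\<in>W \<inter> S. h x = F x)})\<rparr>"

definition real_atlas :: "(real, real) atlas" where
  "real_atlas = {(UNIV, id)}"

definition prod_atlas :: "('m, 'e) atlas \<Rightarrow> (real \<times> 'm, real \<times> 'e) atlas" where
  "prod_atlas A = (\<lambda>(U, \<phi>). (UNIV \<times> U, \<lambda>(s, p). (s, \<phi> p))) ` A"

definition smooth_map :: "'m smooth_space \<Rightarrow> 'n smooth_space \<Rightarrow> ('m \<Rightarrow> 'n) \<Rightarrow> bool" where
  "smooth_map X Y f \<longleftrightarrow>
     (\<forall>p\<in>points X. f p \<in> points Y \<and> (\<forall>h\<in>germs Y (f p). h \<circ> f \<in> germs X p))"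


section \<open>Tangent vectors, vector fields and sections along a map\<close>

text \<open>Tangent vectors at \<open>p\<close> are the derivations at \<open>p\<close> of the functions smooth near \<open>p\<close>;
  as HOL functions they are set to \<open>0\<close> on all other functions.  That a derivation depends only
  on the germ follows from the Leibniz rule.\<close>
type_synonym 'm tvec = "('m \<Rightarrow> real) \<Rightarrow> real"
type_synonym 'm field = "'m \<Rightarrow> 'm tvec"

definition tzero :: "'m tvec" where "tzero = (\<lambda>f. 0)"
definition tadd :: "'m tvec \<Rightarrow> 'm tvec \<Rightarrow> 'm tvec" (infixl "+\<^sub>T" 65) where
  "v +\<^sub>T w = (\<lambda>f. v f + w f)"
definition tscale :: "real \<Rightarrow> 'm tvec \<Rightarrow> 'm tvec" (infixr "*\<^sub>T" 75) where
  "a *\<^sub>T v = (\<lambda>f. a * v f)"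
definition tdiff :: "'m tvec \<Rightarrow> 'm tvec \<Rightarrow> 'm tvec" (infixl "-\<^sub>T" 65) where
  "v -\<^sub>T w = (\<lambda>f. v f - w f)"

definition tangent :: "'m smooth_space \<Rightarrow> 'm \<Rightarrow> 'm tvec set" where
  "tangent X p = {v. (\<forall>f. f \<notin> germs X p \<longrightarrow> v f = 0) \<and>
     (\<forall>f\<in>germs X p. \<forall>h\<in>germs X p. \<forall>a b. v (\<lambda>x. a * f x + b * h x) = a * v f + b * v h) \<and>
     (\<forall>f\<in>germs X p. \<forall>h\<in>germs X p. v (\<lambda>x. f x * h x) = f p * v h + h p * v f)}"

definition push :: "'m smooth_space \<Rightarrow> 'n smooth_space \<Rightarrow> ('m \<Rightarrow> 'n) \<Rightarrow> 'm \<Rightarrow> 'm tvec \<Rightarrow> 'n tvec" where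
  "push X Y f p v = (\<lambda>h. if h \<in> germs Y (f p) then v (h \<circ> f) else 0)"

text \<open>Sections of \<open>f\<^sup>*TY\<close> that are defined and smooth near \<open>p\<close>.\<close>
definition sections :: "'m::topological_space smooth_space \<Rightarrow> 'n smooth_space \<Rightarrow> ('m \<Rightarrow> 'n) \<Rightarrow> 'm
    \<Rightarrow> ('m \<Rightarrow> 'n tvec) set" where
  "sections X Y f p = {V. \<exists>W. open W \<and> p \<in> W \<and> (\<forall>q\<in>W \<inter> points X.
     V q \<in> tangent Y (f q) \<and> (\<forall>h\<in>germs Y (f q). (\<lambda>x. V x h) \<in> germs X q))}"

abbreviation fields :: "'m::topological_space smooth_space \<Rightarrow> 'm \<Rightarrow> 'm field set" where
  "fields X p \<equiv> sections X X id p"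

definition bracket :: "'m smooth_space \<Rightarrow> 'm field \<Rightarrow> 'm field \<Rightarrow> 'm field" where
  "bracket X Z Z' p = (\<lambda>f. if f \<in> germs X p then Z p (\<lambda>q. Z' q f) - Z' p (\<lambda>q. Z q f) else 0)"


section \<open>Connections\<close>

text \<open>A connection in \<open>f\<^sup>*TY\<close>; \<open>D p v V\<close> is the derivative at \<open>p\<close> of the local section \<open>V\<close> in the
  direction of \<open>v \<in> T\<^sub>pX\<close>.\<close>
definition connection_along :: "'m::topological_space smooth_space \<Rightarrow> 'n smooth_space \<Rightarrow> ('m \<Rightarrow> 'n)
    \<Rightarrow> ('m \<Rightarrow> 'm tvec \<Rightarrow> ('m \<Rightarrow> 'n tvec) \<Rightarrow> 'n tvec) \<Rightarrow> bool" where
  "connection_along X Y f D \<longleftrightarrow> (\<forall>p\<in>points X.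
     (\<forall>v\<in>tangent X p. \<forall>V\<in>sections X Y f p.
        D p v V \<in> tangent Y (f p) \<and>
        (\<forall>w\<in>tangent X p. \<forall>a b. D p (a *\<^sub>T v +\<^sub>T b *\<^sub>T w) V = a *\<^sub>T D p v V +\<^sub>T b *\<^sub>T D p w V) \<and>
        (\<forall>V'\<in>sections X Y f p. D p v (\<lambda>q. V q +\<^sub>T V' q) = D p v V +\<^sub>T D p v V') \<and>
        (\<forall>h\<in>germs X p. D p v (\<lambda>q. h q *\<^sub>T V q) = v h *\<^sub>T V p +\<^sub>T h p *\<^sub>T D p v V)) \<and>
     (\<forall>Z\<in>fields X p. \<forall>V\<in>sections X Y f p. (\<lambda>q. D q (Z q) V) \<in> sections X Y f p))"

text \<open>The connection induced (pulled back) by \<open>f\<close> from the connection \<open>nabla\<close> of \<open>Y\<close>; it is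
  uniquely determined on local sections.\<close>
definition induced_connection :: "'m::topological_space smooth_space \<Rightarrow> 'n::topological_space smooth_space
    \<Rightarrow> ('m \<Rightarrow> 'n) \<Rightarrow> ('n \<Rightarrow> 'n tvec \<Rightarrow> 'n field \<Rightarrow> 'n tvec)
    \<Rightarrow> ('m \<Rightarrow> 'm tvec \<Rightarrow> ('m \<Rightarrow> 'n tvec) \<Rightarrow> 'n tvec) \<Rightarrow> bool" where
  "induced_connection X Y f nabla D \<longleftrightarrow> connection_along X Y f D \<and>
     (\<forall>p\<in>points X. \<forall>v\<in>tangent X p. \<forall>Z\<in>fields Y (f p).
        D p v (Z \<circ> f) = nabla (f p) (push X Y f p v) Z)"

definition riemannian_metric :: "'m::topological_space smooth_space \<Rightarrow> ('m \<Rightarrow> 'm tvec \<Rightarrow> 'm tvec \<Rightarrow> real) \<Rightarrow> bool" where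
  "riemannian_metric X g \<longleftrightarrow> (\<forall>p\<in>points X.
     (\<forall>u\<in>tangent X p. \<forall>v\<in>tangent X p. \<forall>w\<in>tangent X p. \<forall>a b.
        g p (a *\<^sub>T u +\<^sub>T b *\<^sub>T v) w = a * g p u w + b * g p v w) \<and>
     (\<forall>u\<in>tangent X p. \<forall>v\<in>tangent X p. g p u v = g p v u) \<and>
     (\<forall>u\<in>tangent X p. u \<noteq> tzero \<longrightarrow> g p u u > 0) \<and>
     (\<forall>Z\<in>fields X p. \<forall>Z'\<in>fields X p. (\<lambda>q. g q (Z q) (Z' q)) \<in> germs X p))"

definition levi_civita :: "'m::topological_space smooth_space \<Rightarrow> ('m \<Rightarrow> 'm tvec \<Rightarrow> 'm tvec \<Rightarrow> real)
    \<Rightarrow> ('m \<Rightarrow> 'm tvec \<Rightarrow> 'm field \<Rightarrow> 'm tvec) \<Rightarrow> bool" where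
  "levi_civita X g nabla \<longleftrightarrow> connection_along X X id nabla \<and>
     (\<forall>p\<in>points X. \<forall>Z\<in>fields X p. \<forall>Z'\<in>fields X p.
        nabla p (Z p) Z' -\<^sub>T nabla p (Z' p) Z = bracket X Z Z' p \<and>
        (\<forall>v\<in>tangent X p. v (\<lambda>q. g q (Z q) (Z' q))
            = g p (nabla p v Z) (Z' p) + g p (Z p) (nabla p v Z')))"


section \<open>Contact Riemannian and Sasaki manifolds\<close>

definition one_form :: "'m::topological_space smooth_space \<Rightarrow> ('m \<Rightarrow> 'm tvec \<Rightarrow> real) \<Rightarrow> bool" where
  "one_form X \<eta> \<longleftrightarrow> (\<forall>p\<in>points X.
     (\<forall>u\<in>tangent X p. \<forall>v\<in>tangent X p. \<forall>a b. \<eta> p (a *\<^sub>T u +\<^sub>T b *\<^sub>T v) = a * \<eta> p u + b * \<eta> p v) \<and>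
     (\<forall>Z\<in>fields X p. (\<lambda>q. \<eta> q (Z q)) \<in> germs X p))"

definition endo_field :: "'m::topological_space smooth_space \<Rightarrow> ('m \<Rightarrow> 'm tvec \<Rightarrow> 'm tvec) \<Rightarrow> bool" where
  "endo_field X \<phi> \<longleftrightarrow> (\<forall>p\<in>points X.
     (\<forall>u\<in>tangent X p. \<phi> p u \<in> tangent X p) \<and>
     (\<forall>u\<in>tangent X p. \<forall>v\<in>tangent X p. \<forall>a b.
        \<phi> p (a *\<^sub>T u +\<^sub>T b *\<^sub>T v) = a *\<^sub>T \<phi> p u +\<^sub>T b *\<^sub>T \<phi> p v) \<and>
     (\<forall>Z\<in>fields X p. (\<lambda>q. \<phi> q (Z q)) \<in> fields X p))"

definition ext_deriv :: "'m smooth_space \<Rightarrow> ('m \<Rightarrow> 'm tvec \<Rightarrow> real) \<Rightarrow> 'm field \<Rightarrow> 'm field \<Rightarrow> 'm \<Rightarrow> real" where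
  "ext_deriv X \<eta> Z Z' p = Z p (\<lambda>q. \<eta> q (Z' q)) - Z' p (\<lambda>q. \<eta> q (Z q)) - \<eta> p (bracket X Z Z' p)"

text \<open>The inequation says that the 3-form \<open>\<eta> \<and> d\<eta>\<close> does not vanish at \<open>p\<close>.\<close>
definition contact_form_3 :: "'m::topological_space smooth_space \<Rightarrow> ('m \<Rightarrow> 'm tvec \<Rightarrow> real) \<Rightarrow> bool" where
  "contact_form_3 X \<eta> \<longleftrightarrow> one_form X \<eta> \<and> (\<forall>p\<in>points X.
     \<exists>Z1\<in>fields X p. \<exists>Z2\<in>fields X p. \<exists>Z3\<in>fields X p.
       \<eta> p (Z1 p) * ext_deriv X \<eta> Z2 Z3 p + \<eta> p (Z2 p) * ext_deriv X \<eta> Z3 Z1 p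
         + \<eta> p (Z3 p) * ext_deriv X \<eta> Z1 Z2 p \<noteq> 0)"

definition contact_riemannian_3 :: "'m::topological_space smooth_space \<Rightarrow> ('m \<Rightarrow> 'm tvec \<Rightarrow> real) \<Rightarrow> 'm field
    \<Rightarrow> ('m \<Rightarrow> 'm tvec \<Rightarrow> 'm tvec) \<Rightarrow> ('m \<Rightarrow> 'm tvec \<Rightarrow> 'm tvec \<Rightarrow> real) \<Rightarrow> bool" where
  "contact_riemannian_3 X \<eta> \<xi> \<phi> g \<longleftrightarrow>
     contact_form_3 X \<eta> \<and> endo_field X \<phi> \<and> riemannian_metric X g \<and>
     (\<forall>p\<in>points X.
        \<xi> \<in> fields X p \<and> \<eta> p (\<xi> p) = 1 \<and>
        (\<forall>Z\<in>fields X p. ext_deriv X \<eta> \<xi> Z p = 0) \<and>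
        (\<forall>u\<in>tangent X p.
           \<phi> p (\<phi> p u) = \<eta> p u *\<^sub>T \<xi> p -\<^sub>T u \<and>
           g p (\<xi> p) u = \<eta> p u \<and>
           (\<forall>v\<in>tangent X p. g p (\<phi> p u) (\<phi> p v) = g p u v - \<eta> p u * \<eta> p v)) \<and>
        (\<forall>Z\<in>fields X p. \<forall>Z'\<in>fields X p. ext_deriv X \<eta> Z Z' p = 2 * g p (Z p) (\<phi> p (Z' p))))"

definition sasaki_3 :: "'m::topological_space smooth_space \<Rightarrow> ('m \<Rightarrow> 'm tvec \<Rightarrow> real) \<Rightarrow> 'm field
    \<Rightarrow> ('m \<Rightarrow> 'm tvec \<Rightarrow> 'm tvec) \<Rightarrow> ('m \<Rightarrow> 'm tvec \<Rightarrow> 'm tvec \<Rightarrow> real)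
    \<Rightarrow> ('m \<Rightarrow> 'm tvec \<Rightarrow> 'm field \<Rightarrow> 'm tvec) \<Rightarrow> bool" where
  "sasaki_3 X \<eta> \<xi> \<phi> g nabla \<longleftrightarrow>
     contact_riemannian_3 X \<eta> \<xi> \<phi> g \<and> levi_civita X g nabla \<and>
     (\<forall>p\<in>points X. \<forall>v\<in>tangent X p. \<forall>Z\<in>fields X p.
        nabla p v (\<lambda>q. \<phi> q (Z q)) -\<^sub>T \<phi> p (nabla p v Z) = g p v (Z p) *\<^sub>T \<xi> p -\<^sub>T \<eta> p (Z p) *\<^sub>T v)"


section \<open>Regularity and the Boothby-Wang fibering\<close>

text \<open>\<open>\<Phi>\<close> is the flow of \<open>\<xi>\<close> and the group is \<open>K = range \<Phi>\<close> (a quotient of the additive group of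
  reals), so that simple transitivity on each orbit means that \<open>K\<close>, and not \<open>\<Phi>\<close>, acts freely.\<close>
definition regular_flow :: "('m::topological_space, 'e::euclidean_space) atlas \<Rightarrow> 'm field
    \<Rightarrow> ('m \<Rightarrow> 'm tvec \<Rightarrow> 'm tvec \<Rightarrow> real) \<Rightarrow> (real \<Rightarrow> 'm \<Rightarrow> 'm) \<Rightarrow> bool" where
  "regular_flow A \<xi> g \<Phi> \<longleftrightarrow>
     smooth_map (mfd (prod_atlas A)) (mfd A) (\<lambda>(s, p). \<Phi> s p) \<and>
     \<Phi> 0 = id \<and> (\<forall>s t. \<Phi> (s + t) = \<Phi> s \<circ> \<Phi> t) \<and>
     (\<forall>p s. \<forall>f\<in>germs (mfd A) (\<Phi> s p).
        ((\<lambda>t. f (\<Phi> t p)) has_real_derivative \<xi> (\<Phi> s p) f) (at s)) \<and>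
     (\<forall>s p. \<forall>u\<in>tangent (mfd A) p. \<forall>v\<in>tangent (mfd A) p.
        g (\<Phi> s p) (push (mfd A) (mfd A) (\<Phi> s) p u) (push (mfd A) (mfd A) (\<Phi> s) p v) = g p u v) \<and>
     (\<forall>s t p. \<Phi> s p = \<Phi> t p \<longrightarrow> \<Phi> s = \<Phi> t)"

definition horizontal_lift :: "'m smooth_space \<Rightarrow> 'b smooth_space \<Rightarrow> 'm field
    \<Rightarrow> ('m \<Rightarrow> 'm tvec \<Rightarrow> 'm tvec \<Rightarrow> real) \<Rightarrow> ('m \<Rightarrow> 'b) \<Rightarrow> 'm \<Rightarrow> 'b tvec \<Rightarrow> 'm tvec" where
  "horizontal_lift M B \<xi> g \<pi> p v = (THE u. u \<in> tangent M p \<and> g p u (\<xi> p) = 0 \<and> push M B \<pi> p u = v)"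

text \<open>\<open>B\<close> is the orbit space: a surjective submersion whose fibres are the orbits determines
  the smooth structure of the quotient, and the last two conditions determine \<open>gB\<close> and \<open>J\<close>.\<close>
definition boothby_wang :: "'m::topological_space smooth_space \<Rightarrow> 'm field \<Rightarrow> ('m \<Rightarrow> 'm tvec \<Rightarrow> 'm tvec)
    \<Rightarrow> ('m \<Rightarrow> 'm tvec \<Rightarrow> 'm tvec \<Rightarrow> real) \<Rightarrow> (real \<Rightarrow> 'm \<Rightarrow> 'm) \<Rightarrow> 'b::topological_space smooth_space
    \<Rightarrow> ('b \<Rightarrow> 'b tvec \<Rightarrow> 'b tvec \<Rightarrow> real) \<Rightarrow> ('b \<Rightarrow> 'b tvec \<Rightarrow> 'b tvec) \<Rightarrow> ('m \<Rightarrow> 'b) \<Rightarrow> bool" where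
  "boothby_wang M \<xi> \<phi> g \<Phi> B gB J \<pi> \<longleftrightarrow>
     smooth_map M B \<pi> \<and> \<pi> ` points M = points B \<and>
     (\<forall>p\<in>points M. \<forall>q\<in>points M. \<pi> p = \<pi> q \<longleftrightarrow> (\<exists>s. q = \<Phi> s p)) \<and>
     (\<forall>p\<in>points M. push M B \<pi> p ` tangent M p = tangent B (\<pi> p)) \<and>
     riemannian_metric B gB \<and>
     (\<forall>p\<in>points M. \<forall>u\<in>tangent M p. \<forall>v\<in>tangent M p. g p u (\<xi> p) = 0 \<and> g p v (\<xi> p) = 0 \<longrightarrow>
        gB (\<pi> p) (push M B \<pi> p u) (push M B \<pi> p v) = g p u v) \<and>
     (\<forall>p\<in>points M. \<forall>v\<in>tangent B (\<pi> p).
        J (\<pi> p) v = push M B \<pi> p (\<phi> p (horizontal_lift M B \<xi> g \<pi> p v)))"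


section \<open>Curves\<close>

text \<open>For a curve \<open>\<gamma>\<close> in \<open>B\<close> on the open interval \<open>I\<close>, \<open>DB\<close> denotes the connection induced in
  \<open>\<gamma>\<^sup>*TB\<close>, so that \<open>DB s (d_ds s) (curve_p1 B I \<gamma>)\<close> is the acceleration \<open>\<nabla>\<^bsub>\<gamma>'\<^esub>\<gamma>'\<close>.\<close>

definition d_ds :: "real field" where
  "d_ds s = (\<lambda>h. if h \<in> smooth_germs real_atlas s then deriv h s else 0)"

definition curve_p1 :: "'b smooth_space \<Rightarrow> real set \<Rightarrow> (real \<Rightarrow> 'b) \<Rightarrow> real \<Rightarrow> 'b tvec" where
  "curve_p1 B I \<gamma> s = push (submfd real_atlas I) B \<gamma> s (d_ds s)"

definition curve_p2 :: "'b smooth_space \<Rightarrow> ('b \<Rightarrow> 'b tvec \<Rightarrow> 'b tvec) \<Rightarrow> real set \<Rightarrow> (real \<Rightarrow> 'b)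
    \<Rightarrow> real \<Rightarrow> 'b tvec" where
  "curve_p2 B J I \<gamma> s = J (\<gamma> s) (curve_p1 B I \<gamma> s)"

definition unit_speed_curve :: "'b smooth_space \<Rightarrow> ('b \<Rightarrow> 'b tvec \<Rightarrow> 'b tvec \<Rightarrow> real) \<Rightarrow> real set
    \<Rightarrow> (real \<Rightarrow> 'b) \<Rightarrow> bool" where
  "unit_speed_curve B gB I \<gamma> \<longleftrightarrow> open I \<and> is_interval I \<and> I \<noteq> {} \<and>
     smooth_map (submfd real_atlas I) B \<gamma> \<and>
     (\<forall>s\<in>I. gB (\<gamma> s) (curve_p1 B I \<gamma> s) (curve_p1 B I \<gamma> s) = 1)"

definition signed_curvature :: "'b smooth_space \<Rightarrow> ('b \<Rightarrow> 'b tvec \<Rightarrow> 'b tvec) \<Rightarrow> real set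
    \<Rightarrow> (real \<Rightarrow> 'b) \<Rightarrow> (real \<Rightarrow> real tvec \<Rightarrow> (real \<Rightarrow> 'b tvec) \<Rightarrow> 'b tvec) \<Rightarrow> real \<Rightarrow> real" where
  "signed_curvature B J I \<gamma> DB s =
     (THE k. DB s (d_ds s) (curve_p1 B I \<gamma>) = k *\<^sub>T curve_p2 B J I \<gamma> s)"

definition geodesic :: "'b smooth_space \<Rightarrow> real set \<Rightarrow> (real \<Rightarrow> 'b)
    \<Rightarrow> (real \<Rightarrow> real tvec \<Rightarrow> (real \<Rightarrow> 'b tvec) \<Rightarrow> 'b tvec) \<Rightarrow> bool" where
  "geodesic B I \<gamma> DB \<longleftrightarrow> (\<forall>s\<in>I. DB s (d_ds s) (curve_p1 B I \<gamma>) = tzero)"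

definition riemannian_circle :: "'b smooth_space \<Rightarrow> ('b \<Rightarrow> 'b tvec \<Rightarrow> 'b tvec) \<Rightarrow> real set
    \<Rightarrow> (real \<Rightarrow> 'b) \<Rightarrow> (real \<Rightarrow> real tvec \<Rightarrow> (real \<Rightarrow> 'b tvec) \<Rightarrow> 'b tvec) \<Rightarrow> bool" where
  "riemannian_circle B J I \<gamma> DB \<longleftrightarrow> (\<exists>k. k \<noteq> 0 \<and> (\<forall>s\<in>I. signed_curvature B J I \<gamma> DB s = k))"


section \<open>Hopf cylinders\<close>

text \<open>The pullback of \<open>\<pi>\<close> along \<open>\<gamma>\<close>, an embedded surface in \<open>\<real> \<times> M\<close>.  Its immersion \<open>\<iota>\<close> into \<open>M\<close>
  is \<open>snd\<close>, and \<open>fst\<close> is the projection to the parameter interval.\<close>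
definition hopf_cylinder :: "('m::topological_space, 'e::euclidean_space) atlas \<Rightarrow> ('m \<Rightarrow> 'b) \<Rightarrow> real set
    \<Rightarrow> (real \<Rightarrow> 'b) \<Rightarrow> (real \<times> 'm) smooth_space" where
  "hopf_cylinder A \<pi> I \<gamma> = submfd (prod_atlas A) {(s, p). s \<in> I \<and> \<pi> p = \<gamma> s}"

definition hopf_t :: "'m smooth_space \<Rightarrow> 'b smooth_space \<Rightarrow> 'm field \<Rightarrow> ('m \<Rightarrow> 'm tvec \<Rightarrow> 'm tvec \<Rightarrow> real)
    \<Rightarrow> ('m \<Rightarrow> 'b) \<Rightarrow> real set \<Rightarrow> (real \<Rightarrow> 'b) \<Rightarrow> real \<times> 'm \<Rightarrow> 'm tvec" where
  "hopf_t M B \<xi> g \<pi> I \<gamma> q = horizontal_lift M B \<xi> g \<pi> (snd q) (curve_p1 B I \<gamma> (fst q))"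

definition hopf_n :: "'m smooth_space \<Rightarrow> 'b smooth_space \<Rightarrow> 'm field \<Rightarrow> ('m \<Rightarrow> 'm tvec \<Rightarrow> 'm tvec \<Rightarrow> real)
    \<Rightarrow> ('m \<Rightarrow> 'b) \<Rightarrow> ('b \<Rightarrow> 'b tvec \<Rightarrow> 'b tvec) \<Rightarrow> real set \<Rightarrow> (real \<Rightarrow> 'b) \<Rightarrow> real \<times> 'm \<Rightarrow> 'm tvec" where
  "hopf_n M B \<xi> g \<pi> J I \<gamma> q = horizontal_lift M B \<xi> g \<pi> (snd q) (curve_p2 B J I \<gamma> (fst q))"

text \<open>The tangent vector field of \<open>S\<close> whose image under the immersion is the given section
  of \<open>\<iota>\<^sup>*TM\<close>.\<close>
definition tangential :: "(real \<times> 'm) smooth_space \<Rightarrow> 'm smooth_space \<Rightarrow> (real \<times> 'm \<Rightarrow> 'm tvec)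
    \<Rightarrow> (real \<times> 'm) field" where
  "tangential S M V q = (THE w. w \<in> tangent S q \<and> push S M snd q w = V q)"

text \<open>Half the trace, with respect to the orthonormal frame \<open>(E1, E2)\<close> of the surface \<open>S\<close>, of its second
  fundamental form \<open>(X, Y) \<mapsto> g (\<nabla>\<^bsub>X\<^esub>Y, n)\<close>, where \<open>D\<close> is the connection induced in \<open>\<iota>\<^sup>*TM\<close>.  The
  frame is given as a pair of sections of \<open>\<iota>\<^sup>*TM\<close>.\<close>
definition mean_curvature :: "(real \<times> 'm) smooth_space \<Rightarrow> 'm smooth_space
    \<Rightarrow> ('m \<Rightarrow> 'm tvec \<Rightarrow> 'm tvec \<Rightarrow> real)
    \<Rightarrow> (real \<times> 'm \<Rightarrow> (real \<times> 'm) tvec \<Rightarrow> (real \<times> 'm \<Rightarrow> 'm tvec) \<Rightarrow> 'm tvec)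
    \<Rightarrow> (real \<times> 'm \<Rightarrow> 'm tvec) \<Rightarrow> (real \<times> 'm \<Rightarrow> 'm tvec) \<Rightarrow> (real \<times> 'm \<Rightarrow> 'm tvec)
    \<Rightarrow> real \<times> 'm \<Rightarrow> real" where
  "mean_curvature S M g D E1 E2 n q =
     (g (snd q) (D q (tangential S M E1 q) E1) (n q) + g (snd q) (D q (tangential S M E2 q) E2) (n q)) / 2"

text \<open>No term \<open>\<nabla>\<^bsub>\<nabla>E\<^esub>\<close> occurs since this is only used for the frame \<open>(t, \<xi>)\<close>, which is parallel
  on \<open>S\<close>.\<close>
definition frame_laplacian :: "(real \<times> 'm) smooth_space \<Rightarrow> 'm smooth_space
    \<Rightarrow> (real \<times> 'm \<Rightarrow> (real \<times> 'm) tvec \<Rightarrow> (real \<times> 'm \<Rightarrow> 'm tvec) \<Rightarrow> 'm tvec)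
    \<Rightarrow> (real \<times> 'm \<Rightarrow> 'm tvec) \<Rightarrow> (real \<times> 'm \<Rightarrow> 'm tvec) \<Rightarrow> (real \<times> 'm \<Rightarrow> 'm tvec)
    \<Rightarrow> real \<times> 'm \<Rightarrow> 'm tvec" where
  "frame_laplacian S M D E1 E2 V q =
     -1 *\<^sub>T (D q (tangential S M E1 q) (\<lambda>x. D x (tangential S M E1 x) V)
        +\<^sub>T D q (tangential S M E2 q) (\<lambda>x. D x (tangential S M E2 x) V))"

end

theory Submission
  imports Defs
begin

text \<open>
  Horizontal lifting is compatible with covariant differentiation: by the Koszul formula
  \<open>\<pi>\<^sub>* (\<nabla>\<^bsub>X*\<^esub> Y*)\<close> is the derivative of \<open>Y\<close> along \<open>X\<close> in the base, and \<open>[\<xi>, Y*] = 0\<close>, so that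
  \<open>\<nabla>\<^bsub>\<xi>\<^esub> Y* = \<nabla>\<^bsub>Y*\<^esub> \<xi> = - \<phi> Y*\<close>.  Together with the Sasaki identity this gives the frame equations
  \<open>\<nabla>\<^bsub>t\<^esub> t = \<kappa> n\<close>, \<open>\<nabla>\<^bsub>t\<^esub> n = - \<kappa> t + \<xi>\<close>, \<open>\<nabla>\<^bsub>t\<^esub> \<xi> = \<nabla>\<^bsub>\<xi>\<^esub> t = - n\<close>, \<open>\<nabla>\<^bsub>\<xi>\<^esub> n = t\<close> along the cylinder, and
  with \<open>H = \<kappa> / 2\<close>, which is constant along the fibres,
  \<open>\<Delta> (H n) = (4 H^3 + 2 H - H'') n + 6 H H' t - 2 H' \<xi>\<close>.
  This is a multiple of \<open>H n\<close> only if \<open>H' = 0\<close>, and then the factor is \<open>4 H^2 + 2\<close> unless \<open>H = 0\<close>.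

  Tangent vectors are derivations, so Hadamard's lemma is needed to expand them in coordinates;
  the tangential lift of \<open>t\<close> to the cylinder exists by the inverse function theorem.\<close>

section \<open>Calculus of smooth functions\<close>

text \<open>The connection \<open>D\<close> along the immersion is known only through its axioms and
  its values on pulled-back fields \<open>Z \<circ> snd\<close>, whereas \<open>t\<close> and
  \<open>n\<close> are given on the cylinder alone. Hence facts about \<open>D\<close> are proved by
  induction over sections: near a point each section is a combination, with germs as coefficients,
  of pulled-back coordinate fields, and the property in question is checked on these and carried
  through sums and multiples. For horizontal sections the generators are lifts of fields of the
  base. In \<open>4 H^2 + 2\<close> the term \<open>4 H^2\<close> is \<open>\<kappa>^2\<close>, from
  the rotation of \<open>(t, n)\<close> in the direction of \<open>t\<close>. One of the two
  remaining units comes from the \<xi>-component of the \<open>t\<close>-derivative of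
  \<open>n\<close>, as the \<open>t\<close>-derivative of \<xi> is \<open>- n\<close>; the other
  from the fibre direction, where \<open>n\<close> turns into \<open>t\<close> and \<open>t\<close>
  into \<open>- n\<close>. The \<xi>-component \<open>- 2 H'\<close> alone forces \<open>H\<close>
  to be constant, also at its zeros.\<close>

lemma Ck_on_cong:
  assumes "open W" "\<And>x. x \<in> W \<Longrightarrow> f x = g x" "Ck_on k W f"
  shows "Ck_on k W g"
  using assms(2,3)
proof (induction k arbitrary: f g)
  case 0
  then show ?case by (simp cong: continuous_on_cong)
next
  case (Suc k)
  have d: "(g has_derivative frechet_derivative f (at x)) (at x)" if "x \<in> W" for x
    using Suc.prems that assms(1)
    by (intro has_derivative_transform_within_open[of f _ x UNIV W g])
       (auto simp: frechet_derivative_works)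
  have "frechet_derivative f (at x) = frechet_derivative g (at x)" if "x \<in> W" for x
    using frechet_derivative_at[OF d[OF that]] .
  then have "Ck_on k W (\<lambda>x. frechet_derivative g (at x) v)" for v
    using Suc.prems(2) by (intro Suc.IH[of "\<lambda>x. frechet_derivative f (at x) v" "\<lambda>x. frechet_derivative g (at x) v"]) simp_all
  moreover have "\<forall>x\<in>W. g differentiable (at x)"
    using d by (meson differentiableI)
  ultimately show ?case
    by simp
qed

text \<open>Admits any formula for the derivative in place of \<open>frechet_derivative\<close>, so
  that regularity can be read off from the formula.\<close>

lemma Ck_on_SucI:
  assumes "open W" "\<And>x. x \<in> W \<Longrightarrow> (f has_derivative f' x) (at x)" "\<And>v. Ck_on k W (\<lambda>x. f' x v)"
  shows "Ck_on (Suc k) W f"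
proof -
  have "f' x = frechet_derivative f (at x)" if "x \<in> W" for x
    using frechet_derivative_at[OF assms(2)[OF that]] .
  then show ?thesis
    using assms by (auto simp: differentiable_def intro: Ck_on_cong[OF assms(1) _ assms(3)])
qed

lemma Ck_on_Suc_has_derivative:
  "Ck_on (Suc k) W f \<Longrightarrow> x \<in> W \<Longrightarrow> (f has_derivative frechet_derivative f (at x)) (at x)"
  by (simp add: frechet_derivative_works)

lemma Ck_on_SucD: "Ck_on (Suc k) W f \<Longrightarrow> Ck_on k W f"
proof (induction k arbitrary: f)
  case 0
  then show ?case
    by (auto intro!: continuous_at_imp_continuous_on differentiable_imp_continuous_within)
qed simp

lemma Ck_on_subset: "Ck_on k W f \<Longrightarrow> V \<subseteq> W \<Longrightarrow> Ck_on k V f"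
  by (induction k arbitrary: f) (auto intro: continuous_on_subset)

lemma Ck_on_const: "open W \<Longrightarrow> Ck_on k W (\<lambda>x. c)"
  by (induction k arbitrary: c) (auto intro!: Ck_on_SucI[where f' = "\<lambda>x v. 0"])

lemma Ck_on_bounded_linear:
  assumes "open W" "bounded_linear L"
  shows "Ck_on k W L"
  using assms
  by (cases k) (auto intro!: Ck_on_SucI[where f' = "\<lambda>x. L"] Ck_on_const linear_continuous_on
      bounded_linear_imp_has_derivative simp del: Ck_on.simps(2))

lemma Ck_on_add:
  "open W \<Longrightarrow> Ck_on k W f \<Longrightarrow> Ck_on k W g \<Longrightarrow> Ck_on k W (\<lambda>x. f x + g x)"
proof (induction k arbitrary: f g)
  case (Suc k)
  show ?case
    by (rule Ck_on_SucI[where f' = "\<lambda>x v. frechet_derivative f (at x) v + frechet_derivative g (at x) v"])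
       (use Suc in \<open>auto intro!: has_derivative_add simp: frechet_derivative_works\<close>)
qed (auto intro: continuous_intros)

lemma Ck_on_bilinear:
  assumes "bounded_bilinear B" "open W"
  shows "Ck_on k W f \<Longrightarrow> Ck_on k W g \<Longrightarrow> Ck_on k W (\<lambda>x. B (f x) (g x))"
proof (induction k arbitrary: f g)
  case 0
  then show ?case using bounded_bilinear.continuous_on[OF assms(1)] by auto
next
  case (Suc k)
  note d = bounded_bilinear.FDERIV[OF assms(1) Ck_on_Suc_has_derivative Ck_on_Suc_has_derivative,
      OF Suc.prems(1) _ Suc.prems(2)]
  show ?case
    by (rule Ck_on_SucI[OF assms(2) d])
       (use Suc Ck_on_SucD[OF Suc.prems(1)] Ck_on_SucD[OF Suc.prems(2)] assms(2)
         in \<open>auto intro!: Ck_on_add simp del: Ck_on.simps(2)  simp: Ck_on.simps(2)[of k]\<close>)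
qed

lemma Ck_on_sum:
  "open W \<Longrightarrow> (\<And>i. i \<in> I \<Longrightarrow> Ck_on k W (f i)) \<Longrightarrow> Ck_on k W (\<lambda>x. \<Sum>i\<in>I. f i x)"
  by (induction I rule: infinite_finite_induct) (auto intro: Ck_on_add Ck_on_const)

lemma linear_basis_expansion:
  fixes L :: "'a::euclidean_space \<Rightarrow> 'b::real_vector"
  assumes "linear L"
  shows "L v = (\<Sum>b\<in>Basis. (v \<bullet> b) *\<^sub>R L b)"
  using linear_sum[OF assms, of "\<lambda>b. (v \<bullet> b) *\<^sub>R b" Basis]
  by (simp add: euclidean_representation linear_cmul[OF assms])

text \<open>The chain rule yields \<open>g' (f x) (f' x v)\<close>, where both the base point and
  the direction vary with \<open>x\<close>, so the induction hypothesis does not apply to it as it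
  stands. Expanding \<open>f' x v\<close> in the basis leaves maps \<open>g' _ b\<close> with a
  fixed direction, composed with \<open>f\<close>, times coefficients of class
  \<open>k\<close>.\<close>

lemma Ck_on_compose:
  fixes f :: "'a::euclidean_space \<Rightarrow> 'b::euclidean_space" and g :: "'b \<Rightarrow> 'c::real_normed_vector"
  assumes "open W" "f ` W \<subseteq> V"
  shows "Ck_on k W f \<Longrightarrow> Ck_on k V g \<Longrightarrow> Ck_on k W (\<lambda>x. g (f x))"
proof (induction k arbitrary: g)
  case 0
  then show ?case using assms continuous_on_compose2[of V g W f] by auto
next
  case (Suc k)
  define f' where "f' x = frechet_derivative f (at x)" for x
  define g' where "g' x = frechet_derivative g (at x)" for x
  have df: "(f has_derivative f' x) (at x)" if "x \<in> W" for x
    using Ck_on_Suc_has_derivative[OF Suc.prems(1) that] by (simp add: f'_def)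
  have dg: "(g has_derivative g' x) (at x)" if "x \<in> V" for x
    using Ck_on_Suc_has_derivative[OF Suc.prems(2) that] by (simp add: g'_def)
  have lin: "linear (g' (f x))" if "x \<in> W" for x
    using dg[of "f x"] assms(2) that has_derivative_linear by blast
  have eq: "(\<Sum>b\<in>Basis. (f' x v \<bullet> b) *\<^sub>R g' (f x) b) = g' (f x) (f' x v)" if "x \<in> W" for x v
    using linear_basis_expansion[OF lin[OF that]] by metis
  have ck: "Ck_on k W (\<lambda>x. g' (f x) (f' x v))" for v
  proof (rule Ck_on_cong[OF assms(1) eq])
    have 1: "Ck_on k W (\<lambda>x. f' x v)" using Suc.prems(1) by (simp add: f'_def)
    have 2: "Ck_on k W (\<lambda>x. g' (f x) b)" for b
      using Suc.IH[of "\<lambda>x. g' x b"] Ck_on_SucD[OF Suc.prems(1)] Suc.prems(2) by (simp add: g'_def)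
    show "Ck_on k W (\<lambda>x. \<Sum>b\<in>Basis. (f' x v \<bullet> b) *\<^sub>R g' (f x) b)"
      using assms(1) 1 2
      by (intro Ck_on_sum Ck_on_bilinear[OF bounded_bilinear_scaleR]
          Ck_on_bilinear[OF bounded_bilinear_inner] Ck_on_const)
  qed
  show ?case
  proof (rule Ck_on_SucI[OF assms(1) _ ck])
    show "((\<lambda>x. g (f x)) has_derivative (\<lambda>v. g' (f x) (f' x v))) (at x)" if "x \<in> W" for x
      using that assms(2) by (intro has_derivative_compose[OF df dg]) auto
  qed
qed

text \<open>The derivative \<open>- f' / f^2\<close> is again a product of inverses of
  \<open>f\<close> and a derivative of \<open>f\<close>, which is what the induction on
  \<open>k\<close> feeds on.\<close>

lemma Ck_on_inverse:
  fixes f :: "'a::euclidean_space \<Rightarrow> real"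
  assumes "open W" "\<And>x. x \<in> W \<Longrightarrow> f x \<noteq> 0"
  shows "Ck_on k W f \<Longrightarrow> Ck_on k W (\<lambda>x. inverse (f x))"
proof (induction k)
  case 0
  then show ?case using assms by (auto intro: continuous_intros)
next
  case (Suc k)
  note IH = Suc.IH[OF Ck_on_SucD[OF Suc.prems]]
  have ck: "Ck_on k W (\<lambda>x. (-1) * ((inverse (f x) * frechet_derivative f (at x) v) * inverse (f x)))" for v
    using Suc.prems assms(1) IH
    by (intro Ck_on_bilinear[OF bounded_bilinear_mult] Ck_on_const) auto
  show ?case
  proof (rule Ck_on_SucI[OF assms(1) _ ck])
    show "((\<lambda>x. inverse (f x)) has_derivative
        (\<lambda>v. (-1) * ((inverse (f x) * frechet_derivative f (at x) v) * inverse (f x)))) (at x)" if "x \<in> W" for x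
      using Deriv.has_derivative_inverse[OF assms(2)[OF that] Ck_on_Suc_has_derivative[OF Suc.prems that]] by simp
  qed
qed

lemma smooth_on_cong:
  "open W \<Longrightarrow> smooth_on W f \<Longrightarrow> (\<And>x. x \<in> W \<Longrightarrow> f x = g x) \<Longrightarrow> smooth_on W g"
  unfolding smooth_on_def using Ck_on_cong[of W f g] by blast

lemma smooth_on_subset: "smooth_on W f \<Longrightarrow> V \<subseteq> W \<Longrightarrow> smooth_on V f"
  unfolding smooth_on_def using Ck_on_subset by blast

lemma smooth_on_const: "open W \<Longrightarrow> smooth_on W (\<lambda>x. c)"
  unfolding smooth_on_def using Ck_on_const by blast

lemma smooth_on_bounded_linear: "open W \<Longrightarrow> bounded_linear L \<Longrightarrow> smooth_on W L"
  unfolding smooth_on_def using Ck_on_bounded_linear by blast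

lemma smooth_on_add: "open W \<Longrightarrow> smooth_on W f \<Longrightarrow> smooth_on W g \<Longrightarrow> smooth_on W (\<lambda>x. f x + g x)"
  unfolding smooth_on_def using Ck_on_add by blast

lemma smooth_on_mult:
  fixes f g :: "'a::euclidean_space \<Rightarrow> real"
  shows "open W \<Longrightarrow> smooth_on W f \<Longrightarrow> smooth_on W g \<Longrightarrow> smooth_on W (\<lambda>x. f x * g x)"
  unfolding smooth_on_def using Ck_on_bilinear[OF bounded_bilinear_mult] by blast

lemma smooth_on_inner:
  fixes f g :: "'a::euclidean_space \<Rightarrow> 'b::real_inner"
  shows "open W \<Longrightarrow> smooth_on W f \<Longrightarrow> smooth_on W g \<Longrightarrow> smooth_on W (\<lambda>x. f x \<bullet> g x)"
  unfolding smooth_on_def using Ck_on_bilinear[OF bounded_bilinear_inner] by blast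

lemma smooth_on_inverse:
  fixes f :: "'a::euclidean_space \<Rightarrow> real"
  shows "open W \<Longrightarrow> smooth_on W f \<Longrightarrow> (\<And>x. x \<in> W \<Longrightarrow> f x \<noteq> 0) \<Longrightarrow> smooth_on W (\<lambda>x. inverse (f x))"
  unfolding smooth_on_def using Ck_on_inverse by blast

lemma smooth_on_compose:
  fixes f :: "'a::euclidean_space \<Rightarrow> 'b::euclidean_space" and g :: "'b \<Rightarrow> 'c::real_normed_vector"
  shows "open W \<Longrightarrow> f ` W \<subseteq> V \<Longrightarrow> smooth_on W f \<Longrightarrow> smooth_on V g \<Longrightarrow> smooth_on W (\<lambda>x. g (f x))"
  unfolding smooth_on_def using Ck_on_compose by blast

lemma smooth_on_componentwise:
  fixes f :: "'a::euclidean_space \<Rightarrow> 'b::euclidean_space"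
  assumes "open W" "\<And>b. b \<in> Basis \<Longrightarrow> smooth_on W (\<lambda>x. f x \<bullet> b)"
  shows "smooth_on W f"
proof -
  have "Ck_on k W (\<lambda>x. \<Sum>b\<in>Basis. (f x \<bullet> b) *\<^sub>R b)" for k
    using assms unfolding smooth_on_def
    by (intro Ck_on_sum Ck_on_bilinear[OF bounded_bilinear_scaleR] Ck_on_const) auto
  then show ?thesis by (simp add: euclidean_representation smooth_on_def)
qed

lemma smooth_on_has_derivative:
  "smooth_on W f \<Longrightarrow> x \<in> W \<Longrightarrow> (f has_derivative frechet_derivative f (at x)) (at x)"
  unfolding smooth_on_def using Ck_on_Suc_has_derivative by blast

lemma smooth_on_directional:
  "smooth_on W f \<Longrightarrow> smooth_on W (\<lambda>x. frechet_derivative f (at x) v)"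
  unfolding smooth_on_def by (metis Ck_on.simps(2))

lemma smooth_on_imp_continuous_on: "smooth_on W f \<Longrightarrow> continuous_on W f"
  unfolding smooth_on_def by (metis Ck_on.simps(1))

section \<open>Hadamard's lemma\<close>

lemma segment_in_ball:
  fixes p x :: "'a::real_normed_vector"
  assumes "x \<in> ball p r" "t \<in> {0..1::real}"
  shows "p + t *\<^sub>R (x - p) \<in> ball p r"
proof -
  have "norm (t *\<^sub>R (x - p)) \<le> norm (x - p)"
    using assms(2) by (simp add: mult_left_le_one_le)
  moreover have "dist p (p + t *\<^sub>R (x - p)) = norm (t *\<^sub>R (x - p))"
    by (simp add: dist_norm)
  ultimately show ?thesis
    using assms(1) by (simp add: dist_norm norm_minus_commute)
qed

text \<open>Differentiation under the integral produces one more factor \<open>t\<close> and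
  replaces \<open>h\<close> by a partial derivative. With the weight \<open>t ^ m\<close> and
  arbitrary \<open>m\<close> the family of integrals is closed under this operation, so induction on
  \<open>k\<close> works.\<close>

lemma Ck_on_segment_integral:
  fixes h :: "'a::euclidean_space \<Rightarrow> real"
  shows "Ck_on k (ball p r) h \<Longrightarrow>
    Ck_on k (ball p r) (\<lambda>x. integral (cbox 0 1) (\<lambda>t. t ^ m * h (p + t *\<^sub>R (x - p))))"
proof (induction k arbitrary: h m)
  case 0
  have *: "continuous_on (ball p r \<times> cbox 0 1) (\<lambda>x. h (p + snd x *\<^sub>R (fst x - p)))"
  proof (rule continuous_on_compose2[of "ball p r" h])
    show "(\<lambda>x. p + snd x *\<^sub>R (fst x - p)) ` (ball p r \<times> cbox 0 1) \<subseteq> ball p r"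
      using segment_in_ball by fastforce
  qed (use 0 in \<open>auto intro!: continuous_intros\<close>)
  show ?case unfolding Ck_on.simps
    by (rule integral_continuous_on_param)
       (use * in \<open>auto simp: case_prod_beta intro!: continuous_intros\<close>)
next
  case (Suc k)
  let ?B = "ball p r"
  define h' where "h' b x = frechet_derivative h (at x) b" for b x
  \<comment> \<open>The derivative in \<open>x\<close> of the integrand, written through the basis
    functionals so that its continuity as a map into bounded linear functionals, which
    \<open>leibniz_rule\<close> asks for, can be read off.\<close>
  define L where "L x t = (\<Sum>b\<in>Basis. (t ^ Suc m * h' b (p + t *\<^sub>R (x - p))) *\<^sub>R blinfun_inner_left b)"
    for x and t :: real
  have Ck: "Ck_on k ?B (h' b)" for b using Suc.prems by (simp add: h'_def[abs_def])
  have cont: "continuous_on ?B (h' b)" for b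
  proof -
    have "Ck_on 0 ?B (h' b)"
      using Ck[of b] by (induction k) (blast dest: Ck_on_SucD)+
    then show ?thesis by simp
  qed
  have cont2: "continuous_on (?B \<times> cbox 0 1) (\<lambda>x. h' b (p + snd x *\<^sub>R (fst x - p)))" for b
  proof (rule continuous_on_compose2[OF cont])
    show "(\<lambda>x. p + snd x *\<^sub>R (fst x - p)) ` (?B \<times> cbox 0 1) \<subseteq> ?B"
      using segment_in_ball by fastforce
  qed (auto intro!: continuous_intros)
  have contt: "continuous_on (cbox 0 1) (\<lambda>t. h' b (p + t *\<^sub>R (x - p)))" if "x \<in> ?B" for b x
  proof (rule continuous_on_compose2[OF cont])
    show "(\<lambda>t. p + t *\<^sub>R (x - p)) ` cbox 0 1 \<subseteq> ?B"
      using segment_in_ball[OF that] by fastforce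
  qed (auto intro!: continuous_intros)
  have conth: "continuous_on (cbox 0 1) (\<lambda>t. h (p + t *\<^sub>R (x - p)))" if "x \<in> ?B" for x
  proof -
    have "continuous_on ?B h"
      using Suc.prems by (auto intro!: continuous_at_imp_continuous_on differentiable_imp_continuous_within)
    then show ?thesis
    proof (rule continuous_on_compose2)
      show "(\<lambda>t. p + t *\<^sub>R (x - p)) ` cbox 0 1 \<subseteq> ?B"
        using segment_in_ball[OF that] by fastforce
    qed (auto intro!: continuous_intros)
  qed
  have h'sum: "frechet_derivative h (at y) v = (\<Sum>b\<in>Basis. (v \<bullet> b) * h' b y)" if "y \<in> ?B" for y v
  proof -
    have "linear (frechet_derivative h (at y))"
      using Ck_on_Suc_has_derivative[OF Suc.prems that] has_derivative_linear by blast
    from linear_basis_expansion[OF this, of v] show ?thesis by (simp only: h'_def real_scaleR_def)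
  qed
  have Lapp: "blinfun_apply (L x t) v = t ^ Suc m * frechet_derivative h (at (p + t *\<^sub>R (x - p))) v"
    if "x \<in> ?B" "t \<in> cbox 0 1" for x t v
    using h'sum[OF segment_in_ball[OF that(1)]] that(2)
    by (simp add: L_def blinfun.sum_left blinfun.scaleR_left sum_distrib_left ac_simps inner_commute)
  have lr: "((\<lambda>x. integral (cbox 0 1) (\<lambda>t. t ^ m * h (p + t *\<^sub>R (x - p)))) has_derivative
        blinfun_apply (integral (cbox 0 1) (L x))) (at x within ?B)" if "x \<in> ?B" for x
  proof (rule leibniz_rule[OF _ _ _ that])
    fix x t assume xt: "x \<in> ?B" "t \<in> cbox 0 (1::real)"
    have y: "p + t *\<^sub>R (x - p) \<in> ?B" using segment_in_ball xt by auto
    have "((\<lambda>x. p + t *\<^sub>R (x - p)) has_derivative (\<lambda>v. t *\<^sub>R v)) (at x)"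
      by (auto intro!: derivative_eq_intros)
    from has_derivative_compose[OF this Ck_on_Suc_has_derivative[OF Suc.prems y]]
    have "((\<lambda>x. t ^ m * h (p + t *\<^sub>R (x - p))) has_derivative
       (\<lambda>v. t ^ m * frechet_derivative h (at (p + t *\<^sub>R (x - p))) (t *\<^sub>R v))) (at x)"
      by (rule has_derivative_mult_right)
    moreover have "linear (frechet_derivative h (at (p + t *\<^sub>R (x - p))))"
      using Ck_on_Suc_has_derivative[OF Suc.prems y] has_derivative_linear by blast
    then have "(\<lambda>v. t ^ m * frechet_derivative h (at (p + t *\<^sub>R (x - p))) (t *\<^sub>R v)) = blinfun_apply (L x t)"
      by (intro ext) (simp add: Lapp[OF xt] linear_cmul)
    ultimately show "((\<lambda>x. t ^ m * h (p + t *\<^sub>R (x - p))) has_derivative blinfun_apply (L x t)) (at x within ?B)"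
      by (metis has_derivative_at_withinI)
  next
    fix x assume "x \<in> ?B"
    then show "(\<lambda>t. t ^ m * h (p + t *\<^sub>R (x - p))) integrable_on cbox 0 1"
      by (intro integrable_continuous continuous_intros conth)
  next
    show "continuous_on (?B \<times> cbox 0 1) (\<lambda>(x, t). L x t)"
      unfolding L_def case_prod_beta by (intro continuous_intros cont2)
  qed simp
  have app: "blinfun_apply (integral (cbox 0 1) (L x)) v
      = (\<Sum>b\<in>Basis. (v \<bullet> b) * integral (cbox 0 1) (\<lambda>t. t ^ Suc m * h' b (p + t *\<^sub>R (x - p))))"
    if x: "x \<in> ?B" for x v
  proof -
    have int: "(\<lambda>t. (t ^ Suc m * h' b (p + t *\<^sub>R (x - p)))) integrable_on cbox 0 1" for b
      by (intro integrable_continuous continuous_intros contt x)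
    have "((\<lambda>t. (t ^ Suc m * h' b (p + t *\<^sub>R (x - p))) *\<^sub>R blinfun_inner_left b) has_integral
        integral (cbox 0 1) (\<lambda>t. t ^ Suc m * h' b (p + t *\<^sub>R (x - p))) *\<^sub>R blinfun_inner_left b) (cbox 0 1)" for b
      using has_integral_linear[OF integrable_integral[OF int[of b]] bounded_linear_scaleR_left]
      by (simp add: o_def)
    then have "integral (cbox 0 1) (L x) = (\<Sum>b\<in>Basis.
        integral (cbox 0 1) (\<lambda>t. t ^ Suc m * h' b (p + t *\<^sub>R (x - p))) *\<^sub>R blinfun_inner_left b)"
      unfolding L_def by (intro integral_unique has_integral_sum) auto
    then show ?thesis
      by (simp add: blinfun.sum_left blinfun.scaleR_left inner_commute mult.commute)
  qed
  have der: "((\<lambda>x. integral (cbox 0 1) (\<lambda>t. t ^ m * h (p + t *\<^sub>R (x - p)))) has_derivative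
      (\<lambda>v. \<Sum>b\<in>Basis. (v \<bullet> b) * integral (cbox 0 1) (\<lambda>t. t ^ Suc m * h' b (p + t *\<^sub>R (x - p))))) (at x)"
    if "x \<in> ?B" for x
  proof -
    have "blinfun_apply (integral (cbox 0 1) (L x)) = (\<lambda>v. \<Sum>b\<in>Basis. (v \<bullet> b) *
        integral (cbox 0 1) (\<lambda>t. t ^ Suc m * h' b (p + t *\<^sub>R (x - p))))"
      using app[OF that] by (rule ext)
    with lr[OF that] show ?thesis by (simp add: at_within_open[OF that open_ball])
  qed
  have ck: "Ck_on k ?B (\<lambda>x. \<Sum>b\<in>Basis. (v \<bullet> b) *
      integral (cbox 0 1) (\<lambda>t. t ^ Suc m * h' b (p + t *\<^sub>R (x - p))))" for v
    by (intro Ck_on_sum Ck_on_bilinear[OF bounded_bilinear_mult] Ck_on_const Suc.IH Ck open_ball)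
  show ?case
    by (rule Ck_on_SucI[OF open_ball der ck])
qed

text \<open>\<open>G b\<close> is the average over the segment from \<open>p\<close> to
  \<open>x\<close> of the partial derivative of \<open>f\<close> along \<open>b\<close>, and the
  formula is the fundamental theorem of calculus on that segment. In a ball the segment stays inside
  the domain.\<close>

lemma hadamard:
  fixes f :: "'a::euclidean_space \<Rightarrow> real"
  assumes "smooth_on (ball p r) f"
  obtains G where "\<And>b. smooth_on (ball p r) (G b)"
    "\<And>x. x \<in> ball p r \<Longrightarrow> f x = f p + (\<Sum>b\<in>Basis. ((x - p) \<bullet> b) * G b x)"
    "\<And>b. G b p = frechet_derivative f (at p) b"
proof
  let ?B = "ball p r"
  define f' where "f' b x = frechet_derivative f (at x) b" for b x
  define G where "G b x = integral (cbox 0 1) (\<lambda>t. t ^ 0 * f' b (p + t *\<^sub>R (x - p)))" for b x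
  have sf: "smooth_on ?B (f' b)" for b
    unfolding f'_def using smooth_on_directional[OF assms] .
  show "smooth_on ?B (G b)" for b
    using sf[of b] unfolding G_def smooth_on_def by (blast intro: Ck_on_segment_integral)
  show "f x = f p + (\<Sum>b\<in>Basis. ((x - p) \<bullet> b) * G b x)" if x: "x \<in> ?B" for x
  proof -
    have cont: "continuous_on (cbox 0 1) (\<lambda>t. f' b (p + t *\<^sub>R (x - p)))" for b
    proof (rule continuous_on_compose2[OF smooth_on_imp_continuous_on[OF sf]])
      show "(\<lambda>t. p + t *\<^sub>R (x - p)) ` cbox 0 1 \<subseteq> ?B"
        using segment_in_ball[OF x] by fastforce
    qed (auto intro!: continuous_intros)
    have "((\<lambda>t. f (p + t *\<^sub>R (x - p))) has_vector_derivative
        (\<Sum>b\<in>Basis. ((x - p) \<bullet> b) * f' b (p + t *\<^sub>R (x - p)))) (at t within {0..1})" if t: "t \<in> {0..1}" for t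
    proof -
      let ?y = "p + t *\<^sub>R (x - p)"
      have dy: "(f has_derivative frechet_derivative f (at ?y)) (at ?y)"
        using smooth_on_has_derivative[OF assms segment_in_ball[OF x t]] .
      have "((\<lambda>t. p + t *\<^sub>R (x - p)) has_derivative (\<lambda>s. s *\<^sub>R (x - p))) (at t within {0..1})"
        by (auto intro!: derivative_eq_intros)
      from has_derivative_compose[OF this dy]
      have "((\<lambda>t. f (p + t *\<^sub>R (x - p))) has_derivative
          (\<lambda>s. frechet_derivative f (at ?y) (s *\<^sub>R (x - p)))) (at t within {0..1})" .
      moreover have lin: "linear (frechet_derivative f (at ?y))"
        using dy has_derivative_linear by blast
      have "frechet_derivative f (at ?y) (s *\<^sub>R (x - p)) = s *\<^sub>R (\<Sum>b\<in>Basis. ((x - p) \<bullet> b) * f' b ?y)" for s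
        using linear_basis_expansion[OF lin, of "x - p"] by (simp only: linear_cmul[OF lin] f'_def real_scaleR_def)
      ultimately show ?thesis by (simp add: has_vector_derivative_def)
    qed
    then have "((\<lambda>t. \<Sum>b\<in>Basis. ((x - p) \<bullet> b) * f' b (p + t *\<^sub>R (x - p))) has_integral
        f (p + 1 *\<^sub>R (x - p)) - f (p + 0 *\<^sub>R (x - p))) {0..1}"
      by (intro fundamental_theorem_of_calculus) auto
    moreover have "((\<lambda>t. \<Sum>b\<in>Basis. ((x - p) \<bullet> b) * f' b (p + t *\<^sub>R (x - p))) has_integral
        (\<Sum>b\<in>Basis. ((x - p) \<bullet> b) * G b x)) {0..1}"
      unfolding G_def using cont
      by (intro has_integral_sum has_integral_mult_right) (auto intro!: integrable_integral integrable_continuous_real)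
    ultimately have "f (p + 1 *\<^sub>R (x - p)) - f (p + 0 *\<^sub>R (x - p)) = (\<Sum>b\<in>Basis. ((x - p) \<bullet> b) * G b x)"
      by (rule has_integral_unique)
    then show ?thesis by simp
  qed
  show "G b p = frechet_derivative f (at p) b" for b
    by (simp add: G_def f'_def)
qed

section \<open>Charts\<close>

lemma
  assumes "smooth_atlas A" "(U, \<phi>) \<in> A"
  shows atlas_open: "open U"
    and atlas_open_image: "open (\<phi> ` U)"
    and atlas_inv: "\<And>x. x \<in> U \<Longrightarrow> inv_into U \<phi> (\<phi> x) = x"
    and atlas_continuous: "continuous_on U \<phi>"
    and atlas_continuous_inv: "continuous_on (\<phi> ` U) (inv_into U \<phi>)"
  using assms unfolding smooth_atlas_def by (auto simp: homeomorphism_def)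

lemma atlas_transition:
  assumes "smooth_atlas A" "(U, \<phi>) \<in> A" "(V, \<psi>) \<in> A"
  shows "smooth_on (\<phi> ` (U \<inter> V)) (\<lambda>y. \<psi> (inv_into U \<phi> y))"
  using assms unfolding smooth_atlas_def by (fastforce simp: o_def)

lemma atlas_cover:
  assumes "smooth_atlas A"
  obtains U \<phi> where "(U, \<phi>) \<in> A" "p \<in> U"
proof -
  have "p \<in> (\<Union>(U, \<phi>)\<in>A. U)" using assms unfolding smooth_atlas_def by simp
  then show ?thesis using that by auto
qed

lemma atlas_open_image_Int:
  assumes "smooth_atlas A" "(U, \<phi>) \<in> A" "open N"
  shows "open (\<phi> ` (U \<inter> N))"
proof -
  have "\<phi> ` (U \<inter> N) = \<phi> ` U \<inter> inv_into U \<phi> -` N"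
    using atlas_inv[OF assms(1,2)] by (auto simp: image_iff)
  then show ?thesis
    using continuous_on_open_vimage[OF atlas_open_image[OF assms(1,2)]]
      atlas_continuous_inv[OF assms(1,2)] assms(3) by (metis Int_commute)
qed

text \<open>A germ is smooth by definition if it is so in some chart; since transition maps are
  smooth, the same holds in each prescribed chart around the point. Later arguments can thus fix one
  chart for several germs.\<close>

lemma smooth_germs_chart:
  assumes A: "smooth_atlas A" and U: "(U, \<phi>) \<in> A" "p \<in> U"
  shows "f \<in> smooth_germs A p \<longleftrightarrow>
    (\<exists>N. open N \<and> p \<in> N \<and> N \<subseteq> U \<and> smooth_on (\<phi> ` N) (\<lambda>y. f (inv_into U \<phi> y)))" (is "_ \<longleftrightarrow> ?R")
proof
  assume "f \<in> smooth_germs A p"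
  then obtain V \<psi> W where V: "(V, \<psi>) \<in> A" "p \<in> V" and W: "open W" "\<psi> p \<in> W" "W \<subseteq> \<psi> ` V"
    and f: "smooth_on W (\<lambda>y. f (inv_into V \<psi> y))"
    unfolding smooth_germs_def by (auto simp: o_def)
  have "open (V \<inter> \<psi> -` W)"
    using continuous_on_open_vimage[OF atlas_open[OF A V(1)]] atlas_continuous[OF A V(1)] W(1)
    by (metis Int_commute)
  then obtain N where N: "N = U \<inter> (V \<inter> \<psi> -` W)" "open N"
    using atlas_open[OF A U(1)] by blast
  let ?\<tau> = "\<lambda>y. \<psi> (inv_into U \<phi> y)"
  have oN: "open (\<phi> ` N)"
    using atlas_open_image_Int[OF A U(1) N(2)] N(1) by (simp add: Int_absorb1 inf.coboundedI1)
  have "smooth_on (\<phi> ` N) (\<lambda>y. f (inv_into V \<psi> (?\<tau> y)))"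
  proof (rule smooth_on_compose[OF oN _ _ f])
    show "?\<tau> ` \<phi> ` N \<subseteq> W"
      using atlas_inv[OF A U(1)] N(1) by auto
    show "smooth_on (\<phi> ` N) ?\<tau>"
      by (rule smooth_on_subset[OF atlas_transition[OF A U(1) V(1)]]) (use N(1) in auto)
  qed
  then have "smooth_on (\<phi> ` N) (\<lambda>y. f (inv_into U \<phi> y))"
    using oN N(1) atlas_inv[OF A U(1)] atlas_inv[OF A V(1)] by (elim smooth_on_cong[rotated]) auto
  then show ?R using N U(2) V(2) W(2) by blast
next
  assume ?R
  then obtain N where N: "open N" "p \<in> N" "N \<subseteq> U" "smooth_on (\<phi> ` N) (\<lambda>y. f (inv_into U \<phi> y))"
    by blast
  moreover have "open (\<phi> ` N)"
    using atlas_open_image_Int[OF A U(1) N(1)] N(3) by (simp add: Int_absorb1)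
  ultimately show "f \<in> smooth_germs A p"
    using U unfolding smooth_germs_def o_def by blast
qed

lemma chart_nhd:
  assumes "smooth_atlas A" "(U, \<phi>) \<in> A" "open N" "N \<subseteq> U"
  shows "open (\<phi> ` N)"
  using atlas_open_image_Int[OF assms(1-3)] assms(4) by (simp add: Int_absorb1)

lemma smooth_germs_chartI:
  assumes A: "smooth_atlas A" "(U, \<phi>) \<in> A" and N: "open N" "N \<subseteq> U"
    and f: "smooth_on (\<phi> ` N) (\<lambda>y. f (inv_into U \<phi> y))" and "p \<in> N"
  shows "f \<in> smooth_germs A p"
  using assms smooth_germs_chart[OF A, of p f] by blast

lemma smooth_germs_cong:
  assumes A: "smooth_atlas A" and f: "f \<in> smooth_germs A p" and eq: "\<forall>\<^sub>F x in nhds p. f x = h x"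
  shows "h \<in> smooth_germs A p"
proof -
  obtain U \<phi> where U: "(U, \<phi>) \<in> A" "p \<in> U" using atlas_cover[OF A] .
  obtain N where N: "open N" "p \<in> N" "N \<subseteq> U" "smooth_on (\<phi> ` N) (\<lambda>y. f (inv_into U \<phi> y))"
    using f smooth_germs_chart[OF A U] by blast
  obtain N' where N': "open N'" "p \<in> N'" "\<And>x. x \<in> N' \<Longrightarrow> f x = h x"
    using eq by (auto simp: eventually_nhds)
  have sub: "N \<inter> N' \<subseteq> U" using N by auto
  have "smooth_on (\<phi> ` (N \<inter> N')) (\<lambda>y. f (inv_into U \<phi> y))"
    by (rule smooth_on_subset[OF N(4)]) auto
  then have "smooth_on (\<phi> ` (N \<inter> N')) (\<lambda>y. h (inv_into U \<phi> y))"
    using N N' atlas_inv[OF A U(1)] chart_nhd[OF A U(1) _ sub]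
    by (elim smooth_on_cong[rotated]) auto
  then show ?thesis
    using N N' sub smooth_germs_chart[OF A U] by (meson IntI open_Int)
qed

lemma eventually_smooth_germs:
  assumes A: "smooth_atlas A" and f: "f \<in> smooth_germs A p"
  shows "\<forall>\<^sub>F x in nhds p. f \<in> smooth_germs A x"
proof -
  obtain U \<phi> where U: "(U, \<phi>) \<in> A" "p \<in> U" using atlas_cover[OF A] .
  then show ?thesis
    using f smooth_germs_chart[OF A U] smooth_germs_chartI[OF A U(1)]
    unfolding eventually_nhds by metis
qed

lemma smooth_germs_tendsto:
  assumes A: "smooth_atlas A" and f: "f \<in> smooth_germs A p"
  shows "(f \<longlongrightarrow> f p) (nhds p)"
proof -
  obtain U \<phi> where U: "(U, \<phi>) \<in> A" "p \<in> U" using atlas_cover[OF A] .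
  obtain N where N: "open N" "p \<in> N" "N \<subseteq> U" "smooth_on (\<phi> ` N) (\<lambda>y. f (inv_into U \<phi> y))"
    using f smooth_germs_chart[OF A U] by blast
  have "continuous_on N (\<lambda>x. f (inv_into U \<phi> (\<phi> x)))"
    using continuous_on_compose2[OF smooth_on_imp_continuous_on[OF N(4)]]
      continuous_on_subset[OF atlas_continuous[OF A U(1)] N(3)] by blast
  then have "continuous_on N f"
    using atlas_inv[OF A U(1)] N(3) by (metis (mono_tags, lifting) continuous_on_cong subsetD)
  then have "(f \<longlongrightarrow> f p) (at p within N)"
    using N by (simp add: continuous_on_def)
  then show ?thesis
    using N by (simp add: at_within_open[OF N(2,1)] tendsto_at_iff_tendsto_nhds)
qed

lemma smooth_germs_const: "smooth_atlas A \<Longrightarrow> (\<lambda>x. c) \<in> smooth_germs A p"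
proof -
  assume A: "smooth_atlas A"
  obtain U \<phi> where U: "(U, \<phi>) \<in> A" "p \<in> U" using atlas_cover[OF A] .
  then show ?thesis
    using smooth_germs_chart[OF A U] smooth_on_const[OF atlas_open_image[OF A U(1)]] atlas_open[OF A U(1)]
    by blast
qed

lemma smooth_germs_binop:
  assumes A: "smooth_atlas A" and f: "f \<in> smooth_germs A p" and h: "h \<in> smooth_germs A p"
    and op: "\<And>W (u::'e::euclidean_space \<Rightarrow> real) v. open W \<Longrightarrow> smooth_on W u \<Longrightarrow> smooth_on W v
        \<Longrightarrow> smooth_on W (\<lambda>x. op (u x) (v x))"
  shows "(\<lambda>x. op (f x) (h x)) \<in> smooth_germs (A :: ('m::topological_space, 'e) atlas) p"
proof -
  obtain U \<phi> where U: "(U, \<phi>) \<in> A" "p \<in> U" using atlas_cover[OF A] .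
  obtain N where N: "open N" "p \<in> N" "N \<subseteq> U" "smooth_on (\<phi> ` N) (\<lambda>y. f (inv_into U \<phi> y))"
    using f smooth_germs_chart[OF A U] by blast
  obtain N' where N': "open N'" "p \<in> N'" "N' \<subseteq> U" "smooth_on (\<phi> ` N') (\<lambda>y. h (inv_into U \<phi> y))"
    using h smooth_germs_chart[OF A U] by blast
  have sub: "N \<inter> N' \<subseteq> U" using N by auto
  have "smooth_on (\<phi> ` (N \<inter> N')) (\<lambda>y. op (f (inv_into U \<phi> y)) (h (inv_into U \<phi> y)))"
    using N N' by (intro op chart_nhd[OF A U(1) _ sub]) (auto intro: smooth_on_subset)
  then show ?thesis
    using N N' sub smooth_germs_chart[OF A U] by (meson IntI open_Int)
qed

lemma smooth_germs_inverse:
  assumes A: "smooth_atlas A" and f: "f \<in> smooth_germs A p" "f p \<noteq> 0"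
  shows "(\<lambda>x. inverse (f x)) \<in> smooth_germs A p"
proof -
  obtain U \<phi> where U: "(U, \<phi>) \<in> A" "p \<in> U" using atlas_cover[OF A] .
  obtain N where N: "open N" "p \<in> N" "N \<subseteq> U" "smooth_on (\<phi> ` N) (\<lambda>y. f (inv_into U \<phi> y))"
    using f smooth_germs_chart[OF A U] by blast
  have "\<forall>\<^sub>F x in nhds p. f x \<noteq> 0"
    using tendsto_imp_eventually_ne[OF smooth_germs_tendsto[OF A f(1)] f(2)] .
  then obtain N' where N': "open N'" "p \<in> N'" "\<And>x. x \<in> N' \<Longrightarrow> f x \<noteq> 0"
    by (auto simp: eventually_nhds)
  have sub: "N \<inter> N' \<subseteq> U" using N by auto
  have "smooth_on (\<phi> ` (N \<inter> N')) (\<lambda>y. inverse (f (inv_into U \<phi> y)))"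
    using N N' atlas_inv[OF A U(1)]
    by (intro smooth_on_inverse chart_nhd[OF A U(1) _ sub]) (auto intro: smooth_on_subset)
  then show ?thesis
    using N N' sub smooth_germs_chart[OF A U] by (meson IntI open_Int)
qed

section \<open>Smooth spaces\<close>

abbreviation near :: "'m::topological_space smooth_space \<Rightarrow> 'm \<Rightarrow> 'm filter" where
  "near X p \<equiv> inf (nhds p) (principal (points X))"

text \<open>What derivations and connections use of a sheaf of functions, common to manifolds and
  embedded submanifolds. The filter \<open>near X p\<close> ignores points outside \<open>X\<close>,
  because a submanifold shares the type of its ambient manifold and its germs are arbitrary off the
  submanifold.\<close>

locale smooth_structure =
  fixes X :: "'m::topological_space smooth_space"
  assumes germ_const: "p \<in> points X \<Longrightarrow> (\<lambda>x. c) \<in> germs X p"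
    and germ_add: "p \<in> points X \<Longrightarrow> f \<in> germs X p \<Longrightarrow> h \<in> germs X p \<Longrightarrow> (\<lambda>x. f x + h x) \<in> germs X p"
    and germ_mult: "p \<in> points X \<Longrightarrow> f \<in> germs X p \<Longrightarrow> h \<in> germs X p \<Longrightarrow> (\<lambda>x. f x * h x) \<in> germs X p"
    and germ_inverse: "p \<in> points X \<Longrightarrow> f \<in> germs X p \<Longrightarrow> f p \<noteq> 0 \<Longrightarrow> (\<lambda>x. inverse (f x)) \<in> germs X p"
    and germ_cong: "p \<in> points X \<Longrightarrow> f \<in> germs X p \<Longrightarrow> \<forall>\<^sub>F x in near X p. f x = h x \<Longrightarrow> h \<in> germs X p"
    and germ_near: "p \<in> points X \<Longrightarrow> f \<in> germs X p \<Longrightarrow> \<forall>\<^sub>F x in near X p. f \<in> germs X x"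
    and germ_tendsto: "p \<in> points X \<Longrightarrow> f \<in> germs X p \<Longrightarrow> (f \<longlongrightarrow> f p) (near X p)"

lemma points_mfd [simp]: "points (mfd A) = UNIV" and germs_mfd [simp]: "germs (mfd A) = smooth_germs A"
  by (simp_all add: mfd_def)

lemma points_submfd [simp]: "points (submfd A S) = S"
  by (simp add: submfd_def)

lemma germs_submfd:
  "h \<in> germs (submfd A S) q \<longleftrightarrow> (\<exists>F\<in>smooth_germs A q. \<forall>\<^sub>F x in near (submfd A S) q. h x = F x)"
  by (auto simp: submfd_def eventually_inf_principal eventually_nhds)

lemma smooth_germs_restrict:
  "F \<in> smooth_germs A q \<Longrightarrow> F \<in> germs (submfd A S) q"
  unfolding germs_submfd by (rule bexI[of _ F]) simp_all

text \<open>Reduces manifolds to submanifolds with \<open>S = UNIV\<close>: a function that agrees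
  with a smooth germ near the point is itself one.\<close>

lemma mfd_eq_submfd:
  assumes "smooth_atlas A" shows "mfd A = submfd A UNIV"
proof -
  have "h \<in> smooth_germs A q \<longleftrightarrow> h \<in> germs (submfd A UNIV) q" for h q
  proof
    show "h \<in> germs (submfd A UNIV) q \<Longrightarrow> h \<in> smooth_germs A q"
      unfolding germs_submfd by (auto intro: smooth_germs_cong[OF assms] elim!: eventually_mono)
  qed (rule smooth_germs_restrict)
  then have "smooth_germs A = germs (submfd A UNIV)" by blast
  then show ?thesis
    unfolding mfd_def by (simp add: submfd_def)
qed

lemma near_self: "p \<in> points X \<Longrightarrow> \<forall>\<^sub>F x in near X p. P x \<Longrightarrow> P p"
  by (auto simp: eventually_inf_principal dest: eventually_nhds_x_imp_x)

lemma near_near: "\<forall>\<^sub>F x in near X p. P x \<Longrightarrow> \<forall>\<^sub>F x in near X p. \<forall>\<^sub>F y in near X x. P y"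
  unfolding eventually_inf_principal by (subst (asm) eventually_eventually[symmetric]) (auto elim: eventually_mono)

lemma near_points: "\<forall>\<^sub>F x in near X p. x \<in> points X"
  by (simp add: eventually_inf_principal)

lemma near_nhds: "\<forall>\<^sub>F x in nhds p. P x \<Longrightarrow> \<forall>\<^sub>F x in near X p. P x"
  by (auto simp: eventually_inf_principal elim: eventually_mono)

lemma smooth_structure_submfd:
  assumes A: "smooth_atlas A"
  shows "smooth_structure (submfd A S)"
proof (rule smooth_structure.intro, unfold points_submfd)
  fix p f h and c :: real
  let ?X = "submfd A S"
  assume p: "p \<in> S"
  show "(\<lambda>x. c) \<in> germs ?X p"
    by (intro smooth_germs_restrict smooth_germs_const A)
  assume f: "f \<in> germs ?X p"
  then obtain F where F: "F \<in> smooth_germs A p" "\<forall>\<^sub>F x in near ?X p. f x = F x"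
    by (auto simp only: germs_submfd)
  have p0: "f p = F p" using near_self[OF _ F(2)] p by simp
  show "(\<lambda>x. inverse (f x)) \<in> germs ?X p" if "f p \<noteq> 0"
    unfolding germs_submfd using smooth_germs_inverse[OF A F(1)] F(2) that p0
    by (intro bexI[of _ "\<lambda>x. inverse (F x)"]) (auto elim!: eventually_mono)
  have "\<forall>\<^sub>F x in near ?X p. F \<in> smooth_germs A x"
    using near_nhds[OF eventually_smooth_germs[OF A F(1)]] .
  with near_near[OF F(2)] have "\<forall>\<^sub>F x in near ?X p. f \<in> germs ?X x"
    by eventually_elim (unfold germs_submfd, blast)
  then show "\<forall>\<^sub>F x in inf (nhds p) (principal S). f \<in> germs ?X x" by simp
  have "(F \<longlongrightarrow> F p) (near ?X p)"
    using smooth_germs_tendsto[OF A F(1)] by (rule tendsto_mono[rotated]) simp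
  then show "(f \<longlongrightarrow> f p) (inf (nhds p) (principal S))"
    using F(2) p0 tendsto_cong[OF F(2)] by simp
  show "h \<in> germs ?X p" if "\<forall>\<^sub>F x in inf (nhds p) (principal S). f x = h x"
  proof -
    have "\<forall>\<^sub>F x in near ?X p. h x = F x"
      using F(2) that unfolding points_submfd by eventually_elim simp
    then show ?thesis using F(1) germs_submfd by blast
  qed
  assume "h \<in> germs ?X p"
  then obtain G where G: "G \<in> smooth_germs A p" "\<forall>\<^sub>F x in near ?X p. h x = G x"
    by (auto simp only: germs_submfd)
  have "\<forall>\<^sub>F x in near ?X p. f x + h x = F x + G x" "\<forall>\<^sub>F x in near ?X p. f x * h x = F x * G x"
    using F(2) G(2) by (eventually_elim; simp)+
  moreover have "(\<lambda>x. F x + G x) \<in> smooth_germs A p" "(\<lambda>x. F x * G x) \<in> smooth_germs A p"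
    using smooth_germs_binop[OF A F(1) G(1)] smooth_on_add smooth_on_mult by blast+
  ultimately show "(\<lambda>x. f x + h x) \<in> germs ?X p" "(\<lambda>x. f x * h x) \<in> germs ?X p"
    by (auto simp only: germs_submfd)
qed

lemma smooth_structure_mfd: "smooth_atlas A \<Longrightarrow> smooth_structure (mfd A)"
  by (simp add: mfd_eq_submfd smooth_structure_submfd)

subsection \<open>Tangent vectors\<close>

lemmas tvec_defs = tzero_def tadd_def tscale_def tdiff_def

lemma tangent_zero: "v \<in> tangent X p \<Longrightarrow> f \<notin> germs X p \<Longrightarrow> v f = 0"
  by (simp add: tangent_def)

lemma tangent_eqI:
  assumes "u \<in> tangent X p" "v \<in> tangent X p" "\<And>f. f \<in> germs X p \<Longrightarrow> u f = v f"
  shows "u = v"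
proof
  show "u f = v f" for f
    using assms tangent_zero[of u X p f] tangent_zero[of v X p f] by (cases "f \<in> germs X p") auto
qed

lemma tangent_mult:
  "v \<in> tangent X p \<Longrightarrow> f \<in> germs X p \<Longrightarrow> h \<in> germs X p \<Longrightarrow> v (\<lambda>x. f x * h x) = f p * v h + h p * v f"
  by (simp add: tangent_def)

lemma tangent_lin:
  "v \<in> tangent X p \<Longrightarrow> f \<in> germs X p \<Longrightarrow> h \<in> germs X p \<Longrightarrow>
    v (\<lambda>x. a * f x + b * h x) = a * v f + b * v h"
  by (simp add: tangent_def)

context smooth_structure
begin

lemma germ_cmult: "p \<in> points X \<Longrightarrow> f \<in> germs X p \<Longrightarrow> (\<lambda>x. c * f x) \<in> germs X p"
  using germ_mult[OF _ germ_const] by blast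

lemma germ_diff: "p \<in> points X \<Longrightarrow> f \<in> germs X p \<Longrightarrow> h \<in> germs X p \<Longrightarrow> (\<lambda>x. f x - h x) \<in> germs X p"
  using germ_add[OF _ _ germ_cmult[of p h "-1"]] by simp

lemma germ_sum:
  "p \<in> points X \<Longrightarrow> (\<And>i. i \<in> I \<Longrightarrow> f i \<in> germs X p) \<Longrightarrow> (\<lambda>x. \<Sum>i\<in>I. f i x) \<in> germs X p"
  by (induction I rule: infinite_finite_induct) (auto intro: germ_add germ_const)

lemma germ_cong_iff:
  "p \<in> points X \<Longrightarrow> \<forall>\<^sub>F x in near X p. f x = h x \<Longrightarrow> f \<in> germs X p \<longleftrightarrow> h \<in> germs X p"
  using germ_cong[of p f h] germ_cong[of p h f] by (auto simp: eq_commute)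

lemma tangent_add:
  "v \<in> tangent X p \<Longrightarrow> f \<in> germs X p \<Longrightarrow> h \<in> germs X p \<Longrightarrow> v (\<lambda>x. f x + h x) = v f + v h"
  using tangent_lin[of v X p f h 1 1] by simp

lemma tangent_diff:
  "v \<in> tangent X p \<Longrightarrow> f \<in> germs X p \<Longrightarrow> h \<in> germs X p \<Longrightarrow> v (\<lambda>x. f x - h x) = v f - v h"
  using tangent_lin[of v X p f h 1 "-1"] by simp

lemma tangent_const:
  assumes "p \<in> points X" "v \<in> tangent X p" shows "v (\<lambda>x. c) = 0"
proof -
  have "v (\<lambda>x. 1) = 0"
    using tangent_mult[OF assms(2) germ_const germ_const, of 1 1] assms(1) by simp
  then show ?thesis
    using tangent_lin[OF assms(2) germ_const germ_const, of c 1 0 1] assms(1) by simp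
qed

lemma tangent_cmult:
  "p \<in> points X \<Longrightarrow> v \<in> tangent X p \<Longrightarrow> f \<in> germs X p \<Longrightarrow> v (\<lambda>x. c * f x) = c * v f"
  using tangent_lin[of v X p f f c 0] by simp

lemma tangent_sum:
  assumes "p \<in> points X" "v \<in> tangent X p"
  shows "(\<And>i. i \<in> I \<Longrightarrow> f i \<in> germs X p) \<Longrightarrow> v (\<lambda>x. \<Sum>i\<in>I. f i x) = (\<Sum>i\<in>I. v (f i))"
  using assms(1)
  by (induction I rule: infinite_finite_induct)
     (simp_all add: tangent_const[OF assms] tangent_add[OF assms(2)] germ_sum)

text \<open>Since germs are total functions, a cutoff can be chosen so that its product with \<open>f - h\<close>
  vanishes identically.\<close>
lemma tangent_cong:
  assumes p: "p \<in> points X" and v: "v \<in> tangent X p" and eq: "\<forall>\<^sub>F x in near X p. f x = h x"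
  shows "v f = v h"
proof (cases "f \<in> germs X p")
  case True
  then have h: "h \<in> germs X p" using germ_cong[OF p _ eq] by blast
  define \<rho> :: "'m \<Rightarrow> real" where "\<rho> x = (if f x = h x then 1 else 0)" for x
  have \<rho>: "\<rho> \<in> germs X p"
    by (rule germ_cong[OF p germ_const[OF p, of 1]]) (use eq in \<open>auto simp: \<rho>_def elim: eventually_mono\<close>)
  have "f p = h p" using near_self[OF p eq] .
  then have "v (\<lambda>x. \<rho> x * (f x - h x)) = v (\<lambda>x. f x - h x)"
    by (subst tangent_mult[OF v \<rho> germ_diff[OF p True h]]) (simp add: \<rho>_def)
  moreover have "(\<lambda>x. \<rho> x * (f x - h x)) = (\<lambda>x. 0)" by (auto simp: \<rho>_def)
  ultimately show ?thesis
    using tangent_diff[OF v True h] tangent_const[OF p v, of 0] by simp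
next
  case False
  then show ?thesis
    using germ_cong_iff[OF p eq] tangent_zero[OF v] by metis
qed

lemma tangent_comb:
  assumes "u \<in> tangent X p" "v \<in> tangent X p"
  shows tangent_tadd: "u +\<^sub>T v \<in> tangent X p"
    and tangent_tscale: "c *\<^sub>T u \<in> tangent X p"
    and tangent_tdiff: "u -\<^sub>T v \<in> tangent X p"
  using assms unfolding tangent_def tvec_defs by (auto simp: algebra_simps)

end

lemma tangent_tzero: "tzero \<in> tangent X p"
  by (simp add: tangent_def tzero_def)

subsection \<open>Smooth maps\<close>

lemma smooth_map_points: "smooth_map X Y f \<Longrightarrow> p \<in> points X \<Longrightarrow> f p \<in> points Y"
  and smooth_map_germs: "smooth_map X Y f \<Longrightarrow> p \<in> points X \<Longrightarrow> h \<in> germs Y (f p) \<Longrightarrow> (\<lambda>x. h (f x)) \<in> germs X p"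
  unfolding smooth_map_def o_def by blast+

lemma push_apply: "h \<in> germs Y (f p) \<Longrightarrow> push X Y f p v h = v (\<lambda>x. h (f x))"
  by (simp add: push_def o_def)

text \<open>Indicator functions are germs, which makes smooth maps continuous.\<close>
lemma smooth_map_near:
  assumes X: "smooth_structure X" and Y: "smooth_structure Y" and f: "smooth_map X Y f"
    and p: "p \<in> points X" and ev: "\<forall>\<^sub>F y in near Y (f p). P y"
  shows "\<forall>\<^sub>F x in near X p. P (f x)"
proof -
  interpret X: smooth_structure X by fact
  interpret Y: smooth_structure Y by fact
  note fp = smooth_map_points[OF f p]
  define \<rho> :: "_ \<Rightarrow> real" where "\<rho> y = (if P y then 1 else 0)" for y
  have "\<rho> \<in> germs Y (f p)"
    by (rule Y.germ_cong[OF fp Y.germ_const[OF fp, of 1]])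
      (use ev in \<open>auto simp: \<rho>_def elim: eventually_mono\<close>)
  from X.germ_tendsto[OF p smooth_map_germs[OF f p this]]
  have "((\<lambda>x. \<rho> (f x)) \<longlongrightarrow> 1) (near X p)"
    using near_self[OF fp ev] by (simp add: \<rho>_def)
  then have "\<forall>\<^sub>F x in near X p. \<rho> (f x) > 1 / 2"
    by (rule order_tendstoD) simp
  then show ?thesis
    by (rule eventually_mono) (simp add: \<rho>_def split: if_splits)
qed

lemma push_tangent:
  assumes Y: "smooth_structure Y" and f: "smooth_map X Y f" and p: "p \<in> points X" and v: "v \<in> tangent X p"
  shows "push X Y f p v \<in> tangent Y (f p)"
proof -
  interpret Y: smooth_structure Y by fact
  note fp = smooth_map_points[OF f p] and g = smooth_map_germs[OF f p]
  show ?thesis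
    using Y.germ_add[OF fp] Y.germ_mult[OF fp] Y.germ_cmult[OF fp] tangent_lin[OF v g g] tangent_mult[OF v g g]
    by (auto simp: tangent_def push_def o_def)
qed

lemma
  shows push_tadd: "push X Y f p (u +\<^sub>T v) = push X Y f p u +\<^sub>T push X Y f p v"
    and push_tscale: "push X Y f p (c *\<^sub>T u) = c *\<^sub>T push X Y f p u"
    and push_tdiff: "push X Y f p (u -\<^sub>T v) = push X Y f p u -\<^sub>T push X Y f p v"
  by (auto simp: push_def tvec_defs)

subsection \<open>Sections along a map\<close>

lemma sections_iff:
  "V \<in> sections X Y f p \<longleftrightarrow> (\<forall>\<^sub>F q in near X p.
     V q \<in> tangent Y (f q) \<and> (\<forall>h\<in>germs Y (f q). (\<lambda>x. V x h) \<in> germs X q))"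
  unfolding sections_def eventually_inf_principal eventually_nhds by blast

lemma sections_near: "V \<in> sections X Y f p \<Longrightarrow> \<forall>\<^sub>F q in near X p. V \<in> sections X Y f q"
  unfolding sections_iff by (rule near_near)

lemma section_tangent: "V \<in> sections X Y f p \<Longrightarrow> p \<in> points X \<Longrightarrow> V p \<in> tangent Y (f p)"
  unfolding sections_iff using near_self by fastforce

lemma section_germ:
  "V \<in> sections X Y f p \<Longrightarrow> p \<in> points X \<Longrightarrow> h \<in> germs Y (f p) \<Longrightarrow> (\<lambda>x. V x h) \<in> germs X p"
  unfolding sections_iff using near_self by fastforce

lemma section_comp:
  assumes X: "smooth_structure X" and Y: "smooth_structure Y" and f: "smooth_map X Y f"
    and p: "p \<in> points X" and Z: "Z \<in> fields Y (f p)"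
  shows "Z \<circ> f \<in> sections X Y f p"
proof -
  have "\<forall>\<^sub>F x in near X p. Z (f x) \<in> tangent Y (id (f x)) \<and> (\<forall>h\<in>germs Y (id (f x)). (\<lambda>x. Z x h) \<in> germs Y (f x))"
    using smooth_map_near[OF X Y f p] Z unfolding sections_iff by blast
  then show ?thesis
    unfolding sections_iff using near_points
    by eventually_elim (auto intro: smooth_map_germs[OF f])
qed

context smooth_structure
begin

lemma section_add:
  assumes "V \<in> sections X Y f p" "W \<in> sections X Y f p"
  shows "(\<lambda>q. V q +\<^sub>T W q) \<in> sections X Y f p"
  using assms near_points unfolding sections_iff
  by eventually_elim (auto simp: tadd_def tangent_def algebra_simps intro!: germ_add)

lemma section_scale:
  assumes "a \<in> germs X p" "V \<in> sections X Y f p" "p \<in> points X"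
  shows "(\<lambda>q. a q *\<^sub>T V q) \<in> sections X Y f p"
  using assms(2) germ_near[OF assms(3,1)] near_points unfolding sections_iff
  by eventually_elim (auto simp: tscale_def tangent_def algebra_simps intro!: germ_mult)

lemma section_cong:
  assumes "V \<in> sections X Y f p" "\<forall>\<^sub>F x in near X p. V x = W x"
  shows "W \<in> sections X Y f p"
  using assms(1) near_near[OF assms(2)] assms(2) near_points unfolding sections_iff
proof eventually_elim
  case (elim q)
  have "(\<lambda>x. W x h) \<in> germs X q" if "(\<lambda>x. V x h) \<in> germs X q" for h
    by (rule germ_cong[OF elim(4) that]) (use elim(2) in \<open>auto elim: eventually_mono\<close>)
  with elim show ?case by auto
qed

end

subsection \<open>Connections\<close>

lemma
  assumes D: "connection_along X Y f D" and p: "p \<in> points X" and v: "v \<in> tangent X p" and V: "V \<in> sections X Y f p"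
  shows connection_tangent: "D p v V \<in> tangent Y (f p)"
    and connection_add: "V' \<in> sections X Y f p \<Longrightarrow> D p v (\<lambda>q. V q +\<^sub>T V' q) = D p v V +\<^sub>T D p v V'"
    and connection_scale: "h \<in> germs X p \<Longrightarrow> D p v (\<lambda>q. h q *\<^sub>T V q) = v h *\<^sub>T V p +\<^sub>T h p *\<^sub>T D p v V"
  using assms unfolding connection_along_def by blast+

lemma connection_section:
  assumes "connection_along X Y f D" "p \<in> points X" "Z \<in> fields X p" "V \<in> sections X Y f p"
  shows "(\<lambda>q. D q (Z q) V) \<in> sections X Y f p"
  using assms unfolding connection_along_def by blast

text \<open>Connections are local. The indicator \<rho> of the set where the sections agree
  satisfies \<open>\<rho> V = \<rho> V'\<close> everywhere, while the Leibniz rule with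
  \<open>v \<rho> = 0\<close> and \<open>\<rho> p = 1\<close> shows that multiplication by \<rho>
  does not change the derivative at \<open>p\<close>.\<close>

lemma (in smooth_structure) connection_cong:
  assumes D: "connection_along X Y f D" and p: "p \<in> points X" and v: "v \<in> tangent X p"
    and V: "V \<in> sections X Y f p" and eq: "\<forall>\<^sub>F x in near X p. V x = V' x"
  shows "D p v V = D p v V'"
proof -
  have V': "V' \<in> sections X Y f p"
    using section_cong[OF V eq] .
  define \<rho> :: "'m \<Rightarrow> real" where "\<rho> x = (if V x = V' x then 1 else 0)" for x
  have ev: "\<forall>\<^sub>F x in near X p. \<rho> x = 1"
    using eq by (auto simp: \<rho>_def elim: eventually_mono)
  then have \<rho>: "\<rho> \<in> germs X p"
    by (intro germ_cong[OF p germ_const[OF p, of 1]]) (auto elim: eventually_mono)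
  have "v \<rho> = 0" "\<rho> p = 1"
    using tangent_cong[OF p v ev] tangent_const[OF p v] near_self[OF p ev] by auto
  then have "D p v (\<lambda>q. \<rho> q *\<^sub>T V q) = D p v V" "D p v (\<lambda>q. \<rho> q *\<^sub>T V' q) = D p v V'"
    using connection_scale[OF D p v V \<rho>] connection_scale[OF D p v V' \<rho>] by (auto simp: tvec_defs)
  moreover have "(\<lambda>q. \<rho> q *\<^sub>T V q) = (\<lambda>q. \<rho> q *\<^sub>T V' q)"
    by (auto simp: \<rho>_def tvec_defs)
  ultimately show ?thesis by simp
qed

subsection \<open>Coordinates\<close>

definition coord :: "('m \<Rightarrow> 'e::euclidean_space) \<Rightarrow> 'e \<Rightarrow> 'm \<Rightarrow> real" where
  "coord \<phi> b x = \<phi> x \<bullet> b"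

text \<open>The coordinate vector field in direction \<open>b\<close>, with \<open>b\<close> any
  vector of the model space. It is set to 0 outside the smooth germs, as membership in
  \<open>tangent\<close> demands.\<close>

definition coord_field :: "('m::topological_space, 'e::euclidean_space) atlas \<Rightarrow> 'm set \<Rightarrow> ('m \<Rightarrow> 'e)
    \<Rightarrow> 'e \<Rightarrow> 'm field" where
  "coord_field A U \<phi> b p f = (if f \<in> smooth_germs A p
     then frechet_derivative (\<lambda>y. f (inv_into U \<phi> y)) (at (\<phi> p)) b else 0)"

context
  fixes A :: "('m::topological_space, 'e::euclidean_space) atlas" and U :: "'m set" and \<phi> :: "'m \<Rightarrow> 'e"
  assumes A: "smooth_atlas A" and U: "(U, \<phi>) \<in> A"
begin

interpretation mfd: smooth_structure "mfd A" by (rule smooth_structure_mfd[OF A])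

lemma chart_vimage_open:
  assumes "open W" shows "open (U \<inter> \<phi> -` W)"
  using continuous_on_open_vimage[OF atlas_open[OF A U]] atlas_continuous[OF A U] assms
  by (metis Int_commute)

lemma smooth_germs_of_chart:
  assumes "p \<in> U" "open W" "\<phi> p \<in> W" "smooth_on W h"
  shows "(\<lambda>x. h (\<phi> x)) \<in> smooth_germs A p"
proof -
  let ?N = "U \<inter> \<phi> -` W"
  note N = chart_vimage_open[OF assms(2)]
  have "smooth_on (\<phi> ` ?N) h" by (rule smooth_on_subset[OF assms(4)]) auto
  then have "smooth_on (\<phi> ` ?N) (\<lambda>y. h (\<phi> (inv_into U \<phi> y)))"
    by (rule smooth_on_cong[OF chart_nhd[OF A U N], rotated])
      (auto simp: atlas_inv[OF A U])
  then show ?thesis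
    using N assms by (auto intro!: smooth_germs_chartI[OF A U N])
qed

lemma coord_germ: "p \<in> U \<Longrightarrow> coord \<phi> b \<in> smooth_germs A p"
  unfolding coord_def
  by (rule smooth_germs_of_chart[where W = UNIV and h = "\<lambda>y. y \<bullet> b"])
    (auto intro: smooth_on_bounded_linear bounded_linear_inner_left)

lemma germ_has_derivative:
  assumes "p \<in> U" "f \<in> smooth_germs A p"
  shows "((\<lambda>y. f (inv_into U \<phi> y)) has_derivative (\<lambda>b. coord_field A U \<phi> b p f)) (at (\<phi> p))"
proof -
  obtain N where N: "open N" "p \<in> N" "N \<subseteq> U" "smooth_on (\<phi> ` N) (\<lambda>y. f (inv_into U \<phi> y))"
    using assms smooth_germs_chart[OF A U] by blast
  then show ?thesis
    using smooth_on_has_derivative[OF N(4), of "\<phi> p"] assms(2) by (simp add: coord_field_def)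
qed

lemma coord_field_eqI:
  assumes "p \<in> U" "f \<in> smooth_germs A p" "((\<lambda>y. f (inv_into U \<phi> y)) has_derivative f') (at (\<phi> p))"
  shows "coord_field A U \<phi> b p f = f' b"
  using has_derivative_unique[OF germ_has_derivative[OF assms(1,2)] assms(3)] by metis

lemma coord_field_coord:
  assumes "p \<in> U" shows "coord_field A U \<phi> b p (coord \<phi> b') = b \<bullet> b'"
proof (rule coord_field_eqI[OF assms coord_germ[OF assms]])
  have "((\<lambda>y. y \<bullet> b') has_derivative (\<lambda>v. v \<bullet> b')) (at (\<phi> p))"
    by (auto intro!: derivative_eq_intros)
  then show "((\<lambda>y. coord \<phi> b' (inv_into U \<phi> y)) has_derivative (\<lambda>v. v \<bullet> b')) (at (\<phi> p))"
    by (rule has_derivative_transform_within_open[OF _ atlas_open_image[OF A U]])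
      (use assms in \<open>auto simp: coord_def atlas_inv[OF A U]\<close>)
qed

lemma coord_field_tangent:
  assumes p: "p \<in> U" shows "coord_field A U \<phi> b p \<in> tangent (mfd A) p"
proof -
  have inv: "inv_into U \<phi> (\<phi> p) = p" using atlas_inv[OF A U p] .
  have 1: "coord_field A U \<phi> b p (\<lambda>x. a * f x + c * h x) = a * coord_field A U \<phi> b p f + c * coord_field A U \<phi> b p h"
    and 2: "coord_field A U \<phi> b p (\<lambda>x. f x * h x) = f p * coord_field A U \<phi> b p h + h p * coord_field A U \<phi> b p f"
    if f: "f \<in> smooth_germs A p" and h: "h \<in> smooth_germs A p" for f h a c
  proof -
    have g: "(\<lambda>x. a * f x + c * h x) \<in> smooth_germs A p" "(\<lambda>x. f x * h x) \<in> smooth_germs A p"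
      using mfd.germ_add mfd.germ_mult mfd.germ_cmult f h by simp_all
    note d = germ_has_derivative[OF p f] germ_has_derivative[OF p h]
    show "coord_field A U \<phi> b p (\<lambda>x. a * f x + c * h x) = a * coord_field A U \<phi> b p f + c * coord_field A U \<phi> b p h"
      by (rule coord_field_eqI[OF p g(1)]) (intro has_derivative_add has_derivative_mult_right d)
    have "((\<lambda>y. f (inv_into U \<phi> y) * h (inv_into U \<phi> y)) has_derivative
        (\<lambda>b. f (inv_into U \<phi> (\<phi> p)) * coord_field A U \<phi> b p h + coord_field A U \<phi> b p f * h (inv_into U \<phi> (\<phi> p)))) (at (\<phi> p))"
      by (intro has_derivative_mult d)
    from coord_field_eqI[OF p g(2) this]
    show "coord_field A U \<phi> b p (\<lambda>x. f x * h x) = f p * coord_field A U \<phi> b p h + h p * coord_field A U \<phi> b p f"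
      by (simp add: inv mult.commute)
  qed
  show ?thesis
    using 1 2 unfolding tangent_def by (simp add: coord_field_def)
qed

lemma coord_field_germ:
  assumes "p \<in> U" "f \<in> smooth_germs A p" shows "(\<lambda>x. coord_field A U \<phi> b x f) \<in> smooth_germs A p"
proof -
  obtain N where N: "open N" "p \<in> N" "N \<subseteq> U" "smooth_on (\<phi> ` N) (\<lambda>y. f (inv_into U \<phi> y))"
    using assms smooth_germs_chart[OF A U] by blast
  have "f \<in> smooth_germs A x" if "x \<in> N" for x
    using smooth_germs_chartI[OF A U N(1,3,4) that] .
  then have "smooth_on (\<phi> ` N) (\<lambda>y. coord_field A U \<phi> b (inv_into U \<phi> y) f)"
    using N atlas_inv[OF A U]
    by (intro smooth_on_cong[OF chart_nhd[OF A U N(1,3)] smooth_on_directional[OF N(4), of b]])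
       (auto simp: coord_field_def subset_iff)
  then show ?thesis
    using N by (auto intro!: smooth_germs_chartI[OF A U N(1,3)])
qed

lemma near_chart: "p \<in> U \<Longrightarrow> \<forall>\<^sub>F x in nhds p. x \<in> U"
  using atlas_open[OF A U] by (rule eventually_nhds_in_open)

lemma coord_field_field:
  assumes "p \<in> U" shows "coord_field A U \<phi> b \<in> fields (mfd A) p"
proof -
  have "\<forall>\<^sub>F x in near (mfd A) p. x \<in> U" using near_nhds[OF near_chart[OF assms]] .
  then show ?thesis
    unfolding sections_iff by eventually_elim (auto intro: coord_field_tangent coord_field_germ)
qed

text \<open>By Hadamard's lemma \<open>f\<close> is near \<open>p\<close> a constant plus a sum of
  products of \<open>coord \<phi> b x - coord \<phi> b p\<close> with a smooth germ. The derivation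
  kills the constant, and in each product only the term survives in which it hits the coordinate;
  the other factor contributes its value at \<open>p\<close>, a partial derivative of
  \<open>f\<close>.\<close>

lemma tangent_expansion:
  assumes p: "p \<in> U" and v: "v \<in> tangent (mfd A) p" and f: "f \<in> smooth_germs A p"
  shows "v f = (\<Sum>b\<in>Basis. v (coord \<phi> b) * coord_field A U \<phi> b p f)"
proof -
  obtain N where N: "open N" "p \<in> N" "N \<subseteq> U" "smooth_on (\<phi> ` N) (\<lambda>y. f (inv_into U \<phi> y))"
    using p f smooth_germs_chart[OF A U] by blast
  obtain r where r: "r > 0" "ball (\<phi> p) r \<subseteq> \<phi> ` N"
    using chart_nhd[OF A U N(1,3)] N(2) by (meson imageI open_contains_ball)
  obtain G where G: "\<And>b. smooth_on (ball (\<phi> p) r) (G b)"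
    and eq: "\<And>y. y \<in> ball (\<phi> p) r \<Longrightarrow> f (inv_into U \<phi> y) = f (inv_into U \<phi> (\<phi> p))
        + (\<Sum>b\<in>Basis. ((y - \<phi> p) \<bullet> b) * G b y)"
    and Gp: "\<And>b. G b (\<phi> p) = frechet_derivative (\<lambda>y. f (inv_into U \<phi> y)) (at (\<phi> p)) b"
    by (rule hadamard[OF smooth_on_subset[OF N(4) r(2)]]) (rule that)
  have Gg: "(\<lambda>x. G b (\<phi> x)) \<in> smooth_germs A p" for b
    using smooth_germs_of_chart[OF p open_ball _ G] r(1) by simp
  have cg: "(\<lambda>x. coord \<phi> b x - coord \<phi> b p) \<in> smooth_germs A p" for b
    using mfd.germ_diff[OF _ _ mfd.germ_const] coord_germ[OF p] by simp
  have pg: "(\<lambda>x. (coord \<phi> b x - coord \<phi> b p) * G b (\<phi> x)) \<in> smooth_germs A p" for b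
    using mfd.germ_mult[of p, OF _ _ _] cg Gg by simp
  have ev: "\<forall>\<^sub>F x in near (mfd A) p. f x = f p + (\<Sum>b\<in>Basis. (coord \<phi> b x - coord \<phi> b p) * G b (\<phi> x))"
  proof (rule near_nhds)
    have "\<forall>\<^sub>F x in nhds p. x \<in> U \<inter> \<phi> -` ball (\<phi> p) r"
      using r(1) p by (intro eventually_nhds_in_open[OF chart_vimage_open[OF open_ball]]) simp
    then show "\<forall>\<^sub>F x in nhds p. f x = f p + (\<Sum>b\<in>Basis. (coord \<phi> b x - coord \<phi> b p) * G b (\<phi> x))"
    proof (rule eventually_mono)
      fix x assume "x \<in> U \<inter> \<phi> -` ball (\<phi> p) r"
      then show "f x = f p + (\<Sum>b\<in>Basis. (coord \<phi> b x - coord \<phi> b p) * G b (\<phi> x))"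
        using eq[of "\<phi> x"] by (simp add: atlas_inv[OF A U] p coord_def inner_diff_left)
    qed
  qed
  have "v f = v (\<lambda>x. f p + (\<Sum>b\<in>Basis. (coord \<phi> b x - coord \<phi> b p) * G b (\<phi> x)))"
    using mfd.tangent_cong[OF _ v ev] by simp
  also have "\<dots> = (\<Sum>b\<in>Basis. v (\<lambda>x. (coord \<phi> b x - coord \<phi> b p) * G b (\<phi> x)))"
  proof -
    let ?g = "\<lambda>b x. (coord \<phi> b x - coord \<phi> b p) * G b (\<phi> x)"
    have "v (\<lambda>x. f p + (\<Sum>b\<in>Basis. ?g b x)) = v (\<lambda>x. f p) + v (\<lambda>x. \<Sum>b\<in>Basis. ?g b x)"
      using mfd.germ_const[of p] mfd.germ_sum[of p Basis ?g] pg by (intro mfd.tangent_add[OF v]) simp_all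
    moreover have "v (\<lambda>x. \<Sum>b\<in>Basis. ?g b x) = (\<Sum>b\<in>Basis. v (?g b))"
      using pg by (intro mfd.tangent_sum[OF _ v]) simp_all
    ultimately show ?thesis using mfd.tangent_const[OF _ v] by simp
  qed
  also have "\<dots> = (\<Sum>b\<in>Basis. G b (\<phi> p) * v (\<lambda>x. coord \<phi> b x - coord \<phi> b p))"
    using tangent_mult[OF v] cg Gg by simp
  also have "\<dots> = (\<Sum>b\<in>Basis. v (coord \<phi> b) * coord_field A U \<phi> b p f)"
    using mfd.tangent_diff[OF v _ mfd.germ_const] coord_germ[OF p] mfd.tangent_const[OF _ v]
    by (simp add: Gp coord_field_def f mult.commute)
  finally show ?thesis .
qed

text \<open>The inclusion of \<open>S\<close> pushes \<open>v\<close> to an ambient tangent vector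
  with the same values on ambient germs, to which the ambient expansion applies.\<close>

lemma tangent_submfd_expansion:
  assumes p: "p \<in> U" "p \<in> S" and v: "v \<in> tangent (submfd A S) p" and f: "f \<in> smooth_germs A p"
  shows "v f = (\<Sum>b\<in>Basis. v (coord \<phi> b) * coord_field A U \<phi> b p f)"
proof -
  have id: "smooth_map (submfd A S) (mfd A) id"
    unfolding smooth_map_def by (auto intro: smooth_germs_restrict)
  have "push (submfd A S) (mfd A) id p v \<in> tangent (mfd A) p"
    using push_tangent[OF smooth_structure_mfd[OF A] id _ v] p by simp
  from tangent_expansion[OF p(1) this f] show ?thesis
    using f coord_germ[OF p(1)] by (simp add: push_def)
qed

text \<open>Smoothness of a field on a submanifold can be tested on ambient coordinates: locally
  \<open>v x f\<close> is the sum of the components of \<open>v\<close> times the coordinate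
  derivatives of an ambient extension of \<open>f\<close>. The criterion serves for
  \<open>d_ds\<close> and for the tangential lift of \<open>t\<close>.\<close>

lemma field_submfdI:
  assumes p: "p \<in> U" "p \<in> S" and v: "\<forall>\<^sub>F q in near (submfd A S) p. v q \<in> tangent (submfd A S) q"
    and c: "\<And>b. b \<in> Basis \<Longrightarrow> (\<lambda>q. v q (coord \<phi> b)) \<in> germs (submfd A S) p"
  shows "v \<in> fields (submfd A S) p"
proof -
  let ?X = "submfd A S"
  interpret S: smooth_structure ?X by (rule smooth_structure_submfd[OF A])
  have "\<forall>\<^sub>F q in near ?X p. \<forall>b\<in>Basis. (\<lambda>q. v q (coord \<phi> b)) \<in> germs ?X q"
    using c S.germ_near p(2) by (intro eventually_ball_finite) auto
  with near_near[OF v] v near_points[of ?X p] near_nhds[OF near_chart[OF p(1)]] show ?thesis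
    unfolding sections_iff
  proof eventually_elim
    case (elim q)
    have "(\<lambda>x. v x f) \<in> germs ?X q" if f: "f \<in> germs ?X q" for f
    proof -
      obtain F where F: "F \<in> smooth_germs A q" "\<forall>\<^sub>F x in near ?X q. f x = F x"
        using f unfolding germs_submfd by blast
      have "(\<lambda>x. \<Sum>b\<in>Basis. v x (coord \<phi> b) * coord_field A U \<phi> b x F) \<in> germs ?X q"
        using elim F(1) by (intro S.germ_sum S.germ_mult smooth_germs_restrict[OF coord_field_germ]) auto
      moreover have "\<forall>\<^sub>F x in near ?X q. (\<Sum>b\<in>Basis. v x (coord \<phi> b) * coord_field A U \<phi> b x F) = v x f"
        using near_nhds[OF near_chart[OF elim(4)]] near_points elim(1) near_near[OF F(2)]
          near_nhds[OF eventually_smooth_germs[OF A F(1)]]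
      proof eventually_elim
        case (elim x)
        then show ?case
          using tangent_submfd_expansion[OF elim(1) _ elim(3) elim(5)] S.tangent_cong[OF _ elim(3,4)] by simp
      qed
      ultimately show ?thesis
        by (rule S.germ_cong[OF elim(3)])
    qed
    then show ?case using elim by simp
  qed
qed

end

subsection \<open>Products with the real line\<close>

lemma inv_into_prod:
  assumes "smooth_atlas A" "(U, \<phi>) \<in> A" "y \<in> \<phi> ` U"
  shows "inv_into (UNIV \<times> U) (\<lambda>(s, p). (s, \<phi> p)) (s, y) = (s :: real, inv_into U \<phi> y)"
proof (rule inv_into_f_eq)
  show "inj_on (\<lambda>(s, p). (s, \<phi> p)) (UNIV \<times> U)"
    using atlas_inv[OF assms(1,2)] by (auto simp: inj_on_def) metis
qed (use assms(3) atlas_inv[OF assms(1,2)] in auto)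

lemma smooth_on_snd_compose:
  fixes h :: "'e::euclidean_space \<Rightarrow> 'c::real_normed_vector"
  assumes "open W" "smooth_on W h" shows "smooth_on (UNIV \<times> W) (\<lambda>y::real \<times> 'e. h (snd y))"
proof -
  have op: "open (UNIV \<times> W :: (real \<times> 'e) set)" using assms(1) by (intro open_Times) simp
  show ?thesis
    by (rule smooth_on_compose[OF op _ smooth_on_bounded_linear[OF op bounded_linear_snd] assms(2)]) auto
qed

text \<open>On overlaps the transition map is the identity of the line times a transition map of
  \<open>A\<close>; its smoothness is tested on inner products with basis vectors.\<close>

lemma smooth_atlas_prod:
  assumes A: "smooth_atlas A"
  shows "smooth_atlas (prod_atlas A :: (real \<times> 'm::topological_space, real \<times> 'e::euclidean_space) atlas)"
  unfolding smooth_atlas_def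
proof (intro conjI ballI; clarify?)
  show "(\<Union>(U, \<phi>)\<in>prod_atlas A. U) = (UNIV :: (real \<times> 'm) set)"
  proof (intro equalityI subsetI)
    fix z :: "real \<times> 'm"
    obtain U \<phi> where "(U, \<phi>) \<in> A" "snd z \<in> U" using atlas_cover[OF A] .
    then show "z \<in> (\<Union>(U, \<phi>)\<in>prod_atlas A. U)"
      unfolding prod_atlas_def by (auto simp: mem_Times_iff intro!: bexI[of _ "(U, \<phi>)"])
  qed simp
next
  fix U' and \<phi>' :: "real \<times> 'm \<Rightarrow> real \<times> 'e" assume "(U', \<phi>') \<in> prod_atlas A"
  then obtain U \<phi> where U: "(U, \<phi>) \<in> A" and eq: "U' = UNIV \<times> U" "\<phi>' = (\<lambda>(s, p). (s, \<phi> p))"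
    unfolding prod_atlas_def by auto
  note at = atlas_inv[OF A U] atlas_open[OF A U] atlas_open_image[OF A U]
  have im: "\<phi>' ` U' = UNIV \<times> \<phi> ` U" unfolding eq by force
  have inv: "inv_into U' \<phi>' (s, y) = (s, inv_into U \<phi> y)" if "y \<in> \<phi> ` U" for s y
    using inv_into_prod[OF A U that] by (simp add: eq)
  have "continuous_on (UNIV \<times> \<phi> ` U) (\<lambda>z. (fst z :: real, inv_into U \<phi> (snd z)))"
    by (intro continuous_intros continuous_on_compose2[OF atlas_continuous_inv[OF A U]]) auto
  then have c: "continuous_on (UNIV \<times> \<phi> ` U) (inv_into U' \<phi>')"
    by (rule continuous_on_eq) (auto simp: inv)
  have "continuous_on (UNIV \<times> U) (\<lambda>z. (fst z :: real, \<phi> (snd z)))"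
    by (intro continuous_intros continuous_on_compose2[OF atlas_continuous[OF A U]]) auto
  then have c': "continuous_on U' \<phi>'"
    unfolding eq by (rule continuous_on_eq) auto
  show "open U' \<and> open (\<phi>' ` U') \<and> homeomorphism U' (\<phi>' ` U') \<phi>' (inv_into U' \<phi>')"
    unfolding homeomorphism_def im using c c' at
    by (auto simp: eq open_Times inv[unfolded eq, OF imageI] image_iff intro!: bexI)
  fix V' and \<psi>' :: "real \<times> 'm \<Rightarrow> real \<times> 'e" assume "(V', \<psi>') \<in> prod_atlas A"
  then obtain V \<psi> where V: "(V, \<psi>) \<in> A" and eq': "V' = UNIV \<times> V" "\<psi>' = (\<lambda>(s, p). (s, \<psi> p))"
    unfolding prod_atlas_def by auto
  have im2: "\<phi>' ` (U' \<inter> V') = UNIV \<times> \<phi> ` (U \<inter> V)" unfolding eq eq' by force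
  have op: "open (\<phi> ` (U \<inter> V))" using atlas_open_image_Int[OF A U] atlas_open[OF A V] .
  note tr = smooth_on_snd_compose[OF op atlas_transition[OF A U V]]
  show "smooth_on (\<phi>' ` (U' \<inter> V')) (\<psi>' \<circ> inv_into U' \<phi>')"
    unfolding im2
  proof (rule smooth_on_cong[where f = "\<lambda>z. (fst z, \<psi> (inv_into U \<phi> (snd z)))"])
    show op2: "open (UNIV \<times> \<phi> ` (U \<inter> V) :: (real \<times> 'e) set)" by (intro open_Times op) simp
    show "smooth_on (UNIV \<times> \<phi> ` (U \<inter> V)) (\<lambda>z. (fst z :: real, \<psi> (inv_into U \<phi> (snd z))))"
    proof (rule smooth_on_componentwise[OF op2])
      fix b :: "real \<times> 'e" assume "b \<in> Basis"
      have "smooth_on (UNIV \<times> \<phi> ` (U \<inter> V)) (\<lambda>z. fst z * fst b + \<psi> (inv_into U \<phi> (snd z)) \<bullet> snd b)"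
        by (intro smooth_on_add smooth_on_mult smooth_on_inner op2 tr smooth_on_const
            smooth_on_bounded_linear[OF _ bounded_linear_fst])
      then show "smooth_on (UNIV \<times> \<phi> ` (U \<inter> V)) (\<lambda>z. (fst z, \<psi> (inv_into U \<phi> (snd z))) \<bullet> b)"
        by (simp add: inner_prod_def)
    qed
  qed (auto simp: inv eq')
qed

lemma inv_id [simp]: "inv_into UNIV (id :: 'a \<Rightarrow> 'a) = id"
  by (simp add: inv_into_def fun_eq_iff)

lemma smooth_germs_real: "k \<in> smooth_germs real_atlas s \<longleftrightarrow> (\<exists>W. open W \<and> s \<in> W \<and> smooth_on W k)"
  by (simp add: smooth_germs_def real_atlas_def)

context
  fixes A :: "('m::topological_space, 'e::euclidean_space) atlas" and U :: "'m set" and \<phi> :: "'m \<Rightarrow> 'e"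
  assumes A: "smooth_atlas A" and U: "(U, \<phi>) \<in> A"
begin

lemma prod_chart: "(UNIV \<times> U, \<lambda>(s, p). (s, \<phi> p)) \<in> prod_atlas A"
  using U unfolding prod_atlas_def by force

lemma smooth_germs_prod_chart:
  assumes "p \<in> U"
  shows "F \<in> smooth_germs (prod_atlas A) (s, p) \<longleftrightarrow>
    (\<exists>W. open W \<and> (s, \<phi> p) \<in> W \<and> W \<subseteq> UNIV \<times> \<phi> ` U \<and> smooth_on W (\<lambda>z. F (fst z, inv_into U \<phi> (snd z))))"
    (is "_ \<longleftrightarrow> ?R")
proof
  let ?\<phi> = "\<lambda>(s::real, p). (s, \<phi> p)"
  note pA = smooth_atlas_prod[OF A] and inv = inv_into_prod[OF A U]
  assume "F \<in> smooth_germs (prod_atlas A) (s, p)"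
  then obtain N where N: "open N" "(s, p) \<in> N" "N \<subseteq> UNIV \<times> U"
    and F: "smooth_on (?\<phi> ` N) (\<lambda>y. F (inv_into (UNIV \<times> U) ?\<phi> y))"
    using smooth_germs_chart[OF pA prod_chart, of "(s, p)" F] assms by auto
  have op: "open (?\<phi> ` N)" using chart_nhd[OF pA prod_chart N(1,3)] .
  have "?\<phi> ` N \<subseteq> UNIV \<times> \<phi> ` U" using N(3) by auto
  moreover from this have "smooth_on (?\<phi> ` N) (\<lambda>z. F (fst z, inv_into U \<phi> (snd z)))"
    by (intro smooth_on_cong[OF op F]) (use N(3) inv in \<open>auto simp: subset_iff\<close>)
  ultimately show ?R using op N(2) by (intro exI[of _ "?\<phi> ` N"]) force
next
  let ?\<phi> = "\<lambda>(s::real, p). (s, \<phi> p)"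
  note inv = inv_into_prod[OF A U]
  assume ?R
  then obtain W where W: "open W" "(s, \<phi> p) \<in> W" "W \<subseteq> UNIV \<times> \<phi> ` U"
    and F: "smooth_on W (\<lambda>z. F (fst z, inv_into U \<phi> (snd z)))" by blast
  have im: "?\<phi> ` (UNIV \<times> U) = UNIV \<times> \<phi> ` U" by force
  have "smooth_on W (F \<circ> inv_into (UNIV \<times> U) ?\<phi>)"
    by (rule smooth_on_cong[OF W(1) F]) (use W(3) in \<open>auto simp: subset_iff inv\<close>)
  then show "F \<in> smooth_germs (prod_atlas A) (s, p)"
    unfolding smooth_germs_def using prod_chart assms W im
    by (intro CollectI bexI[of _ "(UNIV \<times> U, ?\<phi>)"]) auto
qed

lemma smooth_germs_slice_chart:
  assumes "p \<in> U" "F \<in> smooth_germs (prod_atlas A) (s, p)"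
  shows "(\<lambda>x. F (s, x)) \<in> smooth_germs A p"
proof -
  obtain W where W: "open W" "(s, \<phi> p) \<in> W" "W \<subseteq> UNIV \<times> \<phi> ` U"
    and F: "smooth_on W (\<lambda>z. F (fst z, inv_into U \<phi> (snd z)))"
    using assms smooth_germs_prod_chart by blast
  define V where "V = (\<lambda>y. (s, y)) -` W"
  have V: "open V" "\<phi> p \<in> V" "V \<subseteq> \<phi> ` U"
    using W by (auto simp: V_def intro!: continuous_open_vimage continuous_intros)
  have "smooth_on V (\<lambda>y. (s, y))"
  proof (rule smooth_on_componentwise[OF V(1)])
    fix b :: "real \<times> 'e"
    have "smooth_on V (\<lambda>y. s * fst b + y \<bullet> snd b)"
      using V(1) by (intro smooth_on_add smooth_on_const smooth_on_bounded_linear bounded_linear_inner_left)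
    then show "smooth_on V (\<lambda>y. (s, y) \<bullet> b)" by (simp add: inner_prod_def)
  qed
  from smooth_on_compose[OF V(1) _ this F] have "smooth_on V (\<lambda>y. F (s, inv_into U \<phi> y))"
    by (auto simp: V_def)
  then show ?thesis
    unfolding smooth_germs_def using U assms(1) V by (auto simp: o_def)
qed

lemma smooth_germs_snd_chart:
  assumes "p \<in> U" "h \<in> smooth_germs A p"
  shows "(\<lambda>x. h (snd x)) \<in> smooth_germs (prod_atlas A) (s, p)"
proof -
  obtain N where N: "open N" "p \<in> N" "N \<subseteq> U" "smooth_on (\<phi> ` N) (\<lambda>y. h (inv_into U \<phi> y))"
    using assms smooth_germs_chart[OF A U] by blast
  note op = chart_nhd[OF A U N(1,3)]
  have "open (UNIV \<times> \<phi> ` N :: (real \<times> 'e) set)" using op by (intro open_Times) simp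
  then show ?thesis
    unfolding smooth_germs_prod_chart[OF assms(1)]
    using N smooth_on_snd_compose[OF op N(4)]
    by (intro exI[of _ "UNIV \<times> \<phi> ` N"]) auto
qed

lemma smooth_germs_fst_chart:
  assumes "p \<in> U" "k \<in> smooth_germs real_atlas s"
  shows "(\<lambda>x. k (fst x)) \<in> smooth_germs (prod_atlas A) (s, p)"
proof -
  obtain W where W: "open W" "s \<in> W" "smooth_on W k"
    using assms smooth_germs_real by blast
  let ?W = "W \<times> \<phi> ` U"
  have op: "open ?W" using W(1) atlas_open_image[OF A U] by (rule open_Times)
  have "smooth_on ?W (\<lambda>z. k (fst z))"
    by (rule smooth_on_compose[OF op _ smooth_on_bounded_linear[OF op bounded_linear_fst] W(3)]) auto
  then show ?thesis
    unfolding smooth_germs_prod_chart[OF assms(1)]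
    using W op assms(1) by (intro exI[of _ ?W]) auto
qed

end

lemma
  assumes A: "smooth_atlas A"
  shows smooth_germs_slice: "F \<in> smooth_germs (prod_atlas A) (s, p) \<Longrightarrow> (\<lambda>x. F (s, x)) \<in> smooth_germs A p"
    and smooth_germs_snd: "h \<in> smooth_germs A p \<Longrightarrow> (\<lambda>x. h (snd x)) \<in> smooth_germs (prod_atlas A) (s, p)"
    and smooth_germs_fst: "k \<in> smooth_germs real_atlas s \<Longrightarrow> (\<lambda>x. k (fst x)) \<in> smooth_germs (prod_atlas A) (s, p)"
proof -
  obtain U \<phi> where U: "(U, \<phi>) \<in> A" "p \<in> U" using atlas_cover[OF A] .
  show "F \<in> smooth_germs (prod_atlas A) (s, p) \<Longrightarrow> (\<lambda>x. F (s, x)) \<in> smooth_germs A p"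
    and "h \<in> smooth_germs A p \<Longrightarrow> (\<lambda>x. h (snd x)) \<in> smooth_germs (prod_atlas A) (s, p)"
    and "k \<in> smooth_germs real_atlas s \<Longrightarrow> (\<lambda>x. k (fst x)) \<in> smooth_germs (prod_atlas A) (s, p)"
    by (rule smooth_germs_slice_chart[OF A U] smooth_germs_snd_chart[OF A U] smooth_germs_fst_chart[OF A U], assumption)+
qed

lemma smooth_atlas_real: "smooth_atlas real_atlas"
  using smooth_on_bounded_linear[OF open_UNIV bounded_linear_ident, folded id_def]
  by (simp add: smooth_atlas_def real_atlas_def homeomorphism_def)

lemma coord_prod:
  "coord (\<lambda>(s::real, p). (s, \<phi> p)) (1, 0) = fst"
  "coord (\<lambda>(s::real, p). (s, \<phi> p)) (0, b) = (\<lambda>x. coord \<phi> b (snd x))"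
  by (auto simp: coord_def)

section \<open>Riemannian metrics and connections along maps\<close>

lemma section_near_tangent: "V \<in> sections X Y f p \<Longrightarrow> \<forall>\<^sub>F q in near X p. V q \<in> tangent Y (f q)"
  unfolding sections_iff by (auto elim: eventually_mono)

text \<open>Near \<open>p\<close> each section equals the sum of its coordinate components times the
  pulled-back coordinate fields, so a property stable under sums, multiples by germs and local
  equality has to be checked on these fields only.\<close>

lemma section_induct_chart:
  assumes X: "smooth_structure X" and A: "smooth_atlas A" and f: "smooth_map X (mfd A) f"
    and p: "p \<in> points X" and V: "V \<in> sections X (mfd A) f p"
    and U: "(U, \<phi>) \<in> A" "f p \<in> U"
    and base: "\<And>b. b \<in> Basis \<Longrightarrow> P (\<lambda>q. coord_field A U \<phi> b (f q))"
    and add: "\<And>V W. V \<in> sections X (mfd A) f p \<Longrightarrow> W \<in> sections X (mfd A) f p \<Longrightarrow> P V \<Longrightarrow> P W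
        \<Longrightarrow> P (\<lambda>q. V q +\<^sub>T W q)"
    and scale: "\<And>a V. a \<in> germs X p \<Longrightarrow> V \<in> sections X (mfd A) f p \<Longrightarrow> P V \<Longrightarrow> P (\<lambda>q. a q *\<^sub>T V q)"
    and cong: "\<And>V W. V \<in> sections X (mfd A) f p \<Longrightarrow> P V \<Longrightarrow> \<forall>\<^sub>F q in near X p. V q = W q \<Longrightarrow> P W"
  shows "P V"
proof -
  interpret X: smooth_structure X by fact
  let ?e = "\<lambda>b. coord_field A U \<phi> b"
  have e: "(\<lambda>q. ?e b (f q)) \<in> sections X (mfd A) f p" for b
    using section_comp[OF X smooth_structure_mfd[OF A] f p coord_field_field[OF A U]]
    by (simp add: o_def)
  have "(\<lambda>x. V x (coord \<phi> b)) \<in> germs X p" for b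
    using section_germ[OF V p] coord_germ[OF A U] by simp
  then have trm: "(\<lambda>q. V q (coord \<phi> b) *\<^sub>T ?e b (f q)) \<in> sections X (mfd A) f p"
      "b \<in> Basis \<Longrightarrow> P (\<lambda>q. V q (coord \<phi> b) *\<^sub>T ?e b (f q))" for b
    using X.section_scale[OF _ e p] scale[OF _ e base] by blast+
  let ?S = "\<lambda>T q h. \<Sum>b\<in>T. V q (coord \<phi> b) * ?e b (f q) h"
  have "?S T \<in> sections X (mfd A) f p \<and> P (?S T)" if "finite T" "T \<subseteq> Basis" for T
    using that
  proof (induction T)
    case empty
    \<comment> \<open>The closure assumptions contain no case for the zero section, so the empty sum
      is obtained as a zero multiple of some coordinate field.\<close>
    obtain b where b: "b \<in> (Basis :: 'c set)" using nonempty_Basis by blast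
    have eq: "?S {} = (\<lambda>q. 0 *\<^sub>T ?e b (f q))" by (auto simp: tscale_def)
    show ?case unfolding eq
      using X.section_scale[OF X.germ_const e p] scale[OF X.germ_const e base[OF b]] p by blast
  next
    case (insert b T)
    have eq: "?S (insert b T) = (\<lambda>q. (V q (coord \<phi> b) *\<^sub>T ?e b (f q)) +\<^sub>T ?S T q)"
      using insert by (auto simp: tadd_def tscale_def)
    show ?case unfolding eq
      using insert X.section_add[OF trm(1)] add[OF trm(1) _ trm(2)] by simp
  qed
  note S = this[OF finite_Basis order_refl]
  have "\<forall>\<^sub>F q in near X p. f q \<in> U"
    using smooth_map_near[OF X smooth_structure_mfd[OF A] f p near_nhds[OF near_chart[OF A U]]] .
  then have "\<forall>\<^sub>F q in near X p. ?S Basis q = V q"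
    using sections_near[OF V] near_points
  proof eventually_elim
    case (elim q)
    note Vq = section_tangent[OF elim(2,3)]
    show ?case
    proof
      show "?S Basis q h = V q h" for h
        using tangent_expansion[OF A U(1) elim(1) Vq, of h] tangent_zero[OF Vq, of h]
        by (cases "h \<in> smooth_germs A (f q)") (auto simp: coord_field_def)
    qed
  qed
  then show ?thesis using cong S by blast
qed

text \<open>The same principle with all pulled-back fields as generators, the form that fits
  \<open>induced_connection\<close>, which prescribes \<open>D\<close> on exactly these
  sections.\<close>

lemma section_induct [consumes 5, case_names base add scale cong]:
  assumes X: "smooth_structure X" and A: "smooth_atlas A" and f: "smooth_map X (mfd A) f"
    and p: "p \<in> points X" and V: "V \<in> sections X (mfd A) f p"
    and base: "\<And>Z. Z \<in> fields (mfd A) (f p) \<Longrightarrow> P (\<lambda>q. Z (f q))"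
    and step: "\<And>V W. V \<in> sections X (mfd A) f p \<Longrightarrow> W \<in> sections X (mfd A) f p \<Longrightarrow> P V \<Longrightarrow> P W
        \<Longrightarrow> P (\<lambda>q. V q +\<^sub>T W q)"
      "\<And>a V. a \<in> germs X p \<Longrightarrow> V \<in> sections X (mfd A) f p \<Longrightarrow> P V \<Longrightarrow> P (\<lambda>q. a q *\<^sub>T V q)"
      "\<And>V W. V \<in> sections X (mfd A) f p \<Longrightarrow> P V \<Longrightarrow> \<forall>\<^sub>F q in near X p. V q = W q \<Longrightarrow> P W"
  shows "P V"
proof -
  obtain U \<phi> where U: "(U, \<phi>) \<in> A" "f p \<in> U" using atlas_cover[OF A] .
  show ?thesis
    by (rule section_induct_chart[OF X A f p V U]) (use base[OF coord_field_field[OF A U]] step in blast)+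
qed

locale riemannian = smooth_structure +
  fixes g
  assumes metric: "riemannian_metric X g"
begin

context
  fixes p assumes p: "p \<in> points X"
begin

lemma metric_lin_left:
  "u \<in> tangent X p \<Longrightarrow> v \<in> tangent X p \<Longrightarrow> w \<in> tangent X p \<Longrightarrow>
    g p (a *\<^sub>T u +\<^sub>T b *\<^sub>T v) w = a * g p u w + b * g p v w"
  and metric_sym: "u \<in> tangent X p \<Longrightarrow> v \<in> tangent X p \<Longrightarrow> g p u v = g p v u"
  and metric_pos: "u \<in> tangent X p \<Longrightarrow> u \<noteq> tzero \<Longrightarrow> g p u u > 0"
  and metric_germ: "Z \<in> fields X p \<Longrightarrow> Z' \<in> fields X p \<Longrightarrow> (\<lambda>q. g q (Z q) (Z' q)) \<in> germs X p"
  using metric p unfolding riemannian_metric_def by blast+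

lemma metric_left:
  assumes "u \<in> tangent X p" "v \<in> tangent X p" "w \<in> tangent X p"
  shows metric_add_left: "g p (u +\<^sub>T v) w = g p u w + g p v w"
    and metric_diff_left: "g p (u -\<^sub>T v) w = g p u w - g p v w"
  using metric_lin_left[OF assms, of 1 1] metric_lin_left[OF assms, of 1 "-1"]
  by (simp_all add: tvec_defs)

lemma metric_scale_left: "u \<in> tangent X p \<Longrightarrow> w \<in> tangent X p \<Longrightarrow> g p (a *\<^sub>T u) w = a * g p u w"
  using metric_lin_left[of u u w a 0] by (simp add: tvec_defs)

lemma
  assumes "u \<in> tangent X p" "v \<in> tangent X p" "w \<in> tangent X p"
  shows metric_add_right: "g p w (u +\<^sub>T v) = g p w u + g p w v"
    and metric_diff_right: "g p w (u -\<^sub>T v) = g p w u - g p w v"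
  using metric_left[OF assms] metric_sym assms tangent_tadd tangent_tdiff by metis+

lemma metric_scale_right: "u \<in> tangent X p \<Longrightarrow> w \<in> tangent X p \<Longrightarrow> g p w (a *\<^sub>T u) = a * g p w u"
  using metric_scale_left[of u w a] metric_sym tangent_tscale by metis

lemma metric_zero: "w \<in> tangent X p \<Longrightarrow> g p tzero w = 0"
  using metric_scale_left[OF tangent_tzero, of w 0] by (simp add: tvec_defs)

lemma metric_eq_tzero: "u \<in> tangent X p \<Longrightarrow> g p u u = 0 \<Longrightarrow> u = tzero"
  using metric_pos by fastforce

lemma metric_ext:
  assumes "u \<in> tangent X p" "v \<in> tangent X p" "\<And>w. w \<in> tangent X p \<Longrightarrow> g p u w = g p v w"
  shows "u = v"
proof -
  have d: "u -\<^sub>T v \<in> tangent X p" using assms tangent_tdiff by blast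
  have "u -\<^sub>T v = tzero"
    using metric_diff_left[OF assms(1,2) d] assms(3)[OF d] by (intro metric_eq_tzero d) simp
  then show ?thesis by (auto simp: tvec_defs fun_eq_iff)
qed

end

end

lemma levi_civita_torsion:
  assumes "levi_civita X g nabla" "p \<in> points X" "Z \<in> fields X p" "Z' \<in> fields X p"
  shows "nabla p (Z p) Z' -\<^sub>T nabla p (Z' p) Z = bracket X Z Z' p"
  using assms unfolding levi_civita_def by blast

lemma levi_civita_metric:
  assumes "levi_civita X g nabla" "p \<in> points X" "Z \<in> fields X p" "Z' \<in> fields X p" "v \<in> tangent X p"
  shows "v (\<lambda>q. g q (Z q) (Z' q)) = g p (nabla p v Z) (Z' p) + g p (Z p) (nabla p v Z')"
  using assms unfolding levi_civita_def by blast

lemma levi_civita_connection: "levi_civita X g nabla \<Longrightarrow> connection_along X X id nabla"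
  by (simp add: levi_civita_def)

lemma field_tangent: "Z \<in> fields X p \<Longrightarrow> p \<in> points X \<Longrightarrow> Z p \<in> tangent X p"
  using section_tangent by fastforce

lemma levi_civita_tangent:
  "levi_civita X g nabla \<Longrightarrow> p \<in> points X \<Longrightarrow> v \<in> tangent X p \<Longrightarrow> Z \<in> fields X p \<Longrightarrow> nabla p v Z \<in> tangent X p"
  using connection_tangent[OF levi_civita_connection] by fastforce

text \<open>Torsion-freeness rewrites the three brackets, and metricity the three derivatives, as
  inner products with covariant derivatives; everything but two equal terms cancels.\<close>

lemma (in riemannian) koszul:
  assumes lc: "levi_civita X g nabla" and p: "p \<in> points X"
    and Z: "Z1 \<in> fields X p" "Z2 \<in> fields X p" "Z3 \<in> fields X p"
  shows "2 * g p (nabla p (Z1 p) Z2) (Z3 p) =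
      Z1 p (\<lambda>q. g q (Z2 q) (Z3 q)) + Z2 p (\<lambda>q. g q (Z1 q) (Z3 q)) - Z3 p (\<lambda>q. g q (Z1 q) (Z2 q))
      + g p (bracket X Z1 Z2 p) (Z3 p) - g p (bracket X Z1 Z3 p) (Z2 p) - g p (bracket X Z2 Z3 p) (Z1 p)"
proof -
  note T = field_tangent[OF Z(1) p] field_tangent[OF Z(2) p] field_tangent[OF Z(3) p]
  note N = levi_civita_tangent[OF lc p]
  note m = levi_civita_metric[OF lc p]
  note s = metric_sym[OF p]
  show ?thesis
    unfolding levi_civita_torsion[OF lc p Z(1,2), symmetric] levi_civita_torsion[OF lc p Z(1,3), symmetric]
      levi_civita_torsion[OF lc p Z(2,3), symmetric]
    using m[OF Z(2,3) T(1)] m[OF Z(1,3) T(2)] m[OF Z(1,2) T(3)]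
      s[OF T(1) N[OF T(2) Z(3)]] s[OF T(2) N[OF T(1) Z(3)]] s[OF T(1) N[OF T(3) Z(2)]]
      s[OF T(2) N[OF T(3) Z(1)]]
      s[OF T(3) N[OF T(1) Z(2)]] s[OF T(3) N[OF T(2) Z(1)]]
    by (simp add: metric_diff_left[OF p] N T Z)
qed

section \<open>Metric compatibility of pulled-back connections\<close>

locale pullback_connection = X: smooth_structure X + Y: riemannian "mfd A" g
  for X :: "'x::topological_space smooth_space" and A :: "('m::topological_space, 'e::euclidean_space) atlas" and g +
  fixes f nabla D
  assumes A: "smooth_atlas A" and f: "smooth_map X (mfd A) f"
    and lc: "levi_civita (mfd A) g nabla" and D: "induced_connection X (mfd A) f nabla D"
begin

abbreviation "Y \<equiv> mfd A"

lemma conn: "connection_along X Y f D"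
  using D by (simp add: induced_connection_def)

lemma conn_comp:
  "p \<in> points X \<Longrightarrow> v \<in> tangent X p \<Longrightarrow> Z \<in> fields Y (f p) \<Longrightarrow>
    D p v (\<lambda>q. Z (f q)) = nabla (f p) (push X Y f p v) Z"
  using D unfolding induced_connection_def o_def by blast

lemma comp_section: "p \<in> points X \<Longrightarrow> Z \<in> fields Y (f p) \<Longrightarrow> (\<lambda>q. Z (f q)) \<in> sections X Y f p"
  using section_comp[OF X.smooth_structure_axioms Y.smooth_structure_axioms f] by (simp add: o_def)

lemmas induct_section = section_induct[OF X.smooth_structure_axioms A f, consumes 2, case_names base add scale cong]

text \<open>The product rule is bundled with smoothness of the inner product: the derivative of a
  sum or product of functions splits only for germs, so the two have to pass through the induction
  together.\<close>

definition compatible where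
  "compatible p V W \<longleftrightarrow> (\<lambda>q. g (f q) (V q) (W q)) \<in> germs X p \<and>
     (\<forall>v\<in>tangent X p. v (\<lambda>q. g (f q) (V q) (W q)) = g (f p) (D p v V) (W p) + g (f p) (V p) (D p v W))"

lemma
  assumes "compatible p V W"
  shows compatible_germ: "(\<lambda>q. g (f q) (V q) (W q)) \<in> germs X p"
    and compatible_derivative: "v \<in> tangent X p \<Longrightarrow>
      v (\<lambda>q. g (f q) (V q) (W q)) = g (f p) (D p v V) (W p) + g (f p) (V p) (D p v W)"
  using assms unfolding compatible_def by blast+

lemma compatible_sym:
  assumes p: "p \<in> points X" and V: "V \<in> sections X Y f p" "W \<in> sections X Y f p" and "compatible p V W"
  shows "compatible p W V"
  unfolding compatible_def
proof (intro conjI ballI)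
  have "\<forall>\<^sub>F q in near X p. g (f q) (V q) (W q) = g (f q) (W q) (V q)"
    using section_near_tangent[OF V(1)] section_near_tangent[OF V(2)]
    by eventually_elim (auto intro!: Y.metric_sym)
  note ev = this
  show "(\<lambda>q. g (f q) (W q) (V q)) \<in> germs X p"
    using X.germ_cong[OF p compatible_germ[OF assms(4)] ev] .
  fix v assume v: "v \<in> tangent X p"
  note T = section_tangent[OF V(1) p] section_tangent[OF V(2) p] connection_tangent[OF conn p v V(1)]
    connection_tangent[OF conn p v V(2)]
  show "v (\<lambda>q. g (f q) (W q) (V q)) = g (f p) (D p v W) (V p) + g (f p) (W p) (D p v V)"
    using compatible_derivative[OF assms(4) v] X.tangent_cong[OF p v ev]
      Y.metric_sym[OF _ T(3,2)] Y.metric_sym[OF _ T(1,4)] by simp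
qed

lemma compatible_induct:
  assumes p: "p \<in> points X" and W: "W \<in> sections X Y f p" and V: "V \<in> sections X Y f p"
    and base: "\<And>Z. Z \<in> fields Y (f p) \<Longrightarrow> compatible p (\<lambda>q. Z (f q)) W"
  shows "compatible p V W"
  using p V
proof (induction V rule: induct_section)
  case (base Z)
  then show ?case by (rule assms(4))
next
  case (add V V')
  have ev: "\<forall>\<^sub>F q in near X p. g (f q) (V q) (W q) + g (f q) (V' q) (W q) = g (f q) (V q +\<^sub>T V' q) (W q)"
    using section_near_tangent[OF W] section_near_tangent[OF add(1)] section_near_tangent[OF add(2)]
    by eventually_elim (simp add: Y.metric_add_left)
  note T = section_tangent[OF W p] section_tangent[OF add(1) p] section_tangent[OF add(2) p]
  have g: "(\<lambda>q. g (f q) (V q) (W q)) \<in> germs X p" "(\<lambda>q. g (f q) (V' q) (W q)) \<in> germs X p"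
    using add by (auto simp: compatible_def)
  have "v (\<lambda>q. g (f q) (V q +\<^sub>T V' q) (W q)) =
      g (f p) (D p v (\<lambda>q. V q +\<^sub>T V' q)) (W p) + g (f p) (V p +\<^sub>T V' p) (D p v W)" if v: "v \<in> tangent X p" for v
    unfolding X.tangent_cong[OF p v ev, symmetric] connection_add[OF conn p v add(1,2)] X.tangent_add[OF v g]
    using compatible_derivative[OF add(3) v] compatible_derivative[OF add(4) v]
      connection_tangent[OF conn p v] T W add(1,2)
    by (simp add: Y.metric_add_left)
  then show ?case
    using X.germ_cong[OF p X.germ_add[OF p g] ev] by (simp add: compatible_def)
next
  case (scale a V)
  have ev: "\<forall>\<^sub>F q in near X p. a q * g (f q) (V q) (W q) = g (f q) (a q *\<^sub>T V q) (W q)"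
    using section_near_tangent[OF W] section_near_tangent[OF scale(2)]
    by eventually_elim (simp add: Y.metric_scale_left)
  note T = section_tangent[OF W p] section_tangent[OF scale(2) p]
  have g: "(\<lambda>q. g (f q) (V q) (W q)) \<in> germs X p" using scale by (auto simp: compatible_def)
  have "v (\<lambda>q. g (f q) (a q *\<^sub>T V q) (W q)) =
      g (f p) (D p v (\<lambda>q. a q *\<^sub>T V q)) (W p) + g (f p) (a p *\<^sub>T V p) (D p v W)" if v: "v \<in> tangent X p" for v
    unfolding X.tangent_cong[OF p v ev, symmetric] connection_scale[OF conn p v scale(2,1)] tangent_mult[OF v scale(1) g]
    using compatible_derivative[OF scale(3) v] connection_tangent[OF conn p v] T W scale(2)
    by (simp add: Y.metric_add_left Y.metric_scale_left Y.tangent_tscale algebra_simps)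
  then show ?case
    using X.germ_cong[OF p X.germ_mult[OF p scale(1) g] ev] by (simp add: compatible_def)
next
  case (cong V V')
  have ev: "\<forall>\<^sub>F q in near X p. g (f q) (V q) (W q) = g (f q) (V' q) (W q)"
    using cong(2) by (auto elim: eventually_mono)
  show ?case
    using cong(3) X.germ_cong[OF p _ ev] X.tangent_cong[OF p _ ev, symmetric] X.connection_cong[OF conn p _ cong(1,2)]
      near_self[OF p cong(2)] by (simp add: compatible_def)
qed

text \<open>The generation principle is used twice: in the first argument with the second fixed,
  and, after exchanging the arguments by symmetry, once more. What remains is the case of two
  pulled-back fields, where the claim is the metricity of \<open>nabla\<close> at
  \<open>f p\<close>.\<close>

lemma compatible_sections:
  assumes p: "p \<in> points X" and V: "V \<in> sections X Y f p" and W: "W \<in> sections X Y f p"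
  shows "compatible p V W"
proof (rule compatible_induct[OF p W V])
  fix Z assume Z: "Z \<in> fields Y (f p)"
  note Zf = comp_section[OF p Z]
  have "compatible p W (\<lambda>q. Z (f q))"
  proof (rule compatible_induct[OF p Zf W])
    fix Z' assume Z': "Z' \<in> fields Y (f p)"
    have "(\<lambda>q. g (f q) (Z' (f q)) (Z (f q))) \<in> germs X p"
      using smooth_map_germs[OF f p Y.metric_germ] Z Z' by simp
    moreover have "v (\<lambda>q. g (f q) (Z' (f q)) (Z (f q))) =
        push X Y f p v (\<lambda>x. g x (Z' x) (Z x))" for v
      using Y.metric_germ[OF _ Z' Z] by (simp add: push_apply)
    ultimately show "compatible p (\<lambda>q. Z' (f q)) (\<lambda>q. Z (f q))"
      unfolding compatible_def
      using levi_civita_metric[OF lc _ Z' Z push_tangent[OF Y.smooth_structure_axioms f p]] p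
      by (simp add: conn_comp Z Z')
  qed
  then show "compatible p (\<lambda>q. Z (f q)) W" by (rule compatible_sym[OF p W Zf])
qed

lemma section_metric_germ:
  "p \<in> points X \<Longrightarrow> V \<in> sections X Y f p \<Longrightarrow> W \<in> sections X Y f p \<Longrightarrow> (\<lambda>q. g (f q) (V q) (W q)) \<in> germs X p"
  using compatible_sections unfolding compatible_def by blast

lemma section_metric_derivative:
  "p \<in> points X \<Longrightarrow> V \<in> sections X Y f p \<Longrightarrow> W \<in> sections X Y f p \<Longrightarrow> v \<in> tangent X p \<Longrightarrow>
    v (\<lambda>q. g (f q) (V q) (W q)) = g (f p) (D p v V) (W p) + g (f p) (V p) (D p v W)"
  using compatible_sections unfolding compatible_def by blast

end

section \<open>The Boothby-Wang fibering\<close>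

lemma tscale_simps [simp]: "0 *\<^sub>T u = tzero" "1 *\<^sub>T u = u" "u +\<^sub>T tzero = u" "tzero +\<^sub>T u = u"
    "u -\<^sub>T tzero = u" "u -\<^sub>T u = tzero" "a *\<^sub>T tzero = tzero"
  by (simp_all add: tvec_defs)

lemma tangent_expansion2:
  fixes AB :: "('b::topological_space, real ^ 2) atlas"
  assumes AB: "smooth_atlas AB" "(U, \<psi>) \<in> AB" and p: "p \<in> U" "v \<in> tangent (mfd AB) p"
    and b: "b \<in> Basis" "b' \<in> Basis" "b \<noteq> b'"
  shows "v = v (coord \<psi> b) *\<^sub>T coord_field AB U \<psi> b p +\<^sub>T v (coord \<psi> b') *\<^sub>T coord_field AB U \<psi> b' p"
proof
  fix h
  have "card (Basis :: (real ^ 2) set) = 2" by simp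
  moreover have "card {b, b'} = 2" using b by simp
  ultimately have B: "Basis = {b, b'}"
    using b(1,2) by (intro card_subset_eq[symmetric]) auto
  show "v h = (v (coord \<psi> b) *\<^sub>T coord_field AB U \<psi> b p +\<^sub>T v (coord \<psi> b') *\<^sub>T coord_field AB U \<psi> b' p) h"
    using tangent_expansion[OF AB p, of h] tangent_zero[OF p(2), of h] b(3)
    by (cases "h \<in> smooth_germs AB p") (auto simp: tvec_defs B coord_field_def)
qed

locale boothby_wang_fibering =
  fixes A :: "('m::topological_space, 'e::euclidean_space) atlas"
    and AB :: "('b::topological_space, real ^ 2) atlas"
    and \<eta> \<xi> \<phi> g nabla \<Phi> \<pi> gB J nablaB
  assumes A: "smooth_atlas A" and AB: "smooth_atlas AB"
    and sasaki: "sasaki_3 (mfd A) \<eta> \<xi> \<phi> g nabla"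
    and flow: "regular_flow A \<xi> g \<Phi>"
    and fibering: "boothby_wang (mfd A) \<xi> \<phi> g \<Phi> (mfd AB) gB J \<pi>"
    and lcB: "levi_civita (mfd AB) gB nablaB"
begin

abbreviation "M \<equiv> mfd A"
abbreviation "B \<equiv> mfd AB"

lemma contact: "contact_riemannian_3 M \<eta> \<xi> \<phi> g"
  and lc: "levi_civita M g nabla"
  and nabla_phi: "v \<in> tangent M p \<Longrightarrow> Z \<in> fields M p \<Longrightarrow>
    nabla p v (\<lambda>q. \<phi> q (Z q)) -\<^sub>T \<phi> p (nabla p v Z) = g p v (Z p) *\<^sub>T \<xi> p -\<^sub>T \<eta> p (Z p) *\<^sub>T v"
  using sasaki unfolding sasaki_3_def by auto

sublocale M: riemannian M g
  using contact smooth_structure_mfd[OF A] unfolding contact_riemannian_3_def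
  by (auto intro!: riemannian.intro riemannian_axioms.intro)

sublocale B: riemannian B gB
  using fibering smooth_structure_mfd[OF AB] unfolding boothby_wang_def
  by (auto intro!: riemannian.intro riemannian_axioms.intro)

lemma one_form: "one_form M \<eta>" and endo: "endo_field M \<phi>"
  and xi_field: "\<xi> \<in> fields M p" and eta_xi [simp]: "\<eta> p (\<xi> p) = 1"
  and d_eta_xi: "Z \<in> fields M p \<Longrightarrow> ext_deriv M \<eta> \<xi> Z p = 0"
  and phi_phi: "u \<in> tangent M p \<Longrightarrow> \<phi> p (\<phi> p u) = \<eta> p u *\<^sub>T \<xi> p -\<^sub>T u"
  and metric_xi: "u \<in> tangent M p \<Longrightarrow> g p (\<xi> p) u = \<eta> p u"
  and metric_phi: "u \<in> tangent M p \<Longrightarrow> v \<in> tangent M p \<Longrightarrow> g p (\<phi> p u) (\<phi> p v) = g p u v - \<eta> p u * \<eta> p v"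
  using contact unfolding contact_riemannian_3_def contact_form_3_def points_mfd by blast+

lemma xi_tangent [simp]: "\<xi> p \<in> tangent M p"
  using field_tangent[OF xi_field] by simp

lemma metric_xi_right: "u \<in> tangent M p \<Longrightarrow> g p u (\<xi> p) = \<eta> p u"
  using metric_xi[of u p] M.metric_sym[of p u "\<xi> p"] by simp

lemma
  assumes "u \<in> tangent M p" "v \<in> tangent M p"
  shows eta_add: "\<eta> p (u +\<^sub>T v) = \<eta> p u + \<eta> p v"
    and eta_diff: "\<eta> p (u -\<^sub>T v) = \<eta> p u - \<eta> p v"
proof -
  have *: "\<eta> p (a *\<^sub>T u +\<^sub>T b *\<^sub>T v) = a * \<eta> p u + b * \<eta> p v" for a b
    using one_form assms unfolding one_form_def by simp
  show "\<eta> p (u +\<^sub>T v) = \<eta> p u + \<eta> p v" "\<eta> p (u -\<^sub>T v) = \<eta> p u - \<eta> p v"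
    using *[of 1 1] *[of 1 "-1"] by (simp_all add: tvec_defs)
qed

lemma eta_scale:
  assumes "u \<in> tangent M p" shows "\<eta> p (a *\<^sub>T u) = a * \<eta> p u"
proof -
  have "\<eta> p (a *\<^sub>T u +\<^sub>T 0 *\<^sub>T u) = a * \<eta> p u + 0 * \<eta> p u"
    using one_form assms unfolding one_form_def points_mfd by blast
  then show ?thesis by (simp add: tvec_defs)
qed

lemma eta_germ: "Z \<in> fields M p \<Longrightarrow> (\<lambda>q. \<eta> q (Z q)) \<in> smooth_germs A p"
  using one_form unfolding one_form_def by simp

lemma phi_tangent [simp]: "u \<in> tangent M p \<Longrightarrow> \<phi> p u \<in> tangent M p"
  using endo unfolding endo_field_def by simp

lemma phi_field: "Z \<in> fields M p \<Longrightarrow> (\<lambda>q. \<phi> q (Z q)) \<in> fields M p"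
  using endo unfolding endo_field_def by simp

lemma
  assumes "u \<in> tangent M p" "v \<in> tangent M p"
  shows phi_add: "\<phi> p (u +\<^sub>T v) = \<phi> p u +\<^sub>T \<phi> p v"
    and phi_diff: "\<phi> p (u -\<^sub>T v) = \<phi> p u -\<^sub>T \<phi> p v"
proof -
  have *: "\<phi> p (a *\<^sub>T u +\<^sub>T b *\<^sub>T v) = a *\<^sub>T \<phi> p u +\<^sub>T b *\<^sub>T \<phi> p v" for a b
    using endo assms unfolding endo_field_def by simp
  show "\<phi> p (u +\<^sub>T v) = \<phi> p u +\<^sub>T \<phi> p v" "\<phi> p (u -\<^sub>T v) = \<phi> p u -\<^sub>T \<phi> p v"
    using *[of 1 1] *[of 1 "-1"] by (simp_all add: tvec_defs)
qed

lemma phi_scale: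
  assumes "u \<in> tangent M p" shows "\<phi> p (a *\<^sub>T u) = a *\<^sub>T \<phi> p u"
proof -
  have "\<phi> p (a *\<^sub>T u +\<^sub>T 0 *\<^sub>T u) = a *\<^sub>T \<phi> p u +\<^sub>T 0 *\<^sub>T \<phi> p u"
    using endo assms unfolding endo_field_def points_mfd by blast
  then show ?thesis by (simp add: tvec_defs)
qed

lemma M_comb [simp]:
  assumes "u \<in> tangent M p" "v \<in> tangent M p"
  shows "u +\<^sub>T v \<in> tangent M p" "u -\<^sub>T v \<in> tangent M p"
  using M.tangent_comb[of u p v] assms by auto

lemma M_scale [simp]: "u \<in> tangent M p \<Longrightarrow> a *\<^sub>T u \<in> tangent M p"
  using M.tangent_comb[of u p u] by auto

text \<open>\<open>\<phi> \<xi>\<close> has squared length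
  \<open>g(\<xi>, \<xi>) - \<eta>(\<xi>)^2 = 0\<close>.\<close>

lemma phi_xi [simp]: "\<phi> p (\<xi> p) = tzero"
  using metric_phi[of "\<xi> p" p "\<xi> p"] metric_xi[of "\<xi> p" p] by (intro M.metric_eq_tzero[of p]) simp_all

text \<open>Computing the cube of \<phi> on \<open>u\<close> in two ways, as \<phi> of
  \<open>\<phi> (\<phi> u)\<close> and as the square of \<phi> applied to \<open>\<phi> u\<close>,
  leaves \<open>\<eta> (\<phi> u) \<xi> = 0\<close>, since \<phi> annihilates \<xi>.\<close>

lemma eta_phi [simp]:
  assumes u: "u \<in> tangent M p" shows "\<eta> p (\<phi> p u) = 0"
proof -
  have "\<phi> p (\<eta> p u *\<^sub>T \<xi> p -\<^sub>T u) = \<eta> p (\<phi> p u) *\<^sub>T \<xi> p -\<^sub>T \<phi> p u"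
    using phi_phi[OF phi_tangent[OF u]] by (simp add: phi_phi[OF u])
  moreover have "\<phi> p (\<eta> p u *\<^sub>T \<xi> p -\<^sub>T u) = tzero -\<^sub>T \<phi> p u"
    using u by (simp add: phi_diff phi_scale)
  ultimately have "\<eta> p (\<phi> p u) *\<^sub>T \<xi> p = tzero"
    by (auto simp: tvec_defs fun_eq_iff)
  then have "\<eta> p (\<eta> p (\<phi> p u) *\<^sub>T \<xi> p) = \<eta> p (0 *\<^sub>T \<xi> p)" by simp
  then show ?thesis by (simp add: eta_scale del: tscale_simps)
qed

text \<open>Compatibility of \<phi> with the metric, applied to \<open>u\<close> and
  \<open>\<phi> v\<close>; the terms with \<eta> vanish because the image of \<phi> is orthogonal to
  \<xi>.\<close>

lemma metric_phi_skew:
  assumes u: "u \<in> tangent M p" and v: "v \<in> tangent M p"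
  shows "g p (\<phi> p u) v = - g p u (\<phi> p v)"
proof -
  have "g p u (\<phi> p v) = g p (\<phi> p u) (\<phi> p (\<phi> p v))"
    using metric_phi[OF u phi_tangent[OF v]] v by simp
  also have "\<dots> = - g p (\<phi> p u) v"
    using u v by (simp add: phi_phi M.metric_diff_right M.metric_scale_right metric_xi_right)
  finally show ?thesis by simp
qed

lemma metric_phi_self: "u \<in> tangent M p \<Longrightarrow> g p u (\<phi> p u) = 0"
  using metric_phi_skew[of u p u] M.metric_sym[of p u "\<phi> p u"] by simp

lemma nabla_tangent [simp]: "v \<in> tangent M p \<Longrightarrow> Z \<in> fields M p \<Longrightarrow> nabla p v Z \<in> tangent M p"
  using levi_civita_tangent[OF lc] by simp

text \<open>With \<open>Z = \<xi>\<close> the Sasaki identity determines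
  \<open>\<phi> (nabla p v \<xi>)\<close>, because \<open>\<phi> \<xi>\<close> vanishes identically.
  A further application of \<phi> recovers \<open>nabla p v \<xi>\<close> itself, which is
  orthogonal to \<xi> since \<xi> has unit length.\<close>

lemma nabla_xi:
  assumes v: "v \<in> tangent M p"
  shows "nabla p v \<xi> = -1 *\<^sub>T \<phi> p v"
proof -
  let ?w = "nabla p v \<xi>"
  have w: "?w \<in> tangent M p" using v xi_field by simp
  have "v (\<lambda>q. g q (\<xi> q) (\<xi> q)) = 2 * g p ?w (\<xi> p)"
    using levi_civita_metric[OF lc _ xi_field xi_field v] M.metric_sym[of p ?w "\<xi> p"] w by simp
  moreover have "(\<lambda>q. g q (\<xi> q) (\<xi> q)) = (\<lambda>q. 1)" by (simp add: metric_xi)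
  ultimately have "\<eta> p ?w = 0"
    using M.tangent_const[OF _ v, of 1] metric_xi_right[OF w] by simp
  then have ww: "\<phi> p (\<phi> p ?w) = -1 *\<^sub>T ?w" using phi_phi[OF w] by (auto simp: tvec_defs)
  \<comment> \<open>The covariant derivative of the zero field, obtained from the Leibniz rule with
    coefficient 0.\<close>
  have "nabla p v (\<lambda>q. 0 *\<^sub>T \<xi> q) = v (\<lambda>q. 0) *\<^sub>T \<xi> p +\<^sub>T 0 *\<^sub>T nabla p v \<xi>"
    using connection_scale[OF levi_civita_connection[OF lc] _ v xi_field, of "\<lambda>q. 0"] M.germ_const[of p 0] by simp
  then have "nabla p v (\<lambda>q. tzero) = tzero" using M.tangent_const[OF _ v, of 0] by simp
  then have "tzero -\<^sub>T \<phi> p ?w = \<eta> p v *\<^sub>T \<xi> p -\<^sub>T v"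
    using nabla_phi[OF v xi_field] metric_xi_right[OF v] by simp
  then have "\<phi> p ?w = v -\<^sub>T \<eta> p v *\<^sub>T \<xi> p"
    by (auto simp: tvec_defs fun_eq_iff) (metis add_diff_cancel_left' diff_add_cancel minus_diff_eq)
  then have "\<phi> p (\<phi> p ?w) = \<phi> p v"
    using v by (simp add: phi_diff phi_scale)
  with ww show ?thesis by (auto simp: tvec_defs fun_eq_iff)
qed

subsection \<open>Horizontal lifts\<close>

lemma pi_smooth: "smooth_map M B \<pi>" and pi_surj: "range \<pi> = UNIV"
  and pi_fibre: "\<pi> p = \<pi> q \<longleftrightarrow> (\<exists>s. q = \<Phi> s p)"
  and pi_submersion: "push M B \<pi> p ` tangent M p = tangent B (\<pi> p)"
  and pi_isometry: "u \<in> tangent M p \<Longrightarrow> v \<in> tangent M p \<Longrightarrow> \<eta> p u = 0 \<Longrightarrow> \<eta> p v = 0 \<Longrightarrow>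
    gB (\<pi> p) (push M B \<pi> p u) (push M B \<pi> p v) = g p u v"
  using fibering unfolding boothby_wang_def by (simp_all add: metric_xi_right)

lemma pi_germ: "h \<in> smooth_germs AB (\<pi> p) \<Longrightarrow> (\<lambda>x. h (\<pi> x)) \<in> smooth_germs A p"
  using smooth_map_germs[OF pi_smooth, of p h] by simp

lemma push_pi_tangent [simp]: "u \<in> tangent M p \<Longrightarrow> push M B \<pi> p u \<in> tangent B (\<pi> p)"
  using pi_submersion by blast

lemma flow_0 [simp]: "\<Phi> 0 p = p"
  using flow unfolding regular_flow_def by simp

lemma flow_derivative:
  "f \<in> smooth_germs A p \<Longrightarrow> ((\<lambda>t. f (\<Phi> t p)) has_real_derivative \<xi> p f) (at 0)"
  using flow unfolding regular_flow_def by (metis flow_0 germs_mfd)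

lemma push_xi [simp]: "push M B \<pi> p (\<xi> p) = tzero"
proof -
  have "\<xi> p (\<lambda>x. h (\<pi> x)) = 0" if "h \<in> smooth_germs AB (\<pi> p)" for h
  proof -
    have "(\<lambda>t. h (\<pi> (\<Phi> t p))) = (\<lambda>t. h (\<pi> p))" using pi_fibre by metis
    then show ?thesis
      using flow_derivative[OF pi_germ[OF that]] DERIV_unique[OF _ DERIV_const] by metis
  qed
  then show ?thesis by (auto simp: push_def o_def tzero_def)
qed

definition lift where "lift p v = horizontal_lift M B \<xi> g \<pi> p v"

text \<open>The projection is injective on horizontal vectors because it preserves their
  length.\<close>

lemma vertical_zero:
  assumes "u \<in> tangent M p" "\<eta> p u = 0" "push M B \<pi> p u = tzero" shows "u = tzero"
proof (rule M.metric_eq_tzero[of p])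
  show "g p u u = 0"
    using pi_isometry[OF assms(1,1,2,2)] assms(3) B.metric_zero[of "\<pi> p" tzero] by (simp add: tangent_tzero)
qed (use assms in simp_all)

lemma lift_eqI:
  assumes u: "u \<in> tangent M p" "\<eta> p u = 0" and v: "push M B \<pi> p u = v"
  shows "lift p v = u"
  unfolding lift_def horizontal_lift_def
proof (rule the_equality)
  fix w assume w: "w \<in> tangent M p \<and> g p w (\<xi> p) = 0 \<and> push M B \<pi> p w = v"
  moreover from this have "\<eta> p w = 0" using metric_xi_right[of w p] by simp
  ultimately have "w -\<^sub>T u = tzero"
    using u v by (intro vertical_zero[of _ p]) (simp_all add: eta_diff push_tdiff)
  then show "w = u" by (auto simp: tvec_defs fun_eq_iff)
qed (use assms in \<open>simp add: metric_xi_right\<close>)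

lemma lift_push:
  assumes "u \<in> tangent M p" shows "lift p (push M B \<pi> p u) = u -\<^sub>T \<eta> p u *\<^sub>T \<xi> p"
  using assms by (intro lift_eqI) (simp_all add: eta_diff eta_scale push_tdiff push_tscale)

lemma
  assumes "v \<in> tangent B (\<pi> p)"
  shows lift_tangent [simp]: "lift p v \<in> tangent M p"
    and eta_lift [simp]: "\<eta> p (lift p v) = 0"
    and push_lift [simp]: "push M B \<pi> p (lift p v) = v"
proof -
  obtain u where u: "u \<in> tangent M p" "v = push M B \<pi> p u"
    using pi_submersion[of p] assms by (metis imageE)
  then show "lift p v \<in> tangent M p" "\<eta> p (lift p v) = 0" "push M B \<pi> p (lift p v) = v"
    by (simp_all add: lift_push eta_diff eta_scale push_tdiff push_tscale)
qed

lemma B_comb [simp]: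
  assumes "u \<in> tangent B b" "v \<in> tangent B b"
  shows "u +\<^sub>T v \<in> tangent B b" "u -\<^sub>T v \<in> tangent B b"
  using B.tangent_comb[of u b v] assms by auto

lemma B_scale [simp]: "u \<in> tangent B b \<Longrightarrow> a *\<^sub>T u \<in> tangent B b"
  using B.tangent_comb[of u b u] by auto

lemma lift_add: "u \<in> tangent B (\<pi> p) \<Longrightarrow> v \<in> tangent B (\<pi> p) \<Longrightarrow> lift p (u +\<^sub>T v) = lift p u +\<^sub>T lift p v"
  by (intro lift_eqI) (simp_all add: eta_add push_tadd)

lemma lift_scale: "u \<in> tangent B (\<pi> p) \<Longrightarrow> lift p (a *\<^sub>T u) = a *\<^sub>T lift p u"
  by (intro lift_eqI) (simp_all add: eta_scale push_tscale)

lemma metric_lift: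
  "u \<in> tangent B (\<pi> p) \<Longrightarrow> v \<in> tangent B (\<pi> p) \<Longrightarrow> g p (lift p u) (lift p v) = gB (\<pi> p) u v"
  using pi_isometry[of "lift p u" p "lift p v"] by simp

text \<open>The vertical part of \<open>u\<close> is orthogonal to the lift, so only the horizontal
  part counts, and this is the lift of the projection of \<open>u\<close>.\<close>

lemma metric_lift_push:
  assumes u: "u \<in> tangent M p" and v: "v \<in> tangent B (\<pi> p)"
  shows "g p u (lift p v) = gB (\<pi> p) (push M B \<pi> p u) v"
proof -
  have "gB (\<pi> p) (push M B \<pi> p u) v = g p (u -\<^sub>T \<eta> p u *\<^sub>T \<xi> p) (lift p v)"
    using metric_lift[of "push M B \<pi> p u" p v] u v by (simp add: lift_push)
  also have "\<dots> = g p u (lift p v)"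
    using u v by (simp add: M.metric_diff_left M.metric_scale_left metric_xi)
  finally show ?thesis by simp
qed

lemma lift_J:
  assumes "v \<in> tangent B (\<pi> p)" shows "lift p (J (\<pi> p) v) = \<phi> p (lift p v)"
proof (rule lift_eqI)
  show "push M B \<pi> p (\<phi> p (lift p v)) = J (\<pi> p) v"
    using fibering assms unfolding boothby_wang_def lift_def by simp
qed (use assms in simp_all)

lemma J_tangent [simp]: "v \<in> tangent B b \<Longrightarrow> J b v \<in> tangent B b"
proof -
  assume v: "v \<in> tangent B b"
  obtain p where p: "b = \<pi> p" using pi_surj by blast
  have "J (\<pi> p) v = push M B \<pi> p (\<phi> p (lift p v))"
    using fibering v p unfolding boothby_wang_def lift_def by simp
  then show ?thesis using v p by simp
qed

lemma
  assumes "v \<in> tangent B b"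
  shows metric_J_self: "gB b v (J b v) = 0" and metric_J_J: "gB b (J b v) (J b v) = gB b v v"
proof -
  obtain p where p: "b = \<pi> p" using pi_surj by blast
  note v = assms[unfolded p]
  show "gB b v (J b v) = 0" "gB b (J b v) (J b v) = gB b v v"
    unfolding p using metric_lift[OF v J_tangent[OF v]] metric_lift[OF J_tangent[OF v] J_tangent[OF v]]
      metric_lift[OF v v] lift_tangent[OF v]
    by (simp_all add: lift_J[OF v] metric_phi_self metric_phi v)
qed

text \<open>A third vector orthogonal to an orthonormal pair vanishes because the vectors of the
  two-dimensional tangent space satisfy \<open>(b \<times> c) a + (c \<times> a) b + (a \<times> b) c = 0\<close>.\<close>
lemma orthogonal_frame:
  assumes v: "v \<in> tangent B b" "gB b v v = 1" and w: "w \<in> tangent B b"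
  shows "w = gB b w v *\<^sub>T v +\<^sub>T gB b w (J b v) *\<^sub>T J b v"
proof -
  obtain U \<psi> where U: "(U, \<psi>) \<in> AB" "b \<in> U" using atlas_cover[OF AB] .
  define x where "x u = u (coord \<psi> (axis 1 1))" for u :: "'b tvec"
  define y where "y u = u (coord \<psi> (axis 2 1))" for u :: "'b tvec"
  let ?c = "\<lambda>u w. x u * y w - y u * x w"
  have zero: "u = tzero" if "u \<in> tangent B b" "x u = 0" "y u = 0" for u
    using tangent_expansion2[OF AB U that(1), of "axis 1 1" "axis 2 1"] that(2,3)
    by (simp add: x_def y_def axis_eq_axis axis_in_Basis_iff)
  define j where "j = J b v"
  have j: "j \<in> tangent B b" "gB b v j = 0" "gB b j v = 0" "gB b j j = 1"
    using v metric_J_self[OF v(1)] metric_J_J[OF v(1)] B.metric_sym[of b v "J b v"] by (simp_all add: j_def)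
  define u where "u = w -\<^sub>T (gB b w v *\<^sub>T v +\<^sub>T gB b w j *\<^sub>T j)"
  have u: "u \<in> tangent B b" "gB b u v = 0" "gB b u j = 0" "gB b v u = 0" "gB b j u = 0"
  proof -
    show t: "u \<in> tangent B b" using v w j by (simp add: u_def)
    show "gB b u v = 0" "gB b u j = 0"
      using v w j by (simp_all add: u_def B.metric_diff_left B.metric_add_left B.metric_scale_left)
    then show "gB b v u = 0" "gB b j u = 0"
      using B.metric_sym[of b] v j t by auto
  qed
  have xy: "x (r *\<^sub>T p) = r * x p" "y (r *\<^sub>T p) = r * y p" "x (p +\<^sub>T q) = x p + x q" "y (p +\<^sub>T q) = y p + y q" for r p q
    by (simp_all add: x_def y_def tvec_defs)
  let ?z = "?c j u *\<^sub>T v +\<^sub>T ?c u v *\<^sub>T j +\<^sub>T ?c v j *\<^sub>T u"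
  have z: "?z = tzero"
    using v j u by (intro zero) (simp_all add: xy algebra_simps)
  have "gB b ?z u = ?c v j * gB b u u"
    using v j u by (simp add: B.metric_add_left B.metric_scale_left)
  then have 1: "?c v j * gB b u u = 0"
    using z B.metric_zero[of b u] u by simp
  have "?c v j \<noteq> 0"
  proof
    assume c: "?c v j = 0"
    \<comment> \<open>With a vanishing determinant both combinations have zero coordinates; their
      inner products with \<open>j\<close> then give \<open>x v = y v = 0\<close>, against the unit
      length of \<open>v\<close>.\<close>
    have "x v *\<^sub>T j +\<^sub>T (- x j) *\<^sub>T v = tzero" "y v *\<^sub>T j +\<^sub>T (- y j) *\<^sub>T v = tzero"
      using v j c by (intro zero; simp add: xy algebra_simps)+
    then have "gB b (x v *\<^sub>T j +\<^sub>T (- x j) *\<^sub>T v) j = 0" "gB b (y v *\<^sub>T j +\<^sub>T (- y j) *\<^sub>T v) j = 0"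
      using B.metric_zero[of b j] j by simp_all
    then have "x v = 0" "y v = 0"
      using v j by (simp_all add: B.metric_add_left B.metric_scale_left)
    then show False using zero[OF v(1)] v(2) B.metric_zero[of b v] v(1) by simp
  qed
  with 1 have "u = tzero" using B.metric_eq_tzero[of b u] u by simp
  then show ?thesis by (auto simp: u_def j_def tvec_defs fun_eq_iff)
qed

end

section \<open>Local extension of vectors and smoothness of horizontal lifts\<close>

lemma (in smooth_structure) tangent_lincomb:
  "p \<in> points X \<Longrightarrow> (\<And>i. i \<in> I \<Longrightarrow> v i \<in> tangent X p) \<Longrightarrow> (\<lambda>h. \<Sum>i\<in>I. c i * v i h) \<in> tangent X p"
proof (induction I rule: infinite_finite_induct)
  case (insert i I)
  then have "c i *\<^sub>T v i +\<^sub>T (\<lambda>h. \<Sum>i\<in>I. c i * v i h) \<in> tangent X p"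
    using tangent_tadd tangent_tscale by (metis insert_iff)
  with insert show ?case by (simp add: tvec_defs)
qed (use tangent_tzero in \<open>auto simp: tzero_def\<close>)

text \<open>The field is a combination of coordinate fields with constant coefficients. Brackets and
  the Koszul formula take fields, while the vectors at hand are given at one point.\<close>

lemma extend_tangent_vector:
  assumes A: "smooth_atlas A" and u: "u \<in> tangent (mfd A) p"
  obtains Z where "Z \<in> fields (mfd A) p" "Z p = u"
proof -
  interpret M: smooth_structure "mfd A" by (rule smooth_structure_mfd[OF A])
  obtain U \<phi> where U: "(U, \<phi>) \<in> A" "p \<in> U" using atlas_cover[OF A] .
  define Z where "Z x h = (\<Sum>b\<in>Basis. u (coord \<phi> b) * coord_field A U \<phi> b x h)" for x h
  have "\<forall>\<^sub>F x in near (mfd A) p. x \<in> U" using near_nhds[OF near_chart[OF A U]] .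
  then have "Z \<in> fields (mfd A) p"
    unfolding sections_iff
  proof eventually_elim
    case (elim x)
    have "Z x \<in> tangent (mfd A) x"
      unfolding Z_def[abs_def] using coord_field_tangent[OF A U(1) elim] by (intro M.tangent_lincomb) auto
    moreover have "(\<lambda>x. Z x h) \<in> germs (mfd A) x" if "h \<in> smooth_germs A x" for h
      unfolding Z_def using coord_field_germ[OF A U(1) elim that] by (intro M.germ_sum M.germ_cmult) auto
    ultimately show ?case by simp
  qed
  moreover have "Z p = u"
  proof
    show "Z p h = u h" for h
      using tangent_expansion[OF A U u, of h] tangent_zero[OF u, of h]
      by (cases "h \<in> smooth_germs A p") (auto simp: Z_def coord_field_def)
  qed
  ultimately show ?thesis by (rule that)
qed

context boothby_wang_fibering
begin

text \<open>The horizontal part \<open>Z - \<eta>(Z) \<xi>\<close> is smooth, and by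
  \<open>lift_push\<close> it is the lift of the projection.\<close>

lemma lift_push_field:
  assumes Z: "Z \<in> fields M p"
  shows "(\<lambda>x. lift x (push M B \<pi> x (Z x))) \<in> fields M p"
proof -
  have "(\<lambda>x. (- 1 * \<eta> x (Z x)) *\<^sub>T \<xi> x) \<in> fields M p"
    by (intro M.section_scale M.germ_cmult xi_field) (simp_all add: eta_germ Z)
  from M.section_add[OF Z this]
  show ?thesis
  proof (rule M.section_cong)
    show "\<forall>\<^sub>F x in near M p. Z x +\<^sub>T (- 1 * \<eta> x (Z x)) *\<^sub>T \<xi> x = lift x (push M B \<pi> x (Z x))"
      using section_near_tangent[OF Z]
      by eventually_elim (simp add: lift_push, auto simp: tvec_defs)
  qed
qed

lemma push_near:
  assumes Z: "Z \<in> fields M p" and h: "h \<in> smooth_germs AB (\<pi> p)"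
  shows "\<forall>\<^sub>F x in near M p. h \<in> smooth_germs AB (\<pi> x)"
    and "(\<lambda>x. Z x (\<lambda>q. h (\<pi> q))) \<in> smooth_germs A p"
proof -
  have "\<forall>\<^sub>F b in near B (\<pi> p). h \<in> smooth_germs AB b"
    using near_nhds[OF eventually_smooth_germs[OF AB h]] .
  from smooth_map_near[OF M.smooth_structure_axioms B.smooth_structure_axioms pi_smooth _ this]
  show "\<forall>\<^sub>F x in near M p. h \<in> smooth_germs AB (\<pi> x)" by simp
  show "(\<lambda>x. Z x (\<lambda>q. h (\<pi> q))) \<in> smooth_germs A p"
    using section_germ[OF Z, of "\<lambda>q. h (\<pi> q)"] pi_germ[OF h] by simp
qed

text \<open>A coordinate field of the base is \<open>\<pi>\<close>-related to a combination of two local fields whose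
  coefficients are obtained by inverting a 2 by 2 matrix of germs.\<close>
lemma lift_coord_field:
  assumes U: "(U, \<psi>) \<in> AB" "\<pi> p \<in> U" and b: "b \<in> Basis"
  shows "(\<lambda>x. lift x (coord_field AB U \<psi> b (\<pi> x))) \<in> fields M p"
proof -
  have "card (Basis - {b}) = 1" using b by simp
  then obtain b' where "Basis - {b} = {b'}" by (rule card_1_singletonE)
  then have b': "b' \<in> Basis" "b' \<noteq> b" by auto
  let ?e = "coord_field AB U \<psi> b" and ?e' = "coord_field AB U \<psi> b'"
  have "?e (\<pi> p) \<in> tangent B (\<pi> p)" "?e' (\<pi> p) \<in> tangent B (\<pi> p)"
    using coord_field_tangent[OF AB U] by blast+
  then obtain u u' where u: "u \<in> tangent M p" "push M B \<pi> p u = ?e (\<pi> p)"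
      "u' \<in> tangent M p" "push M B \<pi> p u' = ?e' (\<pi> p)"
    using push_lift lift_tangent by metis
  obtain Z where Z: "Z \<in> fields M p" "Z p = u" using extend_tangent_vector[OF A u(1)] .
  obtain Z' where Z': "Z' \<in> fields M p" "Z' p = u'" using extend_tangent_vector[OF A u(3)] .
  let ?y = "\<lambda>x. coord \<psi> b (\<pi> x)" and ?y' = "\<lambda>x. coord \<psi> b' (\<pi> x)"
  have y: "coord \<psi> c \<in> smooth_germs AB (\<pi> p)" for c using coord_germ[OF AB U] .
  define d where "d x = Z x ?y * Z' x ?y' - Z x ?y' * Z' x ?y" for x
  have g: "(\<lambda>x. Z x ?y) \<in> germs M p" "(\<lambda>x. Z x ?y') \<in> germs M p" "(\<lambda>x. Z' x ?y) \<in> germs M p" "(\<lambda>x. Z' x ?y') \<in> germs M p"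
    using push_near(2)[OF Z(1) y] push_near(2)[OF Z'(1) y] by simp_all
  have dg: "d \<in> germs M p"
    unfolding d_def[abs_def] using g by (intro M.germ_diff M.germ_mult) auto
  \<comment> \<open>At \<open>p\<close> the coefficient matrix is the identity, so its determinant
    \<open>d\<close> stays nonzero nearby.\<close>
  have "u ?y = 1" "u ?y' = 0" "u' ?y = 0" "u' ?y' = 1"
    using fun_cong[OF u(2), of "coord \<psi> b"] fun_cong[OF u(2), of "coord \<psi> b'"]
      fun_cong[OF u(4), of "coord \<psi> b"] fun_cong[OF u(4), of "coord \<psi> b'"] b b' y
    by (auto simp: push_apply coord_field_coord[OF AB U] inner_Basis)
  then have d1: "d p = 1" by (simp add: d_def Z Z')
  have di: "(\<lambda>x. inverse (d x)) \<in> germs M p" using M.germ_inverse[OF _ dg] d1 by simp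
  \<comment> \<open>Cramer's rule: the combination of \<open>Z\<close> and \<open>Z'\<close> whose
    projection has coordinate components 1 and 0.\<close>
  let ?E = "\<lambda>x. (Z' x ?y' * inverse (d x)) *\<^sub>T Z x +\<^sub>T (-1 * Z x ?y' * inverse (d x)) *\<^sub>T Z' x"
  have E: "?E \<in> fields M p"
    using Z Z' g di by (intro M.section_add M.section_scale M.germ_mult M.germ_cmult) auto
  have "\<forall>\<^sub>F x in near M p. d x \<noteq> 0"
    using tendsto_imp_eventually_ne[OF M.germ_tendsto[OF _ dg]] d1 by simp
  moreover have "\<forall>\<^sub>F x in near M p. \<pi> x \<in> U"
    using smooth_map_near[OF M.smooth_structure_axioms B.smooth_structure_axioms pi_smooth _
        near_nhds[OF near_chart[OF AB U]]] by simp
  ultimately have "\<forall>\<^sub>F x in near M p. lift x (push M B \<pi> x (?E x)) = lift x (?e (\<pi> x))"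
    using section_near_tangent[OF Z(1)] section_near_tangent[OF Z'(1)]
  proof eventually_elim
    case (elim x)
    have y: "coord \<psi> c \<in> smooth_germs AB (\<pi> x)" for c using coord_germ[OF AB U(1) elim(2)] .
    have ex: "push M B \<pi> x w = w ?y *\<^sub>T ?e (\<pi> x) +\<^sub>T w ?y' *\<^sub>T ?e' (\<pi> x)" if "w \<in> tangent M x" for w
      using tangent_expansion2[OF AB U(1) elim(2) push_pi_tangent[OF that] b b'(1)] b'(2) y
      by (simp add: push_apply)
    have "push M B \<pi> x (?E x) = ?e (\<pi> x)"
    proof
      fix h
      have "push M B \<pi> x (?E x) h = (Z' x ?y' * inverse (d x)) * (Z x ?y * ?e (\<pi> x) h + Z x ?y' * ?e' (\<pi> x) h)
          + (-1 * Z x ?y' * inverse (d x)) * (Z' x ?y * ?e (\<pi> x) h + Z' x ?y' * ?e' (\<pi> x) h)"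
        unfolding push_tadd push_tscale ex[OF elim(3)[unfolded id_apply]] ex[OF elim(4)[unfolded id_apply]] by (simp add: tvec_defs)
      also have "\<dots> = inverse (d x) * d x * ?e (\<pi> x) h"
        by (simp add: d_def algebra_simps)
      finally show "push M B \<pi> x (?E x) h = ?e (\<pi> x) h" using elim(1) by simp
    qed
    then show ?case by simp
  qed
  from M.section_cong[OF lift_push_field[OF E] this] show ?thesis .
qed

text \<open>Lifting is linear over functions on \<open>M\<close>, so smoothness has to be known for
  coordinate fields only. Sections along \<pi> are more general than fields of the base, as their
  coefficients may vary along the fibres.\<close>

lemma lift_section:
  assumes V: "V \<in> sections M B \<pi> p"
  shows "(\<lambda>x. lift x (V x)) \<in> fields M p"
proof -
  obtain U \<psi> where U: "(U, \<psi>) \<in> AB" "\<pi> p \<in> U" using atlas_cover[OF AB] .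
  show ?thesis
  proof (rule section_induct_chart[where P = "\<lambda>V. (\<lambda>x. lift x (V x)) \<in> fields M p", OF M.smooth_structure_axioms AB pi_smooth _ V U])
    show "(\<lambda>x. lift x (coord_field AB U \<psi> b (\<pi> x))) \<in> fields M p" if "b \<in> Basis" for b
      using lift_coord_field[OF U that] .
  next
    fix V W assume VW: "V \<in> sections M B \<pi> p" "W \<in> sections M B \<pi> p"
      and l: "(\<lambda>x. lift x (V x)) \<in> fields M p" "(\<lambda>x. lift x (W x)) \<in> fields M p"
    have "\<forall>\<^sub>F x in near M p. lift x (V x) +\<^sub>T lift x (W x) = lift x (V x +\<^sub>T W x)"
      using section_near_tangent[OF VW(1)] section_near_tangent[OF VW(2)]
      by eventually_elim (simp add: lift_add)
    from M.section_cong[OF M.section_add[OF l] this] show "(\<lambda>x. lift x (V x +\<^sub>T W x)) \<in> fields M p" .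
  next
    fix a V assume V: "a \<in> germs M p" "V \<in> sections M B \<pi> p" and l: "(\<lambda>x. lift x (V x)) \<in> fields M p"
    have "\<forall>\<^sub>F x in near M p. a x *\<^sub>T lift x (V x) = lift x (a x *\<^sub>T V x)"
      using section_near_tangent[OF V(2)] by eventually_elim (simp add: lift_scale)
    from M.section_cong[OF M.section_scale[OF V(1) l] this]
    show "(\<lambda>x. lift x (a x *\<^sub>T V x)) \<in> fields M p" by simp
  next
    fix V W assume "\<forall>\<^sub>F q in near M p. V q = W q" and l: "(\<lambda>x. lift x (V x)) \<in> fields M p"
    then have "\<forall>\<^sub>F x in near M p. lift x (V x) = lift x (W x)" by (auto elim: eventually_mono)
    from M.section_cong[OF l this] show "(\<lambda>x. lift x (W x)) \<in> fields M p" .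
  qed simp
qed

section \<open>Projectable fields and the two Levi-Civita connections\<close>

definition lift_field where "lift_field Z x = lift x (Z (\<pi> x))"

lemma comp_pi_section: "Z \<in> fields B (\<pi> p) \<Longrightarrow> (\<lambda>x. Z (\<pi> x)) \<in> sections M B \<pi> p"
  using section_comp[OF M.smooth_structure_axioms B.smooth_structure_axioms pi_smooth, of p Z] by (simp add: o_def)

lemma lift_field: "Z \<in> fields B (\<pi> p) \<Longrightarrow> lift_field Z \<in> fields M p"
  unfolding lift_field_def[abs_def] using lift_section[OF comp_pi_section] .

lemma near_base_field:
  "Z \<in> fields B (\<pi> p) \<Longrightarrow> \<forall>\<^sub>F x in near M p. Z (\<pi> x) \<in> tangent B (\<pi> x)"
  using section_near_tangent[OF comp_pi_section] .

lemma base_field_tangent: "Z \<in> fields B (\<pi> p) \<Longrightarrow> Z (\<pi> p) \<in> tangent B (\<pi> p)"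
  using field_tangent[of Z B "\<pi> p"] by simp

text \<open>\<open>lift_field Z\<close> and \<open>Z\<close> are \<pi>-related: on a function
  \<open>h \<circ> \<pi>\<close> the lift acts as \<open>Z\<close> acts on \<open>h\<close>, pulled
  back. This is why brackets of lifts project to brackets.\<close>

lemma vector_lift_field:
  assumes v: "v \<in> tangent M p" and Z: "Z \<in> fields B (\<pi> p)" and h: "h \<in> smooth_germs AB (\<pi> p)"
  shows "v (\<lambda>q. lift_field Z q (\<lambda>x. h (\<pi> x))) = push M B \<pi> p v (\<lambda>b. Z b h)"
proof -
  have "\<forall>\<^sub>F q in near M p. lift_field Z q (\<lambda>x. h (\<pi> x)) = Z (\<pi> q) h"
    using near_base_field[OF Z] push_near(1)[OF xi_field h]
  proof eventually_elim
    case (elim q)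
    then show ?case
      using push_lift[OF elim(1)] push_apply[of h B \<pi> q M "lift q (Z (\<pi> q))"] by (simp add: lift_field_def)
  qed
  then show ?thesis
    using M.tangent_cong[OF _ v] section_germ[OF Z, of h] h by (simp add: push_apply)
qed

lemma push_bracket_lift:
  assumes Z: "Z \<in> fields B (\<pi> p)" and Z': "Z' \<in> fields B (\<pi> p)"
  shows "push M B \<pi> p (bracket M (lift_field Z) (lift_field Z') p) = bracket B Z Z' (\<pi> p)"
proof -
  note T = base_field_tangent[OF Z] base_field_tangent[OF Z']
  have l: "lift_field Z p \<in> tangent M p" "lift_field Z' p \<in> tangent M p"
    using T by (simp_all add: lift_field_def)
  have "lift_field Z p (\<lambda>q. lift_field Z' q (\<lambda>x. h (\<pi> x))) = Z (\<pi> p) (\<lambda>b. Z' b h)"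
    "lift_field Z' p (\<lambda>q. lift_field Z q (\<lambda>x. h (\<pi> x))) = Z' (\<pi> p) (\<lambda>b. Z b h)"
    if "h \<in> smooth_germs AB (\<pi> p)" for h
    using vector_lift_field[OF l(1) Z' that] vector_lift_field[OF l(2) Z that] T by (simp_all add: lift_field_def)
  then show ?thesis
    by (auto simp: push_def bracket_def o_def fun_eq_iff pi_germ)
qed

text \<open>The bracket is horizontal because the contraction of \<open>d\<eta>\<close> with \<xi>
  vanishes while \<eta> is constant on both fields, and it projects to zero because \<xi> is
  \<pi>-related to the zero field. The argument is infinitesimal and does not differentiate the flow
  maps.\<close>

lemma bracket_xi_lift:
  assumes Z: "Z \<in> fields B (\<pi> p)"
  shows "bracket M \<xi> (lift_field Z) p = tzero"
proof (rule vertical_zero)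
  note L = lift_field[OF Z] and T = base_field_tangent[OF Z]
  have l: "lift_field Z p \<in> tangent M p"
    using T by (simp add: lift_field_def)
  show "bracket M \<xi> (lift_field Z) p \<in> tangent M p"
    using levi_civita_torsion[OF lc _ xi_field L] l by (metis M_comb(2) UNIV_I nabla_tangent points_mfd xi_field xi_tangent L)
  have "\<forall>\<^sub>F q in near M p. \<eta> q (lift_field Z q) = 0"
    using near_base_field[OF Z] by eventually_elim (simp add: lift_field_def)
  from M.tangent_cong[OF _ xi_tangent this]
  have "\<xi> p (\<lambda>q. \<eta> q (lift_field Z q)) = 0"
    using M.tangent_const[OF _ xi_tangent[of p], of 0] by simp
  then show "\<eta> p (bracket M \<xi> (lift_field Z) p) = 0"
    using d_eta_xi[OF L] M.tangent_const[OF _ l, of 1] by (simp add: ext_deriv_def)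
  have "bracket M \<xi> (lift_field Z) p (\<lambda>x. h (\<pi> x)) = 0" if h: "h \<in> smooth_germs AB (\<pi> p)" for h
  proof -
    have "\<forall>\<^sub>F q in near M p. \<xi> q (\<lambda>x. h (\<pi> x)) = 0"
      using push_near(1)[OF xi_field h]
    proof eventually_elim
      case (elim q)
      then show ?case
        using push_apply[of h B \<pi> q M "\<xi> q"] by (simp add: tzero_def)
    qed
    from M.tangent_cong[OF _ l this] have "lift_field Z p (\<lambda>q. \<xi> q (\<lambda>x. h (\<pi> x))) = 0"
      using M.tangent_const[OF _ l, of 0] by simp
    then show ?thesis
      using vector_lift_field[OF xi_tangent Z h] pi_germ[OF h] by (simp add: bracket_def tzero_def)
  qed
  then show "push M B \<pi> p (bracket M \<xi> (lift_field Z) p) = tzero"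
    by (auto simp: push_def tzero_def o_def)
qed

lemma nabla_xi_lift:
  assumes Z: "Z \<in> fields B (\<pi> p)"
  shows "nabla p (\<xi> p) (lift_field Z) = -1 *\<^sub>T \<phi> p (lift p (Z (\<pi> p)))"
proof -
  have "lift_field Z p \<in> tangent M p"
    using base_field_tangent[OF Z] by (simp add: lift_field_def)
  from nabla_xi[OF this] levi_civita_torsion[OF lc _ xi_field lift_field[OF Z]] bracket_xi_lift[OF Z]
  show ?thesis by (auto simp: tvec_defs fun_eq_iff lift_field_def eq_neg_iff_add_eq_0)
qed

lemma vector_metric_lift:
  assumes v: "v \<in> tangent M p" and Z: "Z \<in> fields B (\<pi> p)" "Z' \<in> fields B (\<pi> p)"
  shows "v (\<lambda>q. g q (lift_field Z q) (lift_field Z' q)) = push M B \<pi> p v (\<lambda>b. gB b (Z b) (Z' b))"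
proof -
  have "\<forall>\<^sub>F q in near M p. g q (lift_field Z q) (lift_field Z' q) = gB (\<pi> q) (Z (\<pi> q)) (Z' (\<pi> q))"
    using near_base_field[OF Z(1)] near_base_field[OF Z(2)]
    by eventually_elim (simp add: lift_field_def metric_lift)
  then show ?thesis
    using M.tangent_cong[OF _ v] B.metric_germ[OF _ Z] by (simp add: push_apply)
qed

lemma push_nabla_lift:
  assumes w: "w \<in> tangent B (\<pi> p)" and Z: "Z \<in> fields B (\<pi> p)"
  shows "push M B \<pi> p (nabla p (lift p w) (lift_field Z)) = nablaB (\<pi> p) w Z"
proof (rule B.metric_ext[of "\<pi> p"])
  show "nablaB (\<pi> p) w Z \<in> tangent B (\<pi> p)"
    using levi_civita_tangent[OF lcB _ w Z] by simp
  show "push M B \<pi> p (nabla p (lift p w) (lift_field Z)) \<in> tangent B (\<pi> p)"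
    using w lift_field[OF Z] by simp
  fix u assume u: "u \<in> tangent B (\<pi> p)"
  obtain W where W: "W \<in> fields B (\<pi> p)" "W (\<pi> p) = w" using extend_tangent_vector[OF AB w] .
  obtain V where V: "V \<in> fields B (\<pi> p)" "V (\<pi> p) = u" using extend_tangent_vector[OF AB u] .
  note L = lift_field[OF W(1)] lift_field[OF Z] lift_field[OF V(1)]
  note T = base_field_tangent[OF W(1)] base_field_tangent[OF Z] base_field_tangent[OF V(1)]
  have br: "bracket M (lift_field X) (lift_field X') p \<in> tangent M p"
    if "X \<in> fields B (\<pi> p)" "X' \<in> fields B (\<pi> p)" for X X'
    using levi_civita_torsion[OF lc _ lift_field[OF that(1)] lift_field[OF that(2)]]
      lift_field[OF that(1)] lift_field[OF that(2)] field_tangent[of _ M p]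
    by (metis M_comb(2) UNIV_I nabla_tangent points_mfd)
  \<comment> \<open>The two Koszul formulas agree term by term: inner products of lifts are pulled
    back from the base, and a bracket of lifts enters only through its projection, the bracket in
    the base.\<close>
  have "g p (nabla p (lift p w) (lift_field Z)) (lift p u) = gB (\<pi> p) (nablaB (\<pi> p) w Z) u"
    using M.koszul[OF lc _ L] B.koszul[OF lcB _ W(1) Z V(1)] T
    by (simp add: vector_metric_lift[OF _ Z V(1)] vector_metric_lift[OF _ W(1) V(1)] vector_metric_lift[OF _ W(1) Z]
        lift_field_def[of _ p] W(2) V(2) metric_lift_push br W(1) V(1) Z push_bracket_lift)
  then show "gB (\<pi> p) (push M B \<pi> p (nabla p (lift p w) (lift_field Z))) u = gB (\<pi> p) (nablaB (\<pi> p) w Z) u"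
    using metric_lift_push[of "nabla p (lift p w) (lift_field Z)" p u] w u L(2) by simp
qed simp

end

section \<open>Curves\<close>

definition velocity :: "'m smooth_space \<Rightarrow> (real \<Rightarrow> 'm) \<Rightarrow> real \<Rightarrow> 'm tvec" where
  "velocity X c u = (\<lambda>h. if h \<in> germs X (c u) then deriv (\<lambda>r. h (c r)) u else 0)"

context
  fixes A :: "('m::topological_space, 'e::euclidean_space) atlas" and S c u0
  assumes A: "smooth_atlas A" and S: "\<forall>\<^sub>F u in nhds u0. c u \<in> S"
    and diff: "\<And>F. F \<in> smooth_germs A (c u0) \<Longrightarrow> \<exists>d. ((\<lambda>u. F (c u)) has_real_derivative d) (at u0)"
begin

interpretation X: smooth_structure "submfd A S" by (rule smooth_structure_submfd[OF A])

lemma curve_point: "c u0 \<in> S"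
  using eventually_nhds_x_imp_x[OF S] .

text \<open>Continuity of \<open>c\<close> at \<open>u0\<close> is hidden in the differentiability
  of germs along \<open>c\<close>: the indicator of the set in question is a germ, so it stays close
  to 1 along \<open>c\<close>.\<close>

lemma curve_near:
  assumes "\<forall>\<^sub>F x in near (submfd A S) (c u0). P x"
  shows "\<forall>\<^sub>F u in nhds u0. P (c u)"
proof -
  define \<rho> :: "'m \<Rightarrow> real" where "\<rho> x = (if x \<in> S \<longrightarrow> P x then 1 else 0)" for x
  have ev: "\<forall>\<^sub>F x in nhds (c u0). x \<in> S \<longrightarrow> P x"
    using assms by (simp add: eventually_inf_principal)
  have "\<rho> \<in> smooth_germs A (c u0)"
    by (rule smooth_germs_cong[OF A smooth_germs_const[OF A, of 1]])
      (use ev in \<open>auto simp: \<rho>_def elim: eventually_mono\<close>)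
  from diff[OF this] have "isCont (\<lambda>u. \<rho> (c u)) u0"
    using DERIV_isCont by blast
  then have "((\<lambda>u. \<rho> (c u)) \<longlongrightarrow> \<rho> (c u0)) (nhds u0)"
    unfolding isCont_def by (subst (asm) tendsto_at_iff_tendsto_nhds)
  moreover have "\<rho> (c u0) = 1"
    using eventually_nhds_x_imp_x[OF ev] by (simp add: \<rho>_def)
  ultimately have "\<forall>\<^sub>F u in nhds u0. \<rho> (c u) > 1 / 2"
    by (intro order_tendstoD) auto
  with S show ?thesis
    by eventually_elim (auto simp: \<rho>_def split: if_splits)
qed

lemma velocity_derivative:
  assumes "h \<in> germs (submfd A S) (c u0)"
  shows "((\<lambda>u. h (c u)) has_real_derivative velocity (submfd A S) c u0 h) (at u0)"
proof -
  obtain F where F: "F \<in> smooth_germs A (c u0)" "\<forall>\<^sub>F x in near (submfd A S) (c u0). h x = F x"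
    using assms unfolding germs_submfd by blast
  obtain d where "((\<lambda>u. F (c u)) has_real_derivative d) (at u0)" using diff[OF F(1)] by blast
  moreover have ev: "\<forall>\<^sub>F u in nhds u0. h (c u) = F (c u)" using curve_near[OF F(2)] .
  ultimately have "((\<lambda>u. h (c u)) has_real_derivative d) (at u0)"
    using DERIV_cong_ev[OF refl ev refl] by blast
  then show ?thesis
    using assms by (simp add: velocity_def DERIV_imp_deriv)
qed

lemma velocity_tangent: "velocity (submfd A S) c u0 \<in> tangent (submfd A S) (c u0)"
proof -
  let ?X = "submfd A S" and ?v = "velocity (submfd A S) c u0"
  have p: "c u0 \<in> points ?X" using curve_point by simp
  have "?v (\<lambda>x. a * f x + b * h x) = a * ?v f + b * ?v h"
    and "?v (\<lambda>x. f x * h x) = f (c u0) * ?v h + h (c u0) * ?v f"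
    if f: "f \<in> germs ?X (c u0)" and h: "h \<in> germs ?X (c u0)" for f h a b
  proof -
    note df = velocity_derivative[OF f] and dh = velocity_derivative[OF h]
    have "(\<lambda>x. a * f x + b * h x) \<in> germs ?X (c u0)" "(\<lambda>x. f x * h x) \<in> germs ?X (c u0)"
      using p f h by (auto intro!: X.germ_add X.germ_cmult X.germ_mult)
    note d = this[THEN velocity_derivative]
    show "?v (\<lambda>x. a * f x + b * h x) = a * ?v f + b * ?v h"
      by (rule DERIV_unique[OF d(1)]) (intro DERIV_add DERIV_cmult df dh)
    show "?v (\<lambda>x. f x * h x) = f (c u0) * ?v h + h (c u0) * ?v f"
      by (rule DERIV_unique[OF d(2)]) (use DERIV_mult[OF df dh] in \<open>simp add: ac_simps\<close>)
  qed
  then show ?thesis by (auto simp: tangent_def velocity_def)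
qed

end

section \<open>The parameter interval as a manifold\<close>

lemma germs_interval:
  assumes "open I" "s \<in> I" shows "germs (submfd real_atlas I) s = smooth_germs real_atlas s"
proof -
  have "\<forall>\<^sub>F x in nhds s. x \<in> I" using assms by (rule eventually_nhds_in_open)
  then have "h \<in> smooth_germs real_atlas s" if h: "h \<in> germs (submfd real_atlas I) s" for h
  proof -
    obtain F where F: "F \<in> smooth_germs real_atlas s" "\<forall>\<^sub>F x in near (submfd real_atlas I) s. h x = F x"
      using h unfolding germs_submfd by blast
    have "\<forall>\<^sub>F x in nhds s. F x = h x"
      using F(2) \<open>\<forall>\<^sub>F x in nhds s. x \<in> I\<close> unfolding eventually_inf_principal points_submfd
      by eventually_elim simp
    then show ?thesis by (rule smooth_germs_cong[OF smooth_atlas_real F(1)])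
  qed
  then show ?thesis using smooth_germs_restrict by blast
qed

lemma real_germ_derivative:
  assumes "k \<in> smooth_germs real_atlas s"
  shows "(k has_real_derivative d_ds s k) (at s)"
proof -
  obtain W where W: "s \<in> W" "smooth_on W k" using assms smooth_germs_real by blast
  have "k differentiable at s" using smooth_on_has_derivative[OF W(2,1)] differentiableI by blast
  then have "(k has_real_derivative deriv k s) (at s)"
    by (simp add: DERIV_deriv_iff_real_differentiable)
  with assms show ?thesis by (simp add: d_ds_def)
qed

text \<open>As the velocity of the identity curve, d/ds inherits the derivation property from
  \<open>velocity_tangent\<close>.\<close>

lemma d_ds_velocity:
  assumes "open I" "s \<in> I" shows "d_ds s = velocity (submfd real_atlas I) (\<lambda>u. u) s"
  using germs_interval[OF assms] by (auto simp: d_ds_def velocity_def)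

lemma d_ds_tangent:
  assumes "open I" "s \<in> I" shows "d_ds s \<in> tangent (submfd real_atlas I) s"
  unfolding d_ds_velocity[OF assms]
  using eventually_nhds_in_open[OF assms] real_germ_derivative
  by (intro velocity_tangent[OF smooth_atlas_real]) auto

lemma d_ds_field:
  assumes "open I" "s \<in> I" shows "d_ds \<in> fields (submfd real_atlas I) s"
proof -
  interpret X: smooth_structure "submfd real_atlas I"
    using smooth_structure_submfd[OF smooth_atlas_real] .
  have at: "(UNIV, id) \<in> real_atlas" by (simp add: real_atlas_def)
  show ?thesis
  proof (rule field_submfdI[OF smooth_atlas_real at])
    show "\<forall>\<^sub>F q in near (submfd real_atlas I) s. d_ds q \<in> tangent (submfd real_atlas I) q"
      using near_points by eventually_elim (auto intro: d_ds_tangent assms)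
    fix b :: real assume "b \<in> Basis"
    then have "coord id b = (\<lambda>x. x)" by (auto simp: coord_def)
    moreover have "d_ds q (\<lambda>x. x) = 1" for q
    proof -
      have "(\<lambda>x. x) \<in> smooth_germs real_atlas q"
        using smooth_germs_real smooth_on_bounded_linear[OF open_UNIV bounded_linear_ident] by blast
      then show ?thesis by (simp add: d_ds_def)
    qed
    ultimately show "(\<lambda>q. d_ds q (coord id b)) \<in> germs (submfd real_atlas I) s"
      using X.germ_const assms(2) by simp
  qed (use assms in auto)
qed

context boothby_wang_fibering
begin

text \<open>A local section of the submersion \<open>\<pi>\<close> comes from the inverse function theorem, applied to the
  restriction of \<open>\<pi>\<close> to an affine plane transversal to the fibre in a chart.  Differentiability
  of the lifted curve at the one parameter \<open>s0\<close> is all that is needed.\<close>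
lemma curve_lift:
  assumes I: "open I" "s0 \<in> I" and \<gamma>: "smooth_map (submfd real_atlas I) B \<gamma>" and p: "\<pi> p = \<gamma> s0"
  obtains c where "c s0 = p" "\<forall>\<^sub>F s in nhds s0. \<pi> (c s) = \<gamma> s"
    "\<And>F. F \<in> smooth_germs (prod_atlas A) (s0, p) \<Longrightarrow> \<exists>d. ((\<lambda>s. F (s, c s)) has_real_derivative d) (at s0)"
proof -
  obtain U \<phi>c where U: "(U, \<phi>c) \<in> A" "p \<in> U" using atlas_cover[OF A] .
  obtain V \<psi> where V: "(V, \<psi>) \<in> AB" "\<pi> p \<in> V" using atlas_cover[OF AB] .
  let ?\<phi>i = "inv_into U \<phi>c"
  define e where "e b = coord_field AB V \<psi> b (\<pi> p)" for b
  have "\<exists>u. u \<in> tangent M p \<and> push M B \<pi> p u = e b" for b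
    using coord_field_tangent[OF AB V, of b] by (intro exI[of _ "lift p (e b)"]) (simp add: e_def)
  then obtain u where u: "\<And>b. u b \<in> tangent M p" "\<And>b. push M B \<pi> p (u b) = e b" by metis
  \<comment> \<open>Chart components of the vector \<open>u b\<close>, which projects to the
    coordinate vector of direction \<open>b\<close>. Along the affine map \<open>L\<close> with
    these directions the coordinates of \<pi> therefore have the identity as derivative at
    0.\<close>
  define \<nu> where "\<nu> b = (\<Sum>j\<in>Basis. u b (coord \<phi>c j) *\<^sub>R j)" for b
  define L where "L z = \<phi>c p + (\<Sum>b\<in>Basis. (z \<bullet> b) *\<^sub>R \<nu> b)" for z :: "real ^ 2"
  have L0: "L 0 = \<phi>c p" by (simp add: L_def)
  have bl: "bounded_linear (\<lambda>z :: real ^ 2. \<Sum>b\<in>Basis. (z \<bullet> b) *\<^sub>R \<nu> b)"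
    by (intro bounded_linear_sum bounded_linear_scaleR_const bounded_linear_inner_left)
  have dL: "(L has_derivative (\<lambda>z. \<Sum>b\<in>Basis. (z \<bullet> b) *\<^sub>R \<nu> b)) (at z)" for z
    unfolding L_def[abs_def] using bounded_linear_imp_has_derivative[OF bl]
    by (auto intro!: derivative_eq_intros)
  have y: "coord \<psi> b \<in> smooth_germs AB (\<pi> p)" for b using coord_germ[OF AB V] .
  have yg: "(\<lambda>x. coord \<psi> b (\<pi> x)) \<in> smooth_germs A p" for b using pi_germ[OF y] .
  have "\<forall>\<^sub>F x in near M p. \<pi> x \<in> V"
    using smooth_map_near[OF M.smooth_structure_axioms B.smooth_structure_axioms pi_smooth _
        near_nhds[OF near_chart[OF AB V]]] by simp
  then obtain N0 where N0: "open N0" "p \<in> N0" "\<And>x. x \<in> N0 \<Longrightarrow> \<pi> x \<in> V"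
    by (auto simp: eventually_nhds)
  have "\<forall>b. \<exists>N. open N \<and> p \<in> N \<and> N \<subseteq> U \<and> smooth_on (\<phi>c ` N) (\<lambda>y. coord \<psi> b (\<pi> (?\<phi>i y)))"
    by (intro allI) (rule smooth_germs_chart[OF A U, THEN iffD1, OF yg])
  from choice[OF this] obtain N where
    "\<forall>b. open (N b) \<and> p \<in> N b \<and> N b \<subseteq> U \<and> smooth_on (\<phi>c ` N b) (\<lambda>y. coord \<psi> b (\<pi> (?\<phi>i y)))"
    by (rule exE)
  then have N: "\<And>b. open (N b)" "\<And>b. p \<in> N b" "\<And>b. N b \<subseteq> U"
      "\<And>b. smooth_on (\<phi>c ` N b) (\<lambda>y. coord \<psi> b (\<pi> (?\<phi>i y)))"
    by simp_all
  \<comment> \<open>On \<open>N1\<close> all coordinates of \<pi> are smooth in the chart of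
    \<open>M\<close>, and \<pi> takes values in the chart domain \<open>V\<close> of the
    base.\<close>
  define N1 where "N1 = U \<inter> N0 \<inter> (\<Inter>b\<in>Basis. N b)"
  have N1: "open N1" "p \<in> N1" "N1 \<subseteq> U"
  proof -
    show "open N1"
      unfolding N1_def by (intro open_Int open_INT ballI finite_Basis N(1) N0(1) atlas_open[OF A U(1)])
  qed (use N(2) N0(2) U(2) in \<open>auto simp: N1_def\<close>)
  define W where "W = L -` (\<phi>c ` N1)"
  have W: "open W" "0 \<in> W"
  proof -
    have "continuous_on UNIV L"
      using has_derivative_continuous[OF dL] by (simp add: continuous_at_imp_continuous_on)
    then show "open W"
      unfolding W_def using chart_nhd[OF A U(1) N1(1,3)] by (intro open_vimage)
    show "0 \<in> W" using N1(2) by (simp add: W_def L0)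
  qed
  have LW: "?\<phi>i (L z) \<in> N1" if "z \<in> W" for z
    using that atlas_inv[OF A U(1)] N1(3) by (auto simp: W_def)
  define f where "f z = \<psi> (\<pi> (?\<phi>i (L z)))" for z
  have sL: "smooth_on W L"
    unfolding L_def[abs_def] by (intro smooth_on_add smooth_on_const W smooth_on_bounded_linear bl)
  have sf: "smooth_on W f"
  proof (rule smooth_on_componentwise[OF W(1)])
    fix b :: "real ^ 2" assume b: "b \<in> Basis"
    have "L ` W \<subseteq> \<phi>c ` N b" using b by (auto simp: W_def N1_def)
    from smooth_on_compose[OF W(1) this sL N(4)]
    show "smooth_on W (\<lambda>z. f z \<bullet> b)" by (simp add: f_def coord_def)
  qed
  have f0: "f 0 = \<psi> (\<pi> p)" using atlas_inv[OF A U] by (simp add: f_def L0)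
  have df0: "(f has_derivative id) (at 0)"
    unfolding has_derivative_componentwise_within[of f id 0 UNIV]
  proof
    fix b :: "real ^ 2" assume b: "b \<in> Basis"
    let ?d = "\<lambda>v. coord_field A U \<phi>c v p (\<lambda>x. coord \<psi> b (\<pi> x))"
    have d: "((\<lambda>y. coord \<psi> b (\<pi> (?\<phi>i y))) has_derivative ?d) (at (\<phi>c p))"
      using germ_has_derivative[OF A U yg] .
    have lin: "linear ?d" using has_derivative_linear[OF d] .
    have d\<nu>: "?d (\<nu> c) = c \<bullet> b" for c
    proof -
      have "?d (\<nu> c) = (\<Sum>j\<in>Basis. u c (coord \<phi>c j) * ?d j)"
        unfolding \<nu>_def by (simp add: linear_sum[OF lin] linear_cmul[OF lin])
      also have "\<dots> = u c (\<lambda>x. coord \<psi> b (\<pi> x))"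
        using tangent_expansion[OF A U u(1) yg] by simp
      also have "\<dots> = push M B \<pi> p (u c) (coord \<psi> b)"
        using y by (simp add: push_apply)
      also have "\<dots> = c \<bullet> b"
        by (simp add: u(2) e_def coord_field_coord[OF AB V])
      finally show ?thesis .
    qed
    have "((\<lambda>z. coord \<psi> b (\<pi> (?\<phi>i (L z)))) has_derivative (\<lambda>z. ?d (\<Sum>c\<in>Basis. (z \<bullet> c) *\<^sub>R \<nu> c))) (at 0)"
      by (rule has_derivative_compose[OF dL]) (simp add: L0 d)
    moreover have "?d (\<Sum>c\<in>Basis. (z \<bullet> c) *\<^sub>R \<nu> c) = id z \<bullet> b" for z
      using b by (simp add: linear_sum[OF lin] linear_cmul[OF lin] d\<nu> inner_Basis if_distrib cong: if_cong)
    ultimately show "((\<lambda>z. f z \<bullet> b) has_derivative (\<lambda>z. id z \<bullet> b)) (at 0)"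
      by (simp add: f_def coord_def)
  qed
  \<comment> \<open>The inverse function theorem wants the derivative as a continuous map into
    bounded linear maps; continuity is checked direction by direction.\<close>
  define f' where "f' z = Blinfun (frechet_derivative f (at z))" for z
  have f': "blinfun_apply (f' z) = frechet_derivative f (at z)" if "z \<in> W" for z
    unfolding f'_def using smooth_on_has_derivative[OF sf that] has_derivative_bounded_linear
    by (intro bounded_linear_Blinfun_apply) blast
  have "continuous_on W (\<lambda>z. blinfun_apply (f' z) b)" for b
    using smooth_on_imp_continuous_on[OF smooth_on_directional[OF sf, of b]]
    by (rule continuous_on_eq) (simp add: f')
  then have cf': "continuous_on W f'"
    by (intro continuous_on_blinfun_componentwise) blast
  have "f' 0 = id_blinfun"
    using frechet_derivative_at[OF df0] f'[OF W(2)] by (intro blinfun_eqI) simp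
  then have inv: "id_blinfun o\<^sub>L f' 0 = id_blinfun" by (intro blinfun_eqI) simp
  obtain U' V' G G' where G: "open U'" "U' \<subseteq> W" "0 \<in> U'" "open V'" "f 0 \<in> V'" "homeomorphism U' V' f G"
      "\<And>y. y \<in> V' \<Longrightarrow> (G has_derivative G' y) (at y)"
  proof (rule inverse_function_theorem[OF W(1) _ cf' W(2) inv])
    show "(f has_derivative blinfun_apply (f' x)) (at x)" if "x \<in> W" for x
      using smooth_on_has_derivative[OF sf that] f'[OF that] by simp
  qed blast
  have G0: "G (f 0) = 0" and GU: "\<And>y. y \<in> V' \<Longrightarrow> G y \<in> U'" and fG: "\<And>y. y \<in> V' \<Longrightarrow> f (G y) = y"
    using G(3,6) by (auto simp: homeomorphism_def)
  \<comment> \<open>The local inverse \<open>G\<close> makes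
    \<open>?\<phi>i \<circ> L \<circ> G \<circ> \<psi>\<close> a local section of \<pi>, and
    \<open>c\<close> is this section along \<gamma>.\<close>
  define c where "c s = ?\<phi>i (L (G (\<psi> (\<gamma> s))))" for s
  show ?thesis
  proof (rule that)
    show "c s0 = p"
      using p G0 atlas_inv[OF A U] by (simp add: c_def f0[unfolded p] L0)
    have "\<forall>\<^sub>F b in near B (\<gamma> s0). b \<in> V \<inter> \<psi> -` V'"
      using V(2) G(5) f0 p
      by (intro near_nhds eventually_nhds_in_open chart_vimage_open[OF AB V(1)] G(4)) auto
    from smooth_map_near[OF smooth_structure_submfd[OF smooth_atlas_real] B.smooth_structure_axioms \<gamma> _ this]
    have "\<forall>\<^sub>F s in nhds s0. s \<in> I \<longrightarrow> \<gamma> s \<in> V \<inter> \<psi> -` V'"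
      using I(2) by (simp add: eventually_inf_principal)
    with eventually_nhds_in_open[OF I] show "\<forall>\<^sub>F s in nhds s0. \<pi> (c s) = \<gamma> s"
    proof eventually_elim
      case (elim s)
      then have *: "\<psi> (\<gamma> s) \<in> V'" "\<gamma> s \<in> V" by auto
      have "c s \<in> N1" using LW GU[OF *(1)] G(2) by (auto simp: c_def)
      then have "\<pi> (c s) \<in> V" using N0(3) by (auto simp: N1_def)
      moreover have "\<psi> (\<pi> (c s)) = \<psi> (\<gamma> s)" using fG[OF *(1)] by (simp add: f_def c_def)
      ultimately show ?case using *(2) atlas_inv[OF AB V(1)] by metis
    qed
    fix F assume "F \<in> smooth_germs (prod_atlas A) (s0, p)"
    then obtain Q where Q: "(s0, \<phi>c p) \<in> Q" "smooth_on Q (\<lambda>z. F (fst z, ?\<phi>i (snd z)))"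
      using smooth_germs_prod_chart[OF A U] by blast
    have "(\<lambda>s. \<psi> (\<gamma> s)) differentiable (at s0)"
      unfolding differentiable_componentwise_within[of "\<lambda>s. \<psi> (\<gamma> s)" s0 UNIV]
    proof
      fix b :: "real ^ 2" assume "b \<in> Basis"
      have "(\<lambda>s. coord \<psi> b (\<gamma> s)) \<in> germs (submfd real_atlas I) s0"
        using smooth_map_germs[OF \<gamma>, of s0 "coord \<psi> b"] y[of b] I p by simp
      from real_germ_derivative[OF this[unfolded germs_interval[OF I]]]
      show "(\<lambda>s. \<psi> (\<gamma> s) \<bullet> b) differentiable (at s0)"
        unfolding coord_def using real_differentiable_def by blast
    qed
    moreover have "G differentiable (at (\<psi> (\<gamma> s0)))"
      using G(5,7) differentiableI by (metis f0 p)
    moreover have "L differentiable (at z)" for z using dL differentiableI by blast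
    ultimately have "(\<lambda>s. L (G (\<psi> (\<gamma> s)))) differentiable (at s0)"
      by (auto intro: differentiable_compose)
    then have "(\<lambda>s. (s, L (G (\<psi> (\<gamma> s))))) differentiable (at s0)"
      unfolding differentiable_def using has_derivative_Pair[OF has_derivative_ident] by fast
    moreover have "(\<lambda>z. F (fst z, ?\<phi>i (snd z))) differentiable (at (s0, L (G (\<psi> (\<gamma> s0)))))"
    proof -
      have eq: "L (G (\<psi> (\<gamma> s0))) = \<phi>c p" using G0 f0 p L0 by simp
      show ?thesis unfolding eq by (rule differentiableI[OF smooth_on_has_derivative[OF Q(2,1)]])
    qed
    ultimately have "(\<lambda>s. F (s, c s)) differentiable (at s0)"
      using differentiable_compose[of "\<lambda>z. F (fst z, ?\<phi>i (snd z))" "\<lambda>s. (s, L (G (\<psi> (\<gamma> s))))" s0 UNIV]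
      by (simp add: c_def)
    then show "\<exists>d. ((\<lambda>s. F (s, c s)) has_real_derivative d) (at s0)"
      by (simp add: real_differentiable_def)
  qed
qed

end

section \<open>Hopf cylinders\<close>

text \<open>On a germ \<open>h\<close> the image field takes the values of \<open>Z\<close> on
  \<open>h \<circ> f\<close>. In particular the velocity \<open>curve_p1\<close> becomes a smooth
  section along the curve.\<close>

lemma push_section:
  assumes X: "smooth_structure X" and Y: "smooth_structure Y" and f: "smooth_map X Y f"
    and p: "p \<in> points X" and Z: "Z \<in> fields X p"
  shows "(\<lambda>q. push X Y f q (Z q)) \<in> sections X Y f p"
proof -
  interpret X: smooth_structure X by fact
  interpret Y: smooth_structure Y by fact
  show ?thesis
    using sections_near[OF Z] near_points unfolding sections_iff[of "\<lambda>q. push X Y f q (Z q)"]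
  proof eventually_elim
    case (elim q)
    have "(\<lambda>x. push X Y f x (Z x) h) \<in> germs X q" if h: "h \<in> germs Y (f q)" for h
    proof (rule X.germ_cong[OF elim(2)])
      show "(\<lambda>x. Z x (\<lambda>y. h (f y))) \<in> germs X q"
        using section_germ[OF elim] smooth_map_germs[OF f elim(2) h] by simp
      show "\<forall>\<^sub>F x in near X q. Z x (\<lambda>y. h (f y)) = push X Y f x (Z x) h"
        using smooth_map_near[OF X Y f elim(2) Y.germ_near[OF smooth_map_points[OF f elim(2)] h]]
        by eventually_elim (simp add: push_apply)
    qed
    then show ?case using push_tangent[OF Y f elim(2) field_tangent[OF elim]] by blast
  qed
qed

locale hopf = boothby_wang_fibering A AB \<eta> \<xi> \<phi> g nabla \<Phi> \<pi> gB J nablaB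
  for A :: "('m::topological_space, 'e::euclidean_space) atlas"
    and AB :: "('b::topological_space, real ^ 2) atlas"
    and \<eta> \<xi> \<phi> g nabla \<Phi> \<pi> gB J nablaB +
  fixes I \<gamma> DB D
  assumes unit_speed: "unit_speed_curve (mfd AB) gB I \<gamma>"
    and DB: "induced_connection (submfd real_atlas I) (mfd AB) \<gamma> nablaB DB"
    and D: "induced_connection (hopf_cylinder A \<pi> I \<gamma>) (mfd A) snd nabla D"
begin

abbreviation "C \<equiv> submfd real_atlas I"
abbreviation "S \<equiv> hopf_cylinder A \<pi> I \<gamma>"

lemma I: "open I" "is_interval I" "I \<noteq> {}" and curve_smooth: "smooth_map C B \<gamma>"
  using unit_speed unfolding unit_speed_curve_def by auto

lemma points_S: "q \<in> points S \<longleftrightarrow> fst q \<in> I \<and> \<pi> (snd q) = \<gamma> (fst q)"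
  by (auto simp: hopf_cylinder_def)

lemma S_I [simp]: "q \<in> points S \<Longrightarrow> fst q \<in> I"
  and S_pi [simp]: "q \<in> points S \<Longrightarrow> \<gamma> (fst q) = \<pi> (snd q)"
  by (simp_all add: points_S)

lemma S_C: "q \<in> points S \<Longrightarrow> fst q \<in> points C"
  by simp

lemma point_over: "s \<in> I \<Longrightarrow> \<exists>q\<in>points S. fst q = s"
  using pi_surj points_S by (metis UNIV_I fst_conv image_iff snd_conv)

lemma C_structure: "smooth_structure C"
  using smooth_structure_submfd[OF smooth_atlas_real] .

lemma S_structure: "smooth_structure S"
  unfolding hopf_cylinder_def by (rule smooth_structure_submfd[OF smooth_atlas_prod[OF A]])

lemma snd_smooth: "smooth_map S M snd"
proof -
  have "h \<circ> snd \<in> germs S q" if "h \<in> smooth_germs A (snd q)" for q :: "real \<times> 'm" and h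
    using smooth_germs_snd[OF A that, of "fst q"] unfolding hopf_cylinder_def o_def
    by (intro smooth_germs_restrict) simp
  then show ?thesis by (simp add: smooth_map_def)
qed

lemma fst_smooth: "smooth_map S C fst"
proof -
  have "k \<circ> fst \<in> germs S q" if "q \<in> points S" "k \<in> germs C (fst q)" for q k
  proof -
    have "k \<in> smooth_germs real_atlas (fst q)"
      using that germs_interval[OF I(1), of "fst q"] by simp
    from smooth_germs_fst[OF A this, of "snd q"] show ?thesis
      unfolding hopf_cylinder_def o_def by (intro smooth_germs_restrict) simp
  qed
  then show ?thesis by (simp add: smooth_map_def)
qed

sublocale curve: pullback_connection C AB gB \<gamma> nablaB DB
  using C_structure curve_smooth lcB DB AB
  by (intro pullback_connection.intro pullback_connection_axioms.intro B.riemannian_axioms)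

sublocale cyl: pullback_connection S A g snd nabla D
  using S_structure snd_smooth lc D A
  by (intro pullback_connection.intro pullback_connection_axioms.intro M.riemannian_axioms)

lemma fst_near: "q \<in> points S \<Longrightarrow> \<forall>\<^sub>F s in near C (fst q). P s \<Longrightarrow> \<forall>\<^sub>F x in near S q. P (fst x)"
  using smooth_map_near[OF S_structure C_structure fst_smooth] .

lemma fst_germ: "q \<in> points S \<Longrightarrow> k \<in> germs C (fst q) \<Longrightarrow> (\<lambda>x. k (fst x)) \<in> germs S q"
  using smooth_map_germs[OF fst_smooth] .

lemma S_push_tangent [simp]: "q \<in> points S \<Longrightarrow> w \<in> tangent S q \<Longrightarrow> push S M snd q w \<in> tangent M (snd q)"
  using push_tangent[OF M.smooth_structure_axioms snd_smooth] .

abbreviation p1 where "p1 \<equiv> curve_p1 B I \<gamma>"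
abbreviation p2 where "p2 \<equiv> curve_p2 B J I \<gamma>"

lemma p1_section: "s \<in> I \<Longrightarrow> p1 \<in> sections C B \<gamma> s"
  unfolding curve_p1_def[abs_def]
  using push_section[OF C_structure B.smooth_structure_axioms curve_smooth _ d_ds_field[OF I(1)]] by simp

lemma p1_tangent: "s \<in> I \<Longrightarrow> p1 s \<in> tangent B (\<gamma> s)"
  using section_tangent[OF p1_section] by simp

lemma p1_unit: "s \<in> I \<Longrightarrow> gB (\<gamma> s) (p1 s) (p1 s) = 1"
  using unit_speed unfolding unit_speed_curve_def by simp

lemma p1_apply: "h \<in> smooth_germs AB (\<gamma> s) \<Longrightarrow> p1 s h = d_ds s (\<lambda>r. h (\<gamma> r))"
  by (simp add: curve_p1_def push_apply)

definition acc where "acc s = DB s (d_ds s) p1"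
text \<open>The inner product is defined without an existence proof, unlike the definite description
  in \<open>signed_curvature\<close>, to which it is shown equal afterwards.\<close>

definition \<kappa> where "\<kappa> s = gB (\<gamma> s) (acc s) (p2 s)"

text \<open>Differentiating the constant squared length of \<open>p1\<close> shows that the
  acceleration is orthogonal to \<open>p1\<close>; in the frame \<open>(p1, p2)\<close> only the
  second component is left.\<close>

lemma
  assumes s: "s \<in> I"
  shows p2_tangent: "p2 s \<in> tangent B (\<gamma> s)" and p2_unit: "gB (\<gamma> s) (p2 s) (p2 s) = 1"
    and acc_tangent: "acc s \<in> tangent B (\<gamma> s)" and acc_eq: "acc s = \<kappa> s *\<^sub>T p2 s"
proof -
  note T = p1_tangent[OF s] and d = d_ds_tangent[OF I(1) s]
  show 2: "p2 s \<in> tangent B (\<gamma> s)" and "gB (\<gamma> s) (p2 s) (p2 s) = 1"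
    using T p1_unit[OF s] by (simp_all add: curve_p2_def metric_J_J)
  show a: "acc s \<in> tangent B (\<gamma> s)"
    unfolding acc_def using connection_tangent[OF curve.conn _ d p1_section[OF s]] s by simp
  have "\<forall>\<^sub>F r in near C s. gB (\<gamma> r) (p1 r) (p1 r) = 1"
    using near_points by eventually_elim (simp add: p1_unit)
  from curve.X.tangent_cong[OF _ d this] have "d_ds s (\<lambda>r. gB (\<gamma> r) (p1 r) (p1 r)) = 0"
    using curve.X.tangent_const[OF _ d] s by simp
  then have "gB (\<gamma> s) (acc s) (p1 s) = 0"
    using curve.section_metric_derivative[OF _ p1_section[OF s] p1_section[OF s] d] s
      B.metric_sym[OF _ a T] by (simp add: acc_def)
  then show "acc s = \<kappa> s *\<^sub>T p2 s"
    using orthogonal_frame[OF T p1_unit[OF s] a] by (simp add: \<kappa>_def curve_p2_def)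
qed

lemma signed_curvature_eq: "s \<in> I \<Longrightarrow> signed_curvature B J I \<gamma> DB s = \<kappa> s"
  unfolding signed_curvature_def
proof (rule the_equality)
  assume s: "s \<in> I"
  show "DB s (d_ds s) p1 = \<kappa> s *\<^sub>T p2 s" using acc_eq[OF s] by (simp add: acc_def)
  fix k assume "DB s (d_ds s) p1 = k *\<^sub>T p2 s"
  then have "gB (\<gamma> s) (k *\<^sub>T p2 s) (p2 s) = \<kappa> s" by (simp add: \<kappa>_def acc_def)
  then show "k = \<kappa> s"
    using p2_tangent[OF s] p2_unit[OF s] by (simp add: B.metric_scale_left)
qed

lemma acc_zero_iff:
  assumes s: "s \<in> I" shows "acc s = tzero \<longleftrightarrow> \<kappa> s = 0"
  using acc_eq[OF s] B.metric_zero[OF _ p2_tangent[OF s]] by (auto simp: \<kappa>_def)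

subsection \<open>Lifting sections along the curve\<close>

text \<open>Horizontal lift of a whole section along \<gamma>. Both \<open>t\<close> and
  \<open>n\<close> arise in this way, and fields of the base pulled back by \<gamma> lift to
  pullbacks of the fields \<open>lift_field Z\<close> of \<open>M\<close>, whose derivatives are
  known.\<close>

definition L where "L V q = lift (snd q) (V (fst q))" for V and q :: "real \<times> 'm"

abbreviation t where "t \<equiv> L p1"
abbreviation n where "n \<equiv> L p2"
abbreviation xi where "xi \<equiv> \<xi> \<circ> snd"

lemma near_curve_section:
  assumes "q \<in> points S" "V \<in> sections C B \<gamma> (fst q)"
  shows "\<forall>\<^sub>F x in near S q. V (fst x) \<in> tangent B (\<pi> (snd x))"
  using fst_near[OF assms(1) section_near_tangent[OF assms(2)]] near_points by eventually_elim simp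

lemma
  assumes q: "q \<in> points S"
  shows L_base: "\<forall>\<^sub>F x in near S q. lift_field Z (snd x) = L (\<lambda>s. Z (\<gamma> s)) x"
    and L_add: "V \<in> sections C B \<gamma> (fst q) \<Longrightarrow> W \<in> sections C B \<gamma> (fst q) \<Longrightarrow>
      \<forall>\<^sub>F x in near S q. L V x +\<^sub>T L W x = L (\<lambda>s. V s +\<^sub>T W s) x"
    and L_scale: "V \<in> sections C B \<gamma> (fst q) \<Longrightarrow>
      \<forall>\<^sub>F x in near S q. a (fst x) *\<^sub>T L V x = L (\<lambda>s. a s *\<^sub>T V s) x"
    and L_cong: "\<forall>\<^sub>F s in near C (fst q). V s = W s \<Longrightarrow> \<forall>\<^sub>F x in near S q. L V x = L W x"
proof -
  show "\<forall>\<^sub>F x in near S q. lift_field Z (snd x) = L (\<lambda>s. Z (\<gamma> s)) x"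
    using near_points by eventually_elim (simp add: lift_field_def L_def)
  show "\<forall>\<^sub>F x in near S q. L V x +\<^sub>T L W x = L (\<lambda>s. V s +\<^sub>T W s) x"
    if "V \<in> sections C B \<gamma> (fst q)" "W \<in> sections C B \<gamma> (fst q)"
    using near_curve_section[OF q that(1)] near_curve_section[OF q that(2)]
    by eventually_elim (simp add: L_def lift_add)
  show "\<forall>\<^sub>F x in near S q. a (fst x) *\<^sub>T L V x = L (\<lambda>s. a s *\<^sub>T V s) x" if "V \<in> sections C B \<gamma> (fst q)"
    using near_curve_section[OF q that] by eventually_elim (simp add: L_def lift_scale)
  show "\<forall>\<^sub>F x in near S q. L V x = L W x" if "\<forall>\<^sub>F s in near C (fst q). V s = W s"
    using fst_near[OF q that] by eventually_elim (simp add: L_def)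
qed

lemma base_section:
  "q \<in> points S \<Longrightarrow> Z \<in> fields B (\<gamma> (fst q)) \<Longrightarrow> (\<lambda>x. lift_field Z (snd x)) \<in> sections S M snd q"
  by (intro cyl.comp_section lift_field) simp_all

lemma L_section:
  assumes q: "q \<in> points S" and V: "V \<in> sections C B \<gamma> (fst q)"
  shows "L V \<in> sections S M snd q"
  using S_C[OF q] V
proof (induction V rule: curve.induct_section)
  case (base Z)
  then show ?case using cyl.X.section_cong[OF base_section L_base] q by simp
next
  case (add V W)
  then show ?case using cyl.X.section_cong[OF cyl.X.section_add L_add[OF q]] by blast
next
  case (scale a V)
  then show ?case using cyl.X.section_cong[OF cyl.X.section_scale L_scale[OF q]] fst_germ[OF q] q by blast
next
  case (cong V W)
  then show ?case using cyl.X.section_cong[OF _ L_cong[OF q]] by blast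
qed

lemma L_tangent [simp]: "q \<in> points S \<Longrightarrow> V (fst q) \<in> tangent B (\<pi> (snd q)) \<Longrightarrow> L V q \<in> tangent M (snd q)"
  by (simp add: L_def)

lemma
  assumes q: "q \<in> points S"
  shows t_tangent [simp]: "t q \<in> tangent M (snd q)" and t_section: "t \<in> sections S M snd q"
    and eta_t [simp]: "\<eta> (snd q) (t q) = 0" and t_unit [simp]: "g (snd q) (t q) (t q) = 1"
    and n_eq: "n q = \<phi> (snd q) (t q)"
proof -
  have p: "p1 (fst q) \<in> tangent B (\<pi> (snd q))" "gB (\<pi> (snd q)) (p1 (fst q)) (p1 (fst q)) = 1"
    using p1_tangent[OF S_I[OF q]] p1_unit[OF S_I[OF q]] q by simp_all
  show "t \<in> sections S M snd q" using L_section[OF q p1_section] q by simp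
  show "t q \<in> tangent M (snd q)" "\<eta> (snd q) (t q) = 0" "g (snd q) (t q) (t q) = 1"
    using p by (simp_all add: L_def metric_lift)
  show "n q = \<phi> (snd q) (t q)"
    using lift_J[OF p(1)] q by (simp add: L_def curve_p2_def)
qed

lemma
  assumes q: "q \<in> points S"
  shows n_tangent [simp]: "n q \<in> tangent M (snd q)" and eta_n [simp]: "\<eta> (snd q) (n q) = 0"
    and n_unit [simp]: "g (snd q) (n q) (n q) = 1" and metric_t_n [simp]: "g (snd q) (t q) (n q) = 0"
    and phi_t: "\<phi> (snd q) (t q) = n q" and phi_n: "\<phi> (snd q) (n q) = -1 *\<^sub>T t q"
  using q by (simp_all add: n_eq metric_phi metric_phi_self phi_phi, auto simp: tvec_defs)

lemma xi_section: "q \<in> points S \<Longrightarrow> xi \<in> sections S M snd q"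
  using cyl.comp_section[OF _ xi_field] by (simp add: o_def)

lemma D_xi:
  assumes "q \<in> points S" "w \<in> tangent S q"
  shows "D q w xi = -1 *\<^sub>T \<phi> (snd q) (push S M snd q w)"
  using cyl.conn_comp[OF assms xi_field] nabla_xi assms by (simp add: o_def)

text \<open>Differentiation of \<open>g (L V, \<xi>) = 0\<close> moves the derivative to \<xi>,
  where it is \<open>- \<phi>\<close>.\<close>

lemma eta_D_L:
  assumes q: "q \<in> points S" and w: "w \<in> tangent S q" and V: "V \<in> sections C B \<gamma> (fst q)"
  shows "\<eta> (snd q) (D q w (L V)) = g (snd q) (L V q) (\<phi> (snd q) (push S M snd q w))"
proof -
  note LV = L_section[OF q V] and T = S_push_tangent[OF q w]
  have VT: "V (fst q) \<in> tangent B (\<pi> (snd q))"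
    using section_tangent[OF V] q by simp
  have "\<forall>\<^sub>F x in near S q. g (snd x) (L V x) (xi x) = 0"
    using near_curve_section[OF q V] near_points
    by eventually_elim (simp add: metric_xi_right, simp add: L_def)
  from cyl.X.tangent_cong[OF q w this] have "w (\<lambda>x. g (snd x) (L V x) (xi x)) = 0"
    using cyl.X.tangent_const[OF q w] by simp
  then show ?thesis
    using cyl.section_metric_derivative[OF q LV xi_section[OF q] w] D_xi[OF q w] T VT q
      metric_xi_right[OF connection_tangent[OF cyl.conn q w LV]]
    by (simp add: M.metric_scale_right)
qed

text \<open>On pulled-back fields of the base this is \<open>push_nabla_lift\<close>. The last
  assumption says that \<open>w\<close> covers d/ds; it makes the derivatives of the coefficients in
  the two Leibniz rules agree.\<close>

lemma push_D_L:
  assumes q: "q \<in> points S" and V: "V \<in> sections C B \<gamma> (fst q)" and w: "w \<in> tangent S q"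
    and wt: "push S M snd q w = t q"
    and w1: "\<And>k. k \<in> germs C (fst q) \<Longrightarrow> w (\<lambda>x. k (fst x)) = d_ds (fst q) k"
  shows "push M B \<pi> (snd q) (D q w (L V)) = DB (fst q) (d_ds (fst q)) V"
  using S_C[OF q] V
proof (induction V rule: curve.induct_section)
  case (base Z)
  then have Z: "Z \<in> fields B (\<pi> (snd q))" using q by simp
  have "D q w (L (\<lambda>s. Z (\<gamma> s))) = nabla (snd q) (t q) (lift_field Z)"
    using cyl.X.connection_cong[OF cyl.conn q w base_section[OF q base] L_base[OF q]]
      cyl.conn_comp[OF q w lift_field[OF Z]] wt by simp
  then show ?case
    using push_nabla_lift[OF _ Z, of "p1 (fst q)"] p1_tangent[OF S_I[OF q]] q base
      curve.conn_comp[OF _ d_ds_tangent[OF I(1) S_I[OF q]] base]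
    by (simp add: L_def[of p1] curve_p1_def[symmetric])
next
  case (add V W)
  note LV = L_section[OF q add(1)] and LW = L_section[OF q add(2)]
  have "D q w (L (\<lambda>s. V s +\<^sub>T W s)) = D q w (L V) +\<^sub>T D q w (L W)"
    using cyl.X.connection_cong[OF cyl.conn q w cyl.X.section_add[OF LV LW] L_add[OF q add(1,2)]]
      connection_add[OF cyl.conn q w LV LW] by simp
  then show ?case
    using add connection_add[OF curve.conn _ d_ds_tangent[OF I(1) S_I[OF q]] add(1,2)] q by (simp add: push_tadd)
next
  case (scale a V)
  note LV = L_section[OF q scale(2)] and a = fst_germ[OF q scale(1)]
  have "D q w (L (\<lambda>s. a s *\<^sub>T V s)) = d_ds (fst q) a *\<^sub>T L V q +\<^sub>T a (fst q) *\<^sub>T D q w (L V)"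
    using cyl.X.connection_cong[OF cyl.conn q w cyl.X.section_scale[OF a LV q] L_scale[OF q scale(2)]]
      connection_scale[OF cyl.conn q w LV a] w1[OF scale(1)] by simp
  moreover have "V (fst q) \<in> tangent B (\<pi> (snd q))"
    using section_tangent[OF scale(2)] q by simp
  ultimately show ?case
    using scale connection_scale[OF curve.conn _ d_ds_tangent[OF I(1) S_I[OF q]] scale(2,1)] q
    by (simp add: push_tadd push_tscale L_def[of _ q])
next
  case (cong V W)
  then show ?case
    using cyl.X.connection_cong[OF cyl.conn q w L_section[OF q cong(1)] L_cong[OF q cong(2)]]
      curve.X.connection_cong[OF curve.conn _ d_ds_tangent[OF I(1) S_I[OF q]] cong(1,2)] q by simp
qed

text \<open>In the fibre direction coefficients that depend on the parameter only have derivative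
  zero, so both sides are linear over such functions; on lifts of base fields the equation is
  \<open>nabla_xi_lift\<close>.\<close>

lemma D_vertical_L:
  assumes q: "q \<in> points S" and V: "V \<in> sections C B \<gamma> (fst q)" and w: "w \<in> tangent S q"
    and wt: "push S M snd q w = \<xi> (snd q)"
    and w1: "\<And>k. k \<in> germs C (fst q) \<Longrightarrow> w (\<lambda>x. k (fst x)) = 0"
  shows "D q w (L V) = -1 *\<^sub>T \<phi> (snd q) (L V q)"
  using S_C[OF q] V
proof (induction V rule: curve.induct_section)
  case (base Z)
  then have Z: "Z \<in> fields B (\<pi> (snd q))" using q by simp
  have "D q w (L (\<lambda>s. Z (\<gamma> s))) = nabla (snd q) (\<xi> (snd q)) (lift_field Z)"
    using cyl.X.connection_cong[OF cyl.conn q w base_section[OF q base] L_base[OF q]]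
      cyl.conn_comp[OF q w lift_field[OF Z]] wt by simp
  then show ?case
    using nabla_xi_lift[OF Z] q by (simp add: L_def[of _ q])
next
  case (add V W)
  note LV = L_section[OF q add(1)] and LW = L_section[OF q add(2)]
  have T: "V (fst q) \<in> tangent B (\<pi> (snd q))" "W (fst q) \<in> tangent B (\<pi> (snd q))"
    using section_tangent[OF add(1)] section_tangent[OF add(2)] q by simp_all
  have "D q w (L (\<lambda>s. V s +\<^sub>T W s)) = D q w (L V) +\<^sub>T D q w (L W)"
    using cyl.X.connection_cong[OF cyl.conn q w cyl.X.section_add[OF LV LW] L_add[OF q add(1,2)]]
      connection_add[OF cyl.conn q w LV LW] by simp
  moreover have "\<phi> (snd q) (L (\<lambda>s. V s +\<^sub>T W s) q) = \<phi> (snd q) (L V q) +\<^sub>T \<phi> (snd q) (L W q)"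
    using T by (simp add: L_def lift_add phi_add)
  ultimately show ?case
    using add by (simp, auto simp: tvec_defs)
next
  case (scale a V)
  note LV = L_section[OF q scale(2)] and a = fst_germ[OF q scale(1)]
  have T: "V (fst q) \<in> tangent B (\<pi> (snd q))"
    using section_tangent[OF scale(2)] q by simp
  have "D q w (L (\<lambda>s. a s *\<^sub>T V s)) = a (fst q) *\<^sub>T D q w (L V)"
    using cyl.X.connection_cong[OF cyl.conn q w cyl.X.section_scale[OF a LV q] L_scale[OF q scale(2)]]
      connection_scale[OF cyl.conn q w LV a] w1[OF scale(1)] by simp
  moreover have "\<phi> (snd q) (L (\<lambda>s. a s *\<^sub>T V s) q) = a (fst q) *\<^sub>T \<phi> (snd q) (L V q)"
    using T phi_scale[of "lift (snd q) (V (fst q))" "snd q"] by (simp add: L_def lift_scale)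
  ultimately show ?case
    using scale by (simp, auto simp: tvec_defs)
next
  case (cong V W)
  then show ?case
    using cyl.X.connection_cong[OF cyl.conn q w L_section[OF q cong(1)] L_cong[OF q cong(2)]]
      near_self[OF q L_cong[OF q cong(2)]] by simp
qed

text \<open>The Sasaki identity for the derivative of \<phi>, transported from fields of
  \<open>M\<close> to sections along the immersion. Smoothness of \<open>\<phi> V\<close> is part of
  the claim because the sum and Leibniz rules for \<open>D\<close> require it in the induction
  steps.\<close>

lemma D_phi:
  assumes q: "q \<in> points S" and V: "V \<in> sections S M snd q"
  shows "(\<lambda>x. \<phi> (snd x) (V x)) \<in> sections S M snd q \<and> (\<forall>w\<in>tangent S q.
      D q w (\<lambda>x. \<phi> (snd x) (V x)) = (\<phi> (snd q) (D q w V) +\<^sub>T g (snd q) (push S M snd q w) (V q) *\<^sub>T \<xi> (snd q))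
        -\<^sub>T \<eta> (snd q) (V q) *\<^sub>T push S M snd q w)" (is "?P V")
  using q V
proof (induction V rule: cyl.induct_section)
  case (base Z)
  have "D q w (\<lambda>x. \<phi> (snd x) (Z (snd x))) = nabla (snd q) (push S M snd q w) (\<lambda>y. \<phi> y (Z y))"
    "D q w (\<lambda>x. Z (snd x)) = nabla (snd q) (push S M snd q w) Z" if "w \<in> tangent S q" for w
    using cyl.conn_comp[OF q that phi_field[OF base]] cyl.conn_comp[OF q that base] by simp_all
  then show ?case
    using cyl.comp_section[OF q phi_field[OF base]] nabla_phi[OF S_push_tangent[OF q] base]
    by (auto simp: tvec_defs fun_eq_iff algebra_simps)
next
  case (add V W)
  have ev: "\<forall>\<^sub>F x in near S q. \<phi> (snd x) (V x) +\<^sub>T \<phi> (snd x) (W x) = \<phi> (snd x) (V x +\<^sub>T W x)"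
    using section_near_tangent[OF add(1)] section_near_tangent[OF add(2)]
    by eventually_elim (simp add: phi_add)
  note T = section_tangent[OF add(1) q] section_tangent[OF add(2) q]
  have s: "(\<lambda>x. \<phi> (snd x) (V x)) \<in> sections S M snd q" "(\<lambda>x. \<phi> (snd x) (W x)) \<in> sections S M snd q"
    using add by blast+
  note s2 = cyl.X.section_add[OF s]
  have "D q w (\<lambda>x. \<phi> (snd x) (V x +\<^sub>T W x)) = (\<phi> (snd q) (D q w (\<lambda>x. V x +\<^sub>T W x))
      +\<^sub>T g (snd q) (push S M snd q w) (V q +\<^sub>T W q) *\<^sub>T \<xi> (snd q)) -\<^sub>T \<eta> (snd q) (V q +\<^sub>T W q) *\<^sub>T push S M snd q w"
    if w: "w \<in> tangent S q" for w
    unfolding cyl.X.connection_cong[OF cyl.conn q w s2 ev, symmetric] connection_add[OF cyl.conn q w s]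
      connection_add[OF cyl.conn q w add(1,2)]
    using add(3,4) w T connection_tangent[OF cyl.conn q w add(1)] connection_tangent[OF cyl.conn q w add(2)] q
    by (simp add: phi_add M.metric_add_right eta_add, auto simp: tvec_defs algebra_simps)
  then show ?case using cyl.X.section_cong[OF s2 ev] by blast
next
  case (scale a V)
  have ev: "\<forall>\<^sub>F x in near S q. a x *\<^sub>T \<phi> (snd x) (V x) = \<phi> (snd x) (a x *\<^sub>T V x)"
    using section_near_tangent[OF scale(2)]
    by eventually_elim (rule phi_scale[symmetric], simp_all)
  note T = section_tangent[OF scale(2) q]
  have s: "(\<lambda>x. \<phi> (snd x) (V x)) \<in> sections S M snd q"
    using scale by blast
  note s2 = cyl.X.section_scale[OF scale(1) s q]
  have "D q w (\<lambda>x. \<phi> (snd x) (a x *\<^sub>T V x)) = (\<phi> (snd q) (D q w (\<lambda>x. a x *\<^sub>T V x))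
      +\<^sub>T g (snd q) (push S M snd q w) (a q *\<^sub>T V q) *\<^sub>T \<xi> (snd q)) -\<^sub>T \<eta> (snd q) (a q *\<^sub>T V q) *\<^sub>T push S M snd q w"
    if w: "w \<in> tangent S q" for w
    unfolding cyl.X.connection_cong[OF cyl.conn q w s2 ev, symmetric] connection_scale[OF cyl.conn q w s scale(1)]
      connection_scale[OF cyl.conn q w scale(2,1)]
    using scale(3) w T connection_tangent[OF cyl.conn q w scale(2)] q
    by (simp add: phi_add phi_scale M.metric_scale_right eta_scale,
        auto simp: tvec_defs algebra_simps)
  then show ?case using cyl.X.section_cong[OF s2 ev] by blast
next
  case (cong V W)
  have ev: "\<forall>\<^sub>F x in near S q. \<phi> (snd x) (V x) = \<phi> (snd x) (W x)"
    using cong(2) by (auto elim: eventually_mono)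
  have s: "(\<lambda>x. \<phi> (snd x) (V x)) \<in> sections S M snd q"
    using cong by blast
  show ?case
    using cong(3) cyl.X.section_cong[OF s ev] cyl.X.connection_cong[OF cyl.conn q _ s ev, symmetric]
      cyl.X.connection_cong[OF cyl.conn q _ cong(1,2), symmetric] near_self[OF q cong(2)] by simp
qed

end

context hopf
begin

subsection \<open>The tangential fields of the frame\<close>

lemma p1_nonzero:
  assumes s: "s \<in> I"
  obtains h where "h \<in> smooth_germs AB (\<gamma> s)" "p1 s h \<noteq> 0"
proof -
  have "p1 s \<noteq> tzero"
    using p1_unit[OF s] B.metric_zero[OF _ p1_tangent[OF s]] by auto
  then obtain h where "p1 s h \<noteq> 0" by (auto simp: tzero_def fun_eq_iff)
  then show ?thesis
    using that tangent_zero[OF p1_tangent[OF s]] by auto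
qed

text \<open>The immersion \<open>snd\<close> is injective on tangent vectors because \<open>\<gamma>\<close> is regular: the component
  along the parameter is determined by \<open>h \<circ> \<pi> \<circ> snd = h \<circ> \<gamma> \<circ> fst\<close>.\<close>
lemma snd_immersion:
  assumes q: "q \<in> points S" and w: "w \<in> tangent S q" and wz: "push S M snd q w = tzero"
  shows "w = tzero"
proof -
  obtain U \<phi>c where U: "(U, \<phi>c) \<in> A" "snd q \<in> U" using atlas_cover[OF A] .
  let ?\<phi> = "\<lambda>(s::real, p). (s, \<phi>c p)" and ?U = "UNIV \<times> U :: (real \<times> 'm) set"
  note pA = smooth_atlas_prod[OF A] and pc = prod_chart[OF A U(1)]
  have qU: "q \<in> ?U" using U by (simp add: mem_Times_iff)
  let ?d = "coord_field (prod_atlas A) ?U ?\<phi> (1, 0) q"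
  \<comment> \<open>Zero image under \<open>snd\<close> makes the components of \<open>w\<close>
    along the chart of \<open>M\<close> vanish, so only the parameter component \<open>w fst\<close>
    is left.\<close>
  have w_eq: "w F = w fst * ?d F" if F: "F \<in> smooth_germs (prod_atlas A) q" for F
  proof -
    have "w F = (\<Sum>b\<in>Basis. w (coord ?\<phi> b) * coord_field (prod_atlas A) ?U ?\<phi> b q F)"
      using tangent_submfd_expansion[OF pA pc qU _ _ F, where S = "{(s, p). s \<in> I \<and> \<pi> p = \<gamma> s}" and v = w] w q
      unfolding hopf_cylinder_def by simp
    also have "\<dots> = (\<Sum>b\<in>{(1, 0)}. w (coord ?\<phi> b) * coord_field (prod_atlas A) ?U ?\<phi> b q F)"
    proof (rule sum.mono_neutral_right)
      show "\<forall>b\<in>Basis - {(1, 0)}. w (coord ?\<phi> b) * coord_field (prod_atlas A) ?U ?\<phi> b q F = 0"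
      proof
        fix b :: "real \<times> 'e" assume "b \<in> Basis - {(1, 0)}"
        then obtain c where b: "b = (0, c)" by (auto simp: Basis_prod_def)
        have "w (\<lambda>x. coord \<phi>c c (snd x)) = push S M snd q w (coord \<phi>c c)"
          using coord_germ[OF A U] by (simp add: push_apply)
        then show "w (coord ?\<phi> b) * coord_field (prod_atlas A) ?U ?\<phi> b q F = 0"
          by (simp add: b coord_prod wz tzero_def)
      qed
    qed (auto simp: Basis_prod_def)
    finally show ?thesis by (simp add: coord_prod)
  qed
  obtain h where h: "h \<in> smooth_germs AB (\<gamma> (fst q))" "p1 (fst q) h \<noteq> 0"
    using p1_nonzero[OF S_I[OF q]] .
  let ?k = "\<lambda>s. h (\<gamma> s)"
  have k: "?k \<in> smooth_germs real_atlas (fst q)"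
    using smooth_map_germs[OF curve_smooth, of "fst q" h] h(1) germs_interval[OF I(1) S_I[OF q]] q by simp
  have kF: "(\<lambda>x. ?k (fst x)) \<in> smooth_germs (prod_atlas A) q"
    using smooth_germs_fst[OF A k, of "snd q"] by simp
  have "?d (\<lambda>x. ?k (fst x)) = fst (1, 0 :: 'e) * d_ds (fst q) ?k"
  proof (rule coord_field_eqI[OF pA pc qU kF])
    have "((\<lambda>y. ?k (fst y)) has_derivative (\<lambda>v. fst v * d_ds (fst q) ?k)) (at (?\<phi> q))"
    proof -
      have "(?k has_derivative (\<lambda>v. v * d_ds (fst q) ?k)) (at (fst (?\<phi> q)))"
        using real_germ_derivative[OF k]
        by (simp add: has_field_derivative_def case_prod_beta mult_commute_abs)
      from has_derivative_compose[OF bounded_linear_imp_has_derivative[OF bounded_linear_fst] this]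
      show ?thesis .
    qed
    then show "((\<lambda>y. ?k (fst (inv_into ?U ?\<phi> y))) has_derivative (\<lambda>v. fst v * d_ds (fst q) ?k)) (at (?\<phi> q))"
    proof (rule has_derivative_transform_within_open[of _ _ _ UNIV "UNIV \<times> \<phi>c ` U"])
      show "open (UNIV \<times> \<phi>c ` U :: (real \<times> 'e) set)"
        using atlas_open_image[OF A U(1)] by (intro open_Times) simp
    qed (use U(2) in \<open>auto simp: case_prod_beta inv_into_prod[OF A U(1)]\<close>)
  qed
  then have d: "?d (\<lambda>x. ?k (fst x)) \<noteq> 0"
    using h(2) by (simp add: p1_apply[OF h(1)])
  \<comment> \<open>On the cylinder the function \<open>?k\<close> of the parameter is also a
    function of the point of \<open>M\<close>, hence killed by \<open>w\<close>; as its parameter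
    derivative is nonzero, \<open>w fst\<close> must be 0.\<close>
  have "\<forall>\<^sub>F x in near S q. ?k (fst x) = h (\<pi> (snd x))"
    using near_points by eventually_elim simp
  from cyl.X.tangent_cong[OF q w this]
  have "w (\<lambda>x. ?k (fst x)) = push S M snd q w (\<lambda>y. h (\<pi> y))"
    using pi_germ[of h "snd q"] h(1) q by (simp add: push_apply)
  then have "w fst = 0"
    using w_eq[OF kF] d by (simp add: wz tzero_def)
  then have wF: "w F = 0" if "F \<in> smooth_germs (prod_atlas A) q" for F
    using w_eq[OF that] by simp
  show ?thesis
  proof
    fix f
    show "w f = tzero f"
    proof (cases "f \<in> germs S q")
      case True
      then obtain F where F: "F \<in> smooth_germs (prod_atlas A) q" "\<forall>\<^sub>F x in near S q. f x = F x"
        unfolding hopf_cylinder_def germs_submfd by blast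
      then show ?thesis using cyl.X.tangent_cong[OF q w F(2)] wF by (simp add: tzero_def)
    qed (simp add: tangent_zero[OF w] tzero_def)
  qed
qed

lemma tangential_eqI:
  assumes q: "q \<in> points S" and w: "w \<in> tangent S q" and V: "push S M snd q w = V q"
  shows "tangential S M V q = w"
  unfolding tangential_def
proof (rule the_equality)
  fix w' assume w': "w' \<in> tangent S q \<and> push S M snd q w' = V q"
  then have "w' -\<^sub>T w = tzero"
    using cyl.X.tangent_tdiff[of w' q w] w V by (intro snd_immersion[OF q]) (auto simp: push_tdiff)
  then show "w' = w" by (auto simp: tvec_defs fun_eq_iff)
qed (use w V in simp)

text \<open>The vector is the velocity of the flow line through \<open>snd q\<close> at fixed
  parameter. This curve stays in the cylinder because \<pi> is constant on orbits, and functions of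
  the parameter are constant along it.\<close>

lemma vertical_vector:
  assumes q: "q \<in> points S"
  obtains w where "w \<in> tangent S q" "push S M snd q w = \<xi> (snd q)"
    "\<And>k. (\<lambda>x. k (fst x)) \<in> germs S q \<Longrightarrow> w (\<lambda>x. k (fst x)) = 0"
proof -
  obtain s p where sp: "q = (s, p)" by (cases q)
  define c where "c u = (s, \<Phi> u p)" for u
  have c0: "c 0 = q" by (simp add: c_def sp)
  let ?S = "{(s, p). s \<in> I \<and> \<pi> p = \<gamma> s}"
  have "\<pi> (\<Phi> u p) = \<pi> p" for u using pi_fibre by metis
  then have cS: "\<forall>\<^sub>F u in nhds 0. c u \<in> ?S"
    using q by (simp add: c_def points_S sp)
  have diff: "\<exists>d. ((\<lambda>u. F (c u)) has_real_derivative d) (at 0)" if "F \<in> smooth_germs (prod_atlas A) (c 0)" for F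
    using flow_derivative[OF smooth_germs_slice[OF A that[unfolded c0 sp]]] by (auto simp: c_def)
  note pA = smooth_atlas_prod[OF A]
  let ?w = "velocity S c 0"
  have w: "?w \<in> tangent S q"
    using velocity_tangent[OF pA cS diff] by (simp add: hopf_cylinder_def c0)
  have d: "((\<lambda>u. h (c u)) has_real_derivative ?w h) (at 0)" if "h \<in> germs S q" for h
    using velocity_derivative[OF pA cS diff] that by (simp add: hopf_cylinder_def c0)
  show ?thesis
  proof (rule that[OF w])
    show "push S M snd q ?w = \<xi> (snd q)"
    proof (rule tangent_eqI)
      fix h assume h: "h \<in> germs M (snd q)"
      have "((\<lambda>u. h (\<Phi> u p)) has_real_derivative ?w (\<lambda>x. h (snd x))) (at 0)"
        using d[OF smooth_map_germs[OF snd_smooth q h]] by (simp add: c_def)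
      moreover have "((\<lambda>u. h (\<Phi> u p)) has_real_derivative \<xi> (snd q) h) (at 0)"
        using flow_derivative[of h p] h by (simp add: sp)
      ultimately show "push S M snd q ?w h = \<xi> (snd q) h"
        using DERIV_unique h by (metis push_apply)
    qed (use w q in simp_all)
    show "?w (\<lambda>x. k (fst x)) = 0" if "(\<lambda>x. k (fst x)) \<in> germs S q" for k
      using d[OF that] DERIV_unique[OF _ DERIV_const] by (simp add: c_def)
  qed
qed

text \<open>The lift of \<gamma> given by \<open>curve_lift\<close> runs in the cylinder with
  parameter speed 1, and its velocity projects to \<open>p1\<close>, but it need not be horizontal;
  the vertical component is subtracted. The last clause extracts differentiability of
  \<open>k\<close> from smoothness of \<open>k \<circ> fst\<close> on the cylinder.\<close>

lemma horizontal_vector: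
  assumes q: "q \<in> points S"
  obtains w where "w \<in> tangent S q" "push S M snd q w = t q"
    "\<And>k. (\<lambda>x. k (fst x)) \<in> germs S q \<Longrightarrow> (k has_real_derivative w (\<lambda>x. k (fst x))) (at (fst q))"
proof -
  obtain s p where sp: "q = (s, p)" by (cases q)
  have s: "s \<in> I" "\<pi> p = \<gamma> s" using q by (auto simp: points_S sp)
  obtain c where c: "c s = p" "\<forall>\<^sub>F r in nhds s. \<pi> (c r) = \<gamma> r"
    and cd: "\<And>F. F \<in> smooth_germs (prod_atlas A) (s, p) \<Longrightarrow> \<exists>d. ((\<lambda>r. F (r, c r)) has_real_derivative d) (at s)"
    by (rule curve_lift[OF I(1) s(1) curve_smooth s(2)]) (rule that)
  let ?c = "\<lambda>r. (r, c r)" and ?S = "{(s, p). s \<in> I \<and> \<pi> p = \<gamma> s}"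
  have cS: "\<forall>\<^sub>F r in nhds s. ?c r \<in> ?S"
    using c(2) eventually_nhds_in_open[OF I(1) s(1)] by eventually_elim simp
  have diff: "\<exists>d. ((\<lambda>u. F (?c u)) has_real_derivative d) (at s)" if "F \<in> smooth_germs (prod_atlas A) (?c s)" for F
    using cd that c(1) by simp
  note pA = smooth_atlas_prod[OF A]
  let ?v = "velocity S ?c s"
  have v: "?v \<in> tangent S q"
    using velocity_tangent[OF pA cS diff] by (simp add: hopf_cylinder_def c sp)
  have d: "((\<lambda>u. h (?c u)) has_real_derivative ?v h) (at s)" if "h \<in> germs S q" for h
    using velocity_derivative[OF pA cS diff] that by (simp add: hopf_cylinder_def c sp)
  let ?u = "push S M snd q ?v"
  have u: "?u \<in> tangent M p" using S_push_tangent[OF q v] by (simp add: sp)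
  have "push M B \<pi> p ?u = p1 s"
  proof (rule tangent_eqI)
    show "push M B \<pi> p ?u \<in> tangent B (\<gamma> s)" "p1 s \<in> tangent B (\<gamma> s)"
      using push_pi_tangent[OF u] p1_tangent[OF s(1)] s by simp_all
    fix h assume "h \<in> germs B (\<gamma> s)"
    then have h: "h \<in> smooth_germs AB (\<pi> p)" "h \<in> smooth_germs AB (\<gamma> s)" using s by simp_all
    have "(\<lambda>x. h (\<pi> (snd x))) \<in> germs S q"
      using smooth_map_germs[OF snd_smooth q, of "\<lambda>y. h (\<pi> y)"] pi_germ[OF h(1)] by (simp add: sp)
    from d[OF this] have "((\<lambda>r. h (\<pi> (c r))) has_real_derivative ?v (\<lambda>x. h (\<pi> (snd x)))) (at s)" by simp
    moreover have ev: "\<forall>\<^sub>F r in nhds s. h (\<pi> (c r)) = h (\<gamma> r)"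
      using c(2) by (auto elim: eventually_mono)
    ultimately have "((\<lambda>r. h (\<gamma> r)) has_real_derivative ?v (\<lambda>x. h (\<pi> (snd x)))) (at s)"
      using DERIV_cong_ev[OF refl ev refl] by blast
    moreover have "((\<lambda>r. h (\<gamma> r)) has_real_derivative p1 s h) (at s)"
      using smooth_map_germs[OF curve_smooth, of s h] h(2) s(1) germs_interval[OF I(1) s(1)]
      by (simp add: p1_apply[OF h(2)] real_germ_derivative)
    ultimately have "?v (\<lambda>x. h (\<pi> (snd x))) = p1 s h" by (rule DERIV_unique)
    then show "push M B \<pi> p ?u h = p1 s h"
      using h(1) pi_germ[OF h(1)] by (simp add: push_apply sp)
  qed
  then have tq: "t q = ?u -\<^sub>T \<eta> p ?u *\<^sub>T \<xi> p"
    using lift_push[OF u] by (simp add: L_def sp)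
  obtain w where w: "w \<in> tangent S q" "push S M snd q w = \<xi> (snd q)"
    "\<And>k. (\<lambda>x. k (fst x)) \<in> germs S q \<Longrightarrow> w (\<lambda>x. k (fst x)) = 0"
    by (rule vertical_vector[OF q]) (rule that)
  show ?thesis
  proof (rule that[of "?v -\<^sub>T \<eta> p ?u *\<^sub>T w"])
    show "?v -\<^sub>T \<eta> p ?u *\<^sub>T w \<in> tangent S q"
      using cyl.X.tangent_tdiff[OF v cyl.X.tangent_tscale[OF w(1,1)]] .
    show "push S M snd q (?v -\<^sub>T \<eta> p ?u *\<^sub>T w) = t q"
      by (simp add: push_tdiff push_tscale w(2) tq) (simp add: sp)
    fix k assume k: "(\<lambda>x. k (fst x)) \<in> germs S q"
    then show "(k has_real_derivative (?v -\<^sub>T \<eta> p ?u *\<^sub>T w) (\<lambda>x. k (fst x))) (at (fst q))"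
      using d[OF k] w(3)[OF k] by (simp add: tvec_defs sp)
  qed
qed

abbreviation T where "T \<equiv> tangential S M t"
abbreviation X where "X \<equiv> tangential S M xi"

lemma
  assumes q: "q \<in> points S"
  shows T_tangent: "T q \<in> tangent S q" and push_T: "push S M snd q (T q) = t q"
    and T_fst: "\<And>k. (\<lambda>x. k (fst x)) \<in> germs S q \<Longrightarrow> (k has_real_derivative T q (\<lambda>x. k (fst x))) (at (fst q))"
proof -
  obtain w where w: "w \<in> tangent S q" "push S M snd q w = t q"
    "\<And>k. (\<lambda>x. k (fst x)) \<in> germs S q \<Longrightarrow> (k has_real_derivative w (\<lambda>x. k (fst x))) (at (fst q))"
    by (rule horizontal_vector[OF q]) (rule that)
  with tangential_eqI[OF q w(1), of t]
  show "T q \<in> tangent S q" "push S M snd q (T q) = t q"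
    "\<And>k. (\<lambda>x. k (fst x)) \<in> germs S q \<Longrightarrow> (k has_real_derivative T q (\<lambda>x. k (fst x))) (at (fst q))"
    by simp_all
qed

lemma
  assumes q: "q \<in> points S"
  shows X_tangent: "X q \<in> tangent S q" and push_X: "push S M snd q (X q) = \<xi> (snd q)"
    and X_fst: "\<And>k. (\<lambda>x. k (fst x)) \<in> germs S q \<Longrightarrow> X q (\<lambda>x. k (fst x)) = 0"
proof -
  obtain w where w: "w \<in> tangent S q" "push S M snd q w = \<xi> (snd q)"
    "\<And>k. (\<lambda>x. k (fst x)) \<in> germs S q \<Longrightarrow> w (\<lambda>x. k (fst x)) = 0"
    by (rule vertical_vector[OF q]) (rule that)
  with tangential_eqI[OF q w(1), of xi]
  show "X q \<in> tangent S q" "push S M snd q (X q) = \<xi> (snd q)"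
    "\<And>k. (\<lambda>x. k (fst x)) \<in> germs S q \<Longrightarrow> X q (\<lambda>x. k (fst x)) = 0"
    by simp_all
qed

lemma T_d_ds:
  assumes q: "q \<in> points S" and k: "k \<in> germs C (fst q)"
  shows "T q (\<lambda>x. k (fst x)) = d_ds (fst q) k"
  using DERIV_unique[OF T_fst[OF q fst_germ[OF q k]] real_germ_derivative]
    k germs_interval[OF I(1) S_I[OF q]] by blast

text \<open>In a product chart the components of \<open>T\<close> are the constant 1 and the chart
  components of \<open>t\<close>, all smooth on the cylinder.\<close>

lemma T_field:
  assumes q: "q \<in> points S" shows "T \<in> fields S q"
proof -
  obtain U \<phi>c where U: "(U, \<phi>c) \<in> A" "snd q \<in> U" using atlas_cover[OF A] .
  let ?\<phi> = "\<lambda>(s::real, p). (s, \<phi>c p)"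
  show ?thesis
    unfolding hopf_cylinder_def
  proof (rule field_submfdI[OF smooth_atlas_prod[OF A] prod_chart[OF A U(1)]], unfold hopf_cylinder_def[symmetric])
    show "q \<in> UNIV \<times> U" using U(2) by (simp add: mem_Times_iff)
    show "q \<in> {(s, p). s \<in> I \<and> \<pi> p = \<gamma> s}" using q unfolding points_S by (simp add: case_prod_beta)
    show "\<forall>\<^sub>F x in near S q. T x \<in> tangent S x"
      using near_points by eventually_elim (rule T_tangent)
    fix b :: "real \<times> 'e" assume "b \<in> Basis"
    then consider "b = (1, 0)" | c where "b = (0, c)" by (auto simp: Basis_prod_def)
    then show "(\<lambda>x. T x (coord ?\<phi> b)) \<in> germs S q"
    proof cases
      case 1
      have id: "(\<lambda>s. s) \<in> germs C r" if "r \<in> I" for r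
        using smooth_germs_restrict[of "\<lambda>s. s" real_atlas r I] smooth_germs_real
          smooth_on_bounded_linear[OF open_UNIV bounded_linear_ident] by blast
      have "\<forall>\<^sub>F x in near S q. 1 = T x fst"
        using near_points
      proof eventually_elim
        case (elim x)
        then show ?case
          using DERIV_unique[OF T_fst[OF elim fst_germ[OF elim id]] DERIV_ident] by simp
      qed
      from cyl.X.germ_cong[OF q cyl.X.germ_const[OF q] this] show ?thesis
        by (simp add: 1 coord_prod)
    next
      case 2
      have ch: "coord \<phi>c c \<in> smooth_germs A (snd q)" using coord_germ[OF A U] .
      have "\<forall>\<^sub>F x in near S q. coord \<phi>c c \<in> germs M (snd x)"
        using smooth_map_near[OF S_structure M.smooth_structure_axioms snd_smooth q M.germ_near] ch by simp
      then have "\<forall>\<^sub>F x in near S q. t x (coord \<phi>c c) = T x (\<lambda>y. coord \<phi>c c (snd y))"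
        using near_points by eventually_elim (metis push_T push_apply)
      from cyl.X.germ_cong[OF q section_germ[OF t_section[OF q] q] this] ch show ?thesis
        by (simp add: 2 coord_prod)
    qed
  qed
qed

subsection \<open>The frame equations\<close>

lemma n_near: "q \<in> points S \<Longrightarrow> \<forall>\<^sub>F x in near S q. \<phi> (snd x) (t x) = n x"
  using near_points[of S] by (rule eventually_mono) (simp add: n_eq)

lemma n_section: "q \<in> points S \<Longrightarrow> n \<in> sections S M snd q"
  using cyl.X.section_cong[OF conjunct1[OF D_phi[OF _ t_section]] n_near] by blast

lemma D_n:
  assumes q: "q \<in> points S" and w: "w \<in> tangent S q"
  shows "D q w n = \<phi> (snd q) (D q w t) +\<^sub>T g (snd q) (push S M snd q w) (t q) *\<^sub>T \<xi> (snd q)"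
  using D_phi[OF q t_section[OF q]] cyl.X.connection_cong[OF cyl.conn q w _ n_near[OF q]] w q
  by simp

text \<open>The \<open>T\<close>-derivative of \<open>t\<close> is horizontal and projects to the
  acceleration, hence it is the lift of \<open>\<kappa> p2\<close>; the \<open>X\<close>-derivative
  of \<open>t\<close> comes from \<open>D_vertical_L\<close>. Those of \<open>n = \<phi> t\<close>
  follow by \<open>D_n\<close>, and those of \<open>xi\<close> by \<open>D_xi\<close>.\<close>

lemma
  assumes q: "q \<in> points S"
  shows D_T_t: "D q (T q) t = \<kappa> (fst q) *\<^sub>T n q"
    and D_T_n: "D q (T q) n = - \<kappa> (fst q) *\<^sub>T t q +\<^sub>T \<xi> (snd q)"
    and D_T_xi: "D q (T q) xi = -1 *\<^sub>T n q"
    and D_X_t: "D q (X q) t = -1 *\<^sub>T n q"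
    and D_X_n: "D q (X q) n = t q"
    and D_X_xi: "D q (X q) xi = tzero"
proof -
  note s = S_I[OF q]
  have a: "acc (fst q) \<in> tangent B (\<pi> (snd q))" "p2 (fst q) \<in> tangent B (\<pi> (snd q))"
    using acc_tangent[OF s] p2_tangent[OF s] q by simp_all
  have "lift (snd q) (acc (fst q)) = D q (T q) t"
  proof (rule lift_eqI)
    show "D q (T q) t \<in> tangent M (snd q)"
      using connection_tangent[OF cyl.conn q T_tangent[OF q] t_section[OF q]] .
    show "\<eta> (snd q) (D q (T q) t) = 0"
      using eta_D_L[OF q T_tangent[OF q] p1_section[OF s]] push_T[OF q] q by (simp add: phi_t)
    show "push M B \<pi> (snd q) (D q (T q) t) = acc (fst q)"
      using push_D_L[OF q p1_section[OF s] T_tangent[OF q] push_T[OF q] T_d_ds[OF q]] by (simp add: acc_def)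
  qed
  then show 1: "D q (T q) t = \<kappa> (fst q) *\<^sub>T n q"
    using acc_eq[OF s] a by (simp add: lift_scale L_def[of _ q])
  show 2: "D q (X q) t = -1 *\<^sub>T n q"
    using D_vertical_L[OF q p1_section[OF s] X_tangent[OF q] push_X[OF q] X_fst[OF q fst_germ[OF q]]]
    unfolding phi_t[OF q] .
  note ps = phi_scale[OF n_tangent[OF q]]
  show "D q (T q) n = - \<kappa> (fst q) *\<^sub>T t q +\<^sub>T \<xi> (snd q)"
    unfolding D_n[OF q T_tangent[OF q]] 1 push_T[OF q] ps phi_n[OF q] t_unit[OF q] by (auto simp: tvec_defs)
  show "D q (X q) n = t q"
    unfolding D_n[OF q X_tangent[OF q]] 2 push_X[OF q] ps phi_n[OF q] metric_xi[OF t_tangent[OF q]] eta_t[OF q]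
    by (auto simp: tvec_defs)
  show "D q (T q) xi = -1 *\<^sub>T n q" "D q (X q) xi = tzero"
    using D_xi[OF q T_tangent[OF q]] D_xi[OF q X_tangent[OF q]] push_T[OF q] push_X[OF q] phi_t[OF q] by simp_all
qed

subsection \<open>The Laplacian of the mean curvature vector field\<close>

abbreviation H where "H \<equiv> mean_curvature S M g D t xi n"
abbreviation HH where "HH \<equiv> (\<lambda>q. H q *\<^sub>T n q)"
abbreviation H' where "H' \<equiv> (\<lambda>q. T q H)"

text \<open>Only the \<open>t\<close>-term contributes, since the fibres are geodesics of
  \<open>M\<close> (\<open>D_X_xi\<close>).\<close>

lemma H_eq: "q \<in> points S \<Longrightarrow> H q = \<kappa> (fst q) / 2"
  by (simp add: mean_curvature_def D_T_t D_X_xi M.metric_scale_left M.metric_zero)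

lemma H_near: "\<forall>\<^sub>F x in near S q. H x = \<kappa> (fst x) / 2"
  using near_points by eventually_elim (rule H_eq)

text \<open>Smoothness comes from writing \<open>H\<close> as half the inner product of the sections
  \<open>D x (T x) t\<close> and \<open>n\<close>; the first is smooth because \<open>T\<close> is a
  smooth field.\<close>

lemma H_germ:
  assumes q: "q \<in> points S" shows "H \<in> germs S q"
proof -
  have "(\<lambda>x. D x (T x) t) \<in> sections S M snd q"
    using connection_section[OF cyl.conn q T_field[OF q] t_section[OF q]] .
  from cyl.section_metric_germ[OF q this n_section[OF q]]
  have 1: "(\<lambda>x. g (snd x) (D x (T x) t) (n x)) \<in> germs S q" .
  have 2: "\<forall>\<^sub>F x in near S q. 1 / 2 * g (snd x) (D x (T x) t) (n x) = H x"
    using near_points by eventually_elim (simp add: H_eq D_T_t M.metric_scale_left)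
  show ?thesis using cyl.X.germ_cong[OF q cyl.X.germ_cmult[OF q 1] 2] .
qed

lemma H'_germ: "q \<in> points S \<Longrightarrow> H' \<in> germs S q"
  using section_germ[OF T_field, of q H] H_germ by simp

text \<open>Differentiability of \<kappa> along the curve is deduced on the cylinder, where
  \<open>H\<close> is smooth and equals half of \<open>\<kappa> \<circ> fst\<close>.\<close>

lemma kappa_derivative:
  assumes q: "q \<in> points S" shows "((\<lambda>s. \<kappa> s / 2) has_real_derivative H' q) (at (fst q))"
  using T_fst[OF q, of "\<lambda>s. \<kappa> s / 2"] cyl.X.germ_cong[OF q H_germ[OF q] H_near]
    cyl.X.tangent_cong[OF q T_tangent[OF q] H_near] by simp

lemma X_H: "q \<in> points S \<Longrightarrow> X q H = 0"
  using X_fst[of q "\<lambda>s. \<kappa> s / 2"] cyl.X.germ_cong[OF _ H_germ H_near]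
    cyl.X.tangent_cong[OF _ X_tangent H_near] by simp

lemma frame_coefficients:
  assumes q: "q \<in> points S"
  shows "g (snd q) ((a *\<^sub>T n q +\<^sub>T b *\<^sub>T t q) +\<^sub>T c *\<^sub>T \<xi> (snd q)) (n q) = a"
    "g (snd q) ((a *\<^sub>T n q +\<^sub>T b *\<^sub>T t q) +\<^sub>T c *\<^sub>T \<xi> (snd q)) (\<xi> (snd q)) = c"
  using q by (simp_all add: M.metric_add_left M.metric_scale_left metric_xi metric_xi_right eta_add eta_scale)

text \<open>The first \<open>T\<close>-derivative of \<open>H n\<close> is
  \<open>H' n - 2 H^2 t + H \<xi>\<close>. In the second one, \<xi> receives \<open>H'\<close> both
  from \<open>H' n\<close> and from \<open>H \<xi>\<close>; \<open>t\<close> receives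
  \<open>- 2 H H'\<close> from turning \<open>n\<close> and \<open>- 4 H H'\<close> from the
  coefficient \<open>- 2 H^2\<close>; \<open>n\<close> receives \<open>H''\<close>,
  \<open>- 4 H^3\<close> and \<open>- H\<close>. The fibre direction adds another
  \<open>- H n\<close>, and the sign of the Laplacian reverses everything.\<close>

lemma laplacian_HH:
  assumes q: "q \<in> points S"
  shows "frame_laplacian S M D t xi HH q =
    ((4 * H q ^ 3 + 2 * H q - T q H') *\<^sub>T n q +\<^sub>T (6 * H q * H' q) *\<^sub>T t q) +\<^sub>T (- 2 * H' q) *\<^sub>T \<xi> (snd q)"
proof -
  note TT = T_tangent[OF q] and XT = X_tangent[OF q]
  note n = n_section[OF q] and ts = t_section[OF q] and x = xi_section[OF q] and h = H_germ[OF q] and h' = H'_germ[OF q]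
  have h2: "(\<lambda>x. - 2 * (H x * H x)) \<in> germs S q"
    using cyl.X.germ_cmult[OF q cyl.X.germ_mult[OF q h h]] .
  have Th2: "T q (\<lambda>x. - 2 * (H x * H x)) = - 4 * H q * H' q"
    using cyl.X.tangent_cmult[OF q TT cyl.X.germ_mult[OF q h h], of "-2"] tangent_mult[OF TT h h] by simp
  \<comment> \<open>The coefficient of \<open>t\<close> is \<open>- H \<kappa>\<close>, written as
    \<open>- 2 H^2\<close> so that it is visibly a germ on the cylinder.\<close>
  let ?V = "\<lambda>x. (H' x *\<^sub>T n x +\<^sub>T (- 2 * (H x * H x)) *\<^sub>T t x) +\<^sub>T H x *\<^sub>T xi x"
  note s1 = cyl.X.section_scale[OF h' n q] and s2 = cyl.X.section_scale[OF h2 ts q] and s3 = cyl.X.section_scale[OF h x q]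
  note s12 = cyl.X.section_add[OF s1 s2]
  have "\<forall>\<^sub>F x in near S q. ?V x = D x (T x) HH"
    using near_points
  proof eventually_elim
    case (elim y)
    show ?case
      unfolding connection_scale[OF cyl.conn elim T_tangent[OF elim] n_section[OF elim] H_germ[OF elim]] D_T_n[OF elim]
      by (auto simp: H_eq[OF elim] tvec_defs algebra_simps)
  qed
  from cyl.X.connection_cong[OF cyl.conn q TT cyl.X.section_add[OF s12 s3] this]
  have 1: "D q (T q) (\<lambda>x. D x (T x) HH) = ((T q H' *\<^sub>T n q +\<^sub>T H' q *\<^sub>T (- \<kappa> (fst q) *\<^sub>T t q +\<^sub>T \<xi> (snd q)))
      +\<^sub>T ((- 4 * H q * H' q) *\<^sub>T t q +\<^sub>T (- 2 * (H q * H q)) *\<^sub>T (\<kappa> (fst q) *\<^sub>T n q)))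
      +\<^sub>T (H' q *\<^sub>T xi q +\<^sub>T H q *\<^sub>T (-1 *\<^sub>T n q))"
    unfolding connection_add[OF cyl.conn q TT s12 s3] connection_add[OF cyl.conn q TT s1 s2]
      connection_scale[OF cyl.conn q TT n h'] connection_scale[OF cyl.conn q TT ts h2]
      connection_scale[OF cyl.conn q TT x h] Th2 D_T_t[OF q] D_T_n[OF q] D_T_xi[OF q] by simp
  have "\<forall>\<^sub>F x in near S q. H x *\<^sub>T t x = D x (X x) HH"
    using near_points
  proof eventually_elim
    case (elim y)
    show ?case
      unfolding connection_scale[OF cyl.conn elim X_tangent[OF elim] n_section[OF elim] H_germ[OF elim]] D_X_n[OF elim] X_H[OF elim]
      by simp
  qed
  from cyl.X.connection_cong[OF cyl.conn q XT cyl.X.section_scale[OF h ts q] this]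
  have 2: "D q (X q) (\<lambda>x. D x (X x) HH) = H q *\<^sub>T (-1 *\<^sub>T n q)"
    unfolding connection_scale[OF cyl.conn q XT ts h] D_X_t[OF q] X_H[OF q] by simp
  have k: "\<kappa> (fst q) = 2 * H q" using H_eq[OF q] by simp
  show ?thesis
    unfolding frame_laplacian_def 1 2 k
    by (auto simp: tvec_defs algebra_simps power3_eq_cube)
qed

text \<open>\<open>H n\<close> has no \<xi>-component, whereas its Laplacian has
  \<open>- 2 H'\<close>. So \<open>H'\<close> vanishes whatever the eigenvalue, and \<kappa> is
  constant because the parameter domain is connected.\<close>

lemma eigen_imp_constant:
  assumes l: "\<And>q. q \<in> points S \<Longrightarrow> frame_laplacian S M D t xi HH q = l *\<^sub>T HH q"
  obtains k where "\<And>s. s \<in> I \<Longrightarrow> \<kappa> s = k"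
proof -
  have z: "H' q = 0" if q: "q \<in> points S" for q
  proof -
    have "g (snd q) (l *\<^sub>T HH q) (\<xi> (snd q)) = 0"
      using q by (simp add: metric_xi_right eta_scale)
    moreover have "g (snd q) (l *\<^sub>T HH q) (\<xi> (snd q)) = - 2 * H' q"
      unfolding l[OF q, symmetric] laplacian_HH[OF q] by (rule frame_coefficients(2)[OF q])
    ultimately show ?thesis by simp
  qed
  have "((\<lambda>s. \<kappa> s / 2) has_real_derivative 0) (at s within I)" if "s \<in> I" for s
  proof -
    obtain q where q: "q \<in> points S" "fst q = s" using point_over \<open>s \<in> I\<close> by blast
    then show ?thesis
      using kappa_derivative[OF q(1)] z[OF q(1)] by (simp add: has_field_derivative_at_within)
  qed
  from has_field_derivative_zero_constant[OF _ this] obtain c where "\<And>s. s \<in> I \<Longrightarrow> \<kappa> s / 2 = c"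
    using I(2) is_interval_convex by blast
  then show ?thesis using that[of "2 * c"] by force
qed

text \<open>With constant \<open>H = k / 2\<close> the derivative terms drop out and
  \<open>4 H^3 + 2 H = (k^2 + 2) H\<close>. The value \<open>k = 0\<close> is included; both sides
  vanish then.\<close>

lemma constant_imp_eigen:
  assumes k: "\<And>s. s \<in> I \<Longrightarrow> \<kappa> s = k" and q: "q \<in> points S"
  shows "frame_laplacian S M D t xi HH q = (k\<^sup>2 + 2) *\<^sub>T HH q"
proof -
  have H: "H x = k / 2" if "x \<in> points S" for x
    using H_eq[OF that] k[OF S_I[OF that]] by simp
  have const: "T y f = 0" if y: "y \<in> points S" and f: "\<And>x. x \<in> points S \<Longrightarrow> f x = c" for y f c
  proof -
    have "\<forall>\<^sub>F x in near S y. f x = c"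
      using near_points by eventually_elim (rule f)
    then show ?thesis
      using cyl.X.tangent_cong[OF y T_tangent[OF y]] cyl.X.tangent_const[OF y T_tangent[OF y], of c] by simp
  qed
  have z: "H' y = 0" if "y \<in> points S" for y
    using const[OF that H] .
  have z2: "T q H' = 0"
    using const[OF q z] .
  show ?thesis
    unfolding laplacian_HH[OF q] z[OF q] z2 H[OF q]
    by (auto simp: tvec_defs power2_eq_square power3_eq_cube field_simps)
qed

section \<open>Geodesics, circles and the eigenvalue\<close>

lemma geodesic_iff: "geodesic B I \<gamma> DB \<longleftrightarrow> (\<forall>s\<in>I. \<kappa> s = 0)"
  using acc_zero_iff by (auto simp: geodesic_def acc_def)

lemma circle_iff: "riemannian_circle B J I \<gamma> DB \<longleftrightarrow> (\<exists>k. k \<noteq> 0 \<and> (\<forall>s\<in>I. \<kappa> s = k))"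
  unfolding riemannian_circle_def using signed_curvature_eq by metis

text \<open>Taking the inner product with \<open>n\<close> and cancelling \<open>H\<close>, a
  nonzero constant in the non-geodesic case, identifies \<open>l\<close> with
  \<open>k^2 + 2\<close>. The strict bound requires a point of the cylinder; there is one since
  \<open>I\<close> is nonempty and \<pi> is surjective.\<close>

lemma eigenvalue:
  assumes "\<not> geodesic B I \<gamma> DB" and l: "\<And>q. q \<in> points S \<Longrightarrow> frame_laplacian S M D t xi HH q = l *\<^sub>T HH q"
  shows "(\<forall>q\<in>points S. l = 4 * (H q)\<^sup>2 + 2) \<and> l > 2"
proof -
  obtain k where k: "\<And>s. s \<in> I \<Longrightarrow> \<kappa> s = k" using eigen_imp_constant[of l] l by blast
  have k0: "k \<noteq> 0" using assms(1) k by (auto simp: geodesic_iff)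
  have *: "l = k\<^sup>2 + 2" if q: "q \<in> points S" for q
  proof -
    have "g (snd q) (l *\<^sub>T HH q) (n q) = g (snd q) ((k\<^sup>2 + 2) *\<^sub>T HH q) (n q)"
      using constant_imp_eigen[OF k q] l[OF q] by simp
    then show ?thesis
      using q k[OF S_I[OF q]] k0 H_eq[OF q] by (simp add: M.metric_scale_left)
  qed
  obtain q where "q \<in> points S" using I(3) point_over by blast
  from *[OF this] have "l = k\<^sup>2 + 2" .
  moreover have "4 * (H q)\<^sup>2 = k\<^sup>2" if "q \<in> points S" for q
    using k[OF S_I[OF that]] by (simp add: H_eq[OF that] power_divide)
  ultimately show ?thesis
    using k0 by simp
qed

lemma laplacian_eigen:
  "((\<exists>l. \<forall>q\<in>points S. frame_laplacian S M D t xi HH q = l *\<^sub>T HH q) \<longleftrightarrow>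
      geodesic B I \<gamma> DB \<or> riemannian_circle B J I \<gamma> DB)
   \<and> (geodesic B I \<gamma> DB \<longrightarrow> (\<forall>q\<in>points S. frame_laplacian S M D t xi HH q = 0 *\<^sub>T HH q))
   \<and> (riemannian_circle B J I \<gamma> DB \<longrightarrow>
      (\<exists>l. l \<noteq> 0 \<and> (\<forall>q\<in>points S. frame_laplacian S M D t xi HH q = l *\<^sub>T HH q)))
   \<and> (\<forall>l. \<not> geodesic B I \<gamma> DB \<and> (\<forall>q\<in>points S. frame_laplacian S M D t xi HH q = l *\<^sub>T HH q) \<longrightarrow>
      (\<forall>q\<in>points S. l = 4 * (H q)\<^sup>2 + 2) \<and> l > 2)"
proof -
  \<comment> \<open>For vanishing \<kappa> the factor supplied is 2, but \<open>HH\<close> is zero,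
    so 0 serves as well.\<close>
  have geo: "frame_laplacian S M D t xi HH q = 0 *\<^sub>T HH q"
    if "geodesic B I \<gamma> DB" "q \<in> points S" for q
    using that constant_imp_eigen[of 0 q] H_eq[of q] S_I[of q] by (simp add: geodesic_iff)
  have circ: "\<exists>l. l \<noteq> 0 \<and> (\<forall>q\<in>points S. frame_laplacian S M D t xi HH q = l *\<^sub>T HH q)"
    if circle: "riemannian_circle B J I \<gamma> DB"
  proof -
    obtain k where "\<And>s. s \<in> I \<Longrightarrow> \<kappa> s = k" using circle by (auto simp: circle_iff)
    from constant_imp_eigen[OF this] show ?thesis
      by (intro exI[of _ "k\<^sup>2 + 2"]) (auto simp: add_nonneg_eq_0_iff)
  qed
  have "geodesic B I \<gamma> DB \<or> riemannian_circle B J I \<gamma> DB"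
    if l: "\<And>q. q \<in> points S \<Longrightarrow> frame_laplacian S M D t xi HH q = l *\<^sub>T HH q" for l
  proof -
    obtain k where "\<And>s. s \<in> I \<Longrightarrow> \<kappa> s = k" using eigen_imp_constant[of l] l by blast
    then show ?thesis by (auto simp: geodesic_iff circle_iff)
  qed
  with geo circ eigenvalue show ?thesis by blast
qed

end

theorem theorem2p1:
  fixes A :: "('m::{t2_space, second_countable_topology}, real ^ 3) atlas"
    and AB :: "('b::{t2_space, second_countable_topology}, real ^ 2) atlas"
    and M :: "'m smooth_space" and B :: "'b smooth_space"
    and \<eta> :: "'m \<Rightarrow> 'm tvec \<Rightarrow> real" and \<xi> :: "'m field"
    and \<phi> :: "'m \<Rightarrow> 'm tvec \<Rightarrow> 'm tvec" and g :: "'m \<Rightarrow> 'm tvec \<Rightarrow> 'm tvec \<Rightarrow> real"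
    and nabla :: "'m \<Rightarrow> 'm tvec \<Rightarrow> 'm field \<Rightarrow> 'm tvec"
    and \<Phi> :: "real \<Rightarrow> 'm \<Rightarrow> 'm" and \<pi> :: "'m \<Rightarrow> 'b"
    and gB :: "'b \<Rightarrow> 'b tvec \<Rightarrow> 'b tvec \<Rightarrow> real" and J :: "'b \<Rightarrow> 'b tvec \<Rightarrow> 'b tvec"
    and nablaB :: "'b \<Rightarrow> 'b tvec \<Rightarrow> 'b field \<Rightarrow> 'b tvec"
    and I :: "real set" and \<gamma> :: "real \<Rightarrow> 'b"
    and DB :: "real \<Rightarrow> real tvec \<Rightarrow> (real \<Rightarrow> 'b tvec) \<Rightarrow> 'b tvec"
    and S :: "(real \<times> 'm) smooth_space"
    and D :: "real \<times> 'm \<Rightarrow> (real \<times> 'm) tvec \<Rightarrow> (real \<times> 'm \<Rightarrow> 'm tvec) \<Rightarrow> 'm tvec"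
    and t n xi HH \<Delta>HH :: "real \<times> 'm \<Rightarrow> 'm tvec" and H :: "real \<times> 'm \<Rightarrow> real"
  assumes "smooth_atlas A" and "M = mfd A"
    and "sasaki_3 M \<eta> \<xi> \<phi> g nabla"
    and "regular_flow A \<xi> g \<Phi>"
    and "smooth_atlas AB" and "B = mfd AB"
    and "boothby_wang M \<xi> \<phi> g \<Phi> B gB J \<pi>"
    and "levi_civita B gB nablaB"
    and "unit_speed_curve B gB I \<gamma>"
    and "induced_connection (submfd real_atlas I) B \<gamma> nablaB DB"
    and "S = hopf_cylinder A \<pi> I \<gamma>"
    and "induced_connection S M snd nabla D"
    and "t = hopf_t M B \<xi> g \<pi> I \<gamma>" and "n = hopf_n M B \<xi> g \<pi> J I \<gamma>" and "xi = \<xi> \<circ> snd"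
    and "H = mean_curvature S M g D t xi n"
    and "HH = (\<lambda>q. H q *\<^sub>T n q)"
    and "\<Delta>HH = frame_laplacian S M D t xi HH"
  shows "((\<exists>l. \<forall>q\<in>points S. \<Delta>HH q = l *\<^sub>T HH q) \<longleftrightarrow>
            geodesic B I \<gamma> DB \<or> riemannian_circle B J I \<gamma> DB)
       \<and> (geodesic B I \<gamma> DB \<longrightarrow> (\<forall>q\<in>points S. \<Delta>HH q = 0 *\<^sub>T HH q))
       \<and> (riemannian_circle B J I \<gamma> DB \<longrightarrow>
            (\<exists>l. l \<noteq> 0 \<and> (\<forall>q\<in>points S. \<Delta>HH q = l *\<^sub>T HH q)))
       \<and> (\<forall>l. \<not> geodesic B I \<gamma> DB \<and> (\<forall>q\<in>points S. \<Delta>HH q = l *\<^sub>T HH q) \<longrightarrow>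
            (\<forall>q\<in>points S. l = 4 * (H q)\<^sup>2 + 2) \<and> l > 2)"
proof -
  interpret h: hopf A AB \<eta> \<xi> \<phi> g nabla \<Phi> \<pi> gB J nablaB I \<gamma> DB D
    using assms(1,3-5,7-10,12) unfolding assms(2,6,11)
    by (intro hopf.intro boothby_wang_fibering.intro hopf_axioms.intro)
  have "h.L (curve_p1 (mfd AB) I \<gamma>) = hopf_t (mfd A) (mfd AB) \<xi> g \<pi> I \<gamma>"
    "h.L (curve_p2 (mfd AB) J I \<gamma>) = hopf_n (mfd A) (mfd AB) \<xi> g \<pi> J I \<gamma>"
    by (auto simp: h.L_def[abs_def] h.lift_def hopf_t_def hopf_n_def)
  note main = h.laplacian_eigen[unfolded this]
  show ?thesis
    unfolding assms(18) assms(17) assms(16) assms(15) assms(14) assms(13) assms(11) assms(6) assms(2)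
    by (rule main)
qed

end
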